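(* Let $d\ge 3$ be a fixed integer and let $\alpha>0$. Let $X=A\odot W$ be the $n\times n$ weighted random $d$-regular graph whose edge-weights are i.i.d. Weibull random variables with shape parameter $\alpha$. Then there exists a continuous function $h_d:(2,\infty)\to(1,\infty)$ such that $$\lim_{n\to\infty}\frac{\lambda_1(X)}{(\log n)^{1/\alpha}}=\begin{cases}1, & 0<\alpha\le 2,\\ h_d(\alpha), & \alpha>2,\end{cases}$$ in probability. The function $h_d$ is given by $$h_d(\alpha)=2\cdot\sup_{\mathbf u=(u_i)_{i\in V(\mathbb T_d)},\ \|\mathbf u\|_1=1}\Big(\sum_{(i,j)\in E(\mathbb T_d)}|u_iu_j|^{\frac{\alpha}{2(\alpha-1)}}\Big)^{\frac{\alpha-1}{\alpha}},\qquad \alpha>2,$$ and it satisfies $\lim_{\alpha\downarrow 2}h_d(\alpha)=1$ and $\lim_{\alpha\to\infty}h_d(\alpha)=2\sqrt{d-1}$.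
   Context: $\mathbb T_d$ is the infinite $d$-regular tree, with vertex set $V(\mathbb T_d)$ and set of undirected edges $E(\mathbb T_d)$ (each edge counted once); $\|\mathbf u\|_1=\sum_i|u_i|$, $u_i \in \mathbb R$. Random $d$-regular graph: a graph chosen uniformly from the set of simple $d$-regular graphs with vertex set $[n]=\{1,\dots,n\}$ ($n$ ranges over integers for which this set is nonempty, i.e. $n>d$ and $nd$ even). $A=(A_{ij})$ is its (symmetric $0/1$, zero-diagonal) adjacency matrix. $W=(W_{ij})_{i,j\in[n]}$ is a symmetric random matrix independent of $A$, with $\{W_{ij}\}_{1\le i<j\le n}$ i.i.d.; $X_{ij}=A_{ij}W_{ij}$. The common law of the $W_{ij}$ ($i<j$) does not depend on $n$ and is Weibull with shape parameter $\alpha>0$ in the following sense: there are constants $C_1,C_2>0$ such that for all $t\ge 1$, $$\tfrac{C_1}{2}e^{-t^\alpha}\le\mathbb P(W_{ij}\ge t)\le\tfrac{C_2}{2}e^{-t^\alpha}\quad\text{and}\quad \tfrac{C_1}{2}e^{-t^\alpha}\le\mathbb P(W_{ij}\le -t)\le\tfrac{C_2}{2}e^{-t^\alpha}.$$ $\lambda_1(X)$ denotes the largest eigenvalue of the symmetric matrix $X$. *)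

theory Defs
  imports "HOL-Probability.Probability" "Jordan_Normal_Form.Spectral_Radius"
begin

text \<open>
  The infinite \<open>d\<close>-regular tree, realised as the Cayley graph of the free product of \<open>d\<close> copies
  of \<open>\<int>/2\<close>: vertices are reduced words, and every word is joined to its one-letter extensions.
  Thus the root \<open>[]\<close> has \<open>d\<close> children, every other vertex \<open>v\<close> has the parent \<open>tl v\<close>
  and \<open>d - 1\<close> children.
\<close>

definition tree_verts :: "nat \<Rightarrow> nat list set" where
  "tree_verts d = {v. set v \<subseteq> {..<d} \<and> distinct_adj v}"

definition tree_edges :: "nat \<Rightarrow> nat list set set" where
  "tree_edges d = {{v, a # v} | a v. a # v \<in> tree_verts d}"

lemma tree_verts_Cons:
  "a # v \<in> tree_verts d \<longleftrightarrow> a < d \<and> v \<in> tree_verts d \<and> (v \<noteq> [] \<longrightarrow> a \<noteq> hd v)"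
  by (cases v) (auto simp: tree_verts_def)

lemma card_incident_tree_edges:
  assumes v: "v \<in> tree_verts d"
  shows "card {e \<in> tree_edges d. v \<in> e} = d"
proof -
  define C where "C = {a. a < d \<and> (v \<noteq> [] \<longrightarrow> a \<noteq> hd v)}"
  define P where "P = (if v = [] then {} else {{tl v, v}})"
  have C: "finite C" and inj: "inj_on (\<lambda>a. {v, a # v}) C"
    by (auto simp: C_def inj_on_def doubleton_eq_iff)
  have "{e \<in> tree_edges d. v \<in> e} = (\<lambda>a. {v, a # v}) ` C \<union> P"
  proof (intro equalityI subsetI)
    fix e assume "e \<in> {e \<in> tree_edges d. v \<in> e}"
    then obtain a w where "e = {w, a # w}" "a # w \<in> tree_verts d" "v = w \<or> v = a # w"
      by (auto simp: tree_edges_def)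
    then show "e \<in> (\<lambda>a. {v, a # v}) ` C \<union> P"
      by (auto simp: C_def P_def tree_verts_Cons)
  next
    fix e assume "e \<in> (\<lambda>a. {v, a # v}) ` C \<union> P"
    then consider a where "a \<in> C" "e = {v, a # v}" | "v \<noteq> []" "e = {tl v, v}"
      by (auto simp: P_def split: if_splits)
    then show "e \<in> {e \<in> tree_edges d. v \<in> e}"
    proof cases
      case 1
      with v have "a # v \<in> tree_verts d" by (auto simp: C_def tree_verts_Cons)
      with 1 show ?thesis by (auto simp: tree_edges_def)
    next
      case 2
      then have "e = {tl v, hd v # tl v}" "hd v # tl v \<in> tree_verts d" using v by auto
      then have "e \<in> tree_edges d" unfolding tree_edges_def by blast
      with 2 show ?thesis by auto
    qed
  qed
  moreover have "((\<lambda>a. {v, a # v}) ` C) \<inter> P = {}"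
  proof -
    have "v \<noteq> tl v" if "v \<noteq> []" using that by (cases v) auto
    moreover have "tl v \<noteq> a # v" for a
      by (cases v) (auto dest: arg_cong[where f = length])
    ultimately show ?thesis by (auto simp: P_def doubleton_eq_iff)
  qed
  ultimately have "card {e \<in> tree_edges d. v \<in> e} = card C + card P"
    using C inj by (simp add: card_Un_disjoint card_image P_def)
  moreover have "card C + card P = d"
  proof (cases "v = []")
    case True
    then show ?thesis by (simp add: C_def P_def)
  next
    case False
    then have "C = {..<d} - {hd v}" "hd v < d" using v by (cases v; auto simp: C_def tree_verts_def)+
    then show ?thesis using False by (simp add: P_def)
  qed
  ultimately show ?thesis by simp
qed

text \<open>
  Simple \<open>d\<close>-regular graphs on \<open>n\<close> labelled vertices, given by their edge sets. Vertices are
  labelled \<open>0, \<dots>, n - 1\<close>, in accordance with the row and column indices of matrices.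
\<close>

definition regular_graphs :: "nat \<Rightarrow> nat \<Rightarrow> nat set set set" where
  "regular_graphs d n =
     {E. E \<subseteq> {e. e \<subseteq> {..<n} \<and> card e = 2} \<and> (\<forall>v<n. card {e \<in> E. v \<in> e} = d)}"

definition adjacency :: "nat set set \<Rightarrow> nat \<Rightarrow> nat \<Rightarrow> real" where
  "adjacency E i j = of_bool ({i, j} \<in> E)"

definition weighted_adjacency_mat :: "nat \<Rightarrow> nat set set \<Rightarrow> (nat \<Rightarrow> nat \<Rightarrow> real) \<Rightarrow> real mat" where
  "weighted_adjacency_mat n E w = Matrix.mat n n (\<lambda>(i, j). adjacency E i j * w i j)"

text \<open>
  Meant for symmetric matrices of positive dimension, which have a nonempty finite real spectrum.
\<close>

definition largest_eigenvalue :: "real mat \<Rightarrow> real" where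
  "largest_eigenvalue X = Max (spectrum X)"

definition weibull_law :: "real \<Rightarrow> real measure \<Rightarrow> bool" where
  "weibull_law \<alpha> \<mu> \<longleftrightarrow>
     prob_space \<mu> \<and> sets \<mu> = sets borel \<and>
     (\<exists>C1>0. \<exists>C2>0. \<forall>t\<ge>1.
        measure \<mu> {t..} \<in> {C1 / 2 * exp (- (t powr \<alpha>)) .. C2 / 2 * exp (- (t powr \<alpha>))} \<and>
        measure \<mu> {..-t} \<in> {C1 / 2 * exp (- (t powr \<alpha>)) .. C2 / 2 * exp (- (t powr \<alpha>))})"

text \<open>
  A uniformly random \<open>d\<close>-regular graph \<open>G\<close> together with an independent symmetric matrix \<open>W\<close>
  whose entries above the diagonal are i.i.d. with law \<open>\<mu>\<close>. The law of the diagonal entries is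
  left open.
\<close>

locale weighted_random_regular_graph = prob_space M
  for M :: "'a measure" +
  fixes d n :: nat
    and G :: "'a \<Rightarrow> nat set set"
    and W :: "nat \<Rightarrow> nat \<Rightarrow> 'a \<Rightarrow> real"
    and \<mu> :: "real measure"
  assumes G_measurable: "G \<in> M \<rightarrow>\<^sub>M count_space (regular_graphs d n)"
    and G_uniform:
      "distr M (count_space (regular_graphs d n)) G = uniform_count_measure (regular_graphs d n)"
    and W_measurable: "\<And>i j. i < n \<Longrightarrow> j < n \<Longrightarrow> random_variable borel (W i j)"
    and W_symmetric: "\<And>i j \<omega>. i < n \<Longrightarrow> j < n \<Longrightarrow> \<omega> \<in> space M \<Longrightarrow> W i j \<omega> = W j i \<omega>"
    and W_law: "\<And>i j. i < j \<Longrightarrow> j < n \<Longrightarrow> distr M borel (W i j) = \<mu>"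
    and W_indep: "indep_vars (\<lambda>_. borel) (\<lambda>(i, j). W i j) {(i, j). i < j \<and> j < n}"
    and adjacency_indep_W:
      "indep_var
         (PiM ({..<n} \<times> {..<n}) (\<lambda>_. borel)) (\<lambda>\<omega>. \<lambda>(i, j)\<in>{..<n} \<times> {..<n}. adjacency (G \<omega>) i j)
         (PiM ({..<n} \<times> {..<n}) (\<lambda>_. borel)) (\<lambda>\<omega>. \<lambda>(i, j)\<in>{..<n} \<times> {..<n}. W i j \<omega>)"

text \<open>
  Convergence in probability along a filter, for random variables which may live on different
  probability spaces.
\<close>

definition converges_in_prob ::
    "('i \<Rightarrow> 'a measure) \<Rightarrow> ('i \<Rightarrow> 'a \<Rightarrow> real) \<Rightarrow> real \<Rightarrow> 'i filter \<Rightarrow> bool" where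
  "converges_in_prob M Y L F \<longleftrightarrow>
     (\<forall>\<epsilon>>0. ((\<lambda>n. measure (M n) {\<omega> \<in> space (M n). \<bar>Y n \<omega> - L\<bar> > \<epsilon>}) \<longlongrightarrow> 0) F)"

text \<open>
  The product over an edge \<open>{i, j}\<close> is \<open>\<bar>u i * u j\<bar>\<close>. For \<open>\<alpha> > 2\<close> the exponent
  \<open>p = \<alpha> / (2 * (\<alpha> - 1))\<close> satisfies \<open>2 * p > 1\<close>, so the edge sums converge and are bounded by
  \<open>d / 2\<close>; hence neither \<open>infsum\<close> nor the supremum is degenerate.
\<close>

definition tree_functional :: "nat \<Rightarrow> real \<Rightarrow> (nat list \<Rightarrow> real) \<Rightarrow> real" where
  "tree_functional d \<alpha> u =
     (\<Sum>\<^sub>\<infinity>e\<in>tree_edges d. (\<Prod>i\<in>e. \<bar>u i\<bar>) powr (\<alpha> / (2 * (\<alpha> - 1)))) powr ((\<alpha> - 1) / \<alpha>)"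

definition l1_unit_sphere :: "'v set \<Rightarrow> ('v \<Rightarrow> real) set" where
  "l1_unit_sphere V = {u. ((\<lambda>i. \<bar>u i\<bar>) has_sum 1) V}"

end

theory Submission
  imports Defs "HOL-Real_Asymp.Real_Asymp"
begin

text \<open>
  Only edges of weight at least \<open>\<epsilon> (log n)\<^sup>1\<^sup>/\<^sup>\<alpha>\<close> matter; they form a subcritical percolation whose
  components have bounded size. By a switching argument a labelled graph \<open>F\<close> on \<open>k\<close> vertices lies
  in the random graph with probability at most \<open>(C / n) ^ \<bar>F\<bar>\<close>, and its weights satisfy
  \<open>\<Sum> \<bar>w\<bar>\<^sup>\<alpha> \<ge> T\<close> with probability about \<open>exp (- T)\<close>. The first moment over the \<open>n ^ k\<close> choices
  of the vertices shows that tree components have \<open>\<Sum> \<bar>w\<bar>\<^sup>\<alpha> \<le> (1 + o(1)) log n\<close> and that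
  components with a cycle have \<open>\<Sum> \<bar>w\<bar>\<^sup>\<alpha> = o(log n)\<close>. Hoelder's inequality on a finite tree, embedded
  into the regular tree, then gives the upper bound, with \<open>u i = v i ^ 2\<close> for an eigenvector \<open>v\<close>.

  For the lower bound a nearly optimal finitely supported \<open>u\<close> is pushed forward along the universal
  covering of the graph. As \<open>2 p \<ge> 1\<close> for \<open>p = \<alpha> / (2 (\<alpha> - 1))\<close>, this does not decrease the
  functional, so every \<open>d\<close>-regular graph has a good test vector around each vertex. Among order \<open>n\<close>
  disjoint balls, each carries the weights required by its test vector independently with
  probability of order \<open>n ^ (- 1 + \<eta>)\<close>.

  By Hoelder's inequality the supremum of the edge sums is log-convex in \<open>p\<close>, hence continuous
  on \<open>p > 1/2\<close>; this gives continuity of \<open>h\<close> and the limit at \<open>\<alpha> = 2\<close>, that is \<open>p = 1\<close>.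
\<close>

section \<open>Rayleigh quotients\<close>

text \<open>A weight configuration costs a factor of about exp (- sum of |w|^\<alpha>), and n
  starting points can pay for a cost of log n. The constant is therefore the best quadratic form
  under an l^\<alpha> constraint on the weights. Hoelder duality produces the exponent \<alpha> /
  (\<alpha> - 1), and passing from v to u = v^2 halves it. For \<alpha> \<le> 2 the l^2 norm of the
  weights is at most their l^\<alpha> norm, and spreading the weight over several edges gains
  nothing over a single edge. Balls of a random graph may contain short cycles. Projecting the tree
  onto an arbitrary regular graph avoids any discussion of them in the lower bound: the graph can be
  fixed beforehand and only the independent weights stay random. The upper bound uses a single fact
  about the random graph, the estimate for containing a given edge set, and crude counts of
  subgraphs suffice because their number of vertices stays bounded as n grows. Both tail bounds come
  as a measurable exceptional event together with a rate that does not depend on the probability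
  space.\<close>

lemma compact_function_box:
  fixes S :: "'i \<Rightarrow> real set"
  assumes "\<And>i. compact (S i)"
  shows "compact {u. \<forall>i. u i \<in> S i}"
proof -
  \<comment> \<open>Tychonoff's theorem; the topology of a function type is the product
    topology.\<close>
  have "compactin (product_topology (\<lambda>_. euclidean) UNIV) (PiE UNIV S)"
    using assms by (subst compactin_PiE) (auto simp: compactin_euclidean_iff)
  moreover have "PiE UNIV S = {u. \<forall>i. u i \<in> S i}"
    by auto
  ultimately show ?thesis
    by (simp add: euclidean_product_topology compactin_euclidean_iff)
qed

text \<open>The quadratic form attains its maximum on the compact unit sphere. At a maximiser the
  first variation in every coordinate direction vanishes, which is the eigenvector equation.\<close>

lemma max_rayleigh_quotient:
  fixes a :: "nat \<Rightarrow> nat \<Rightarrow> real"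
  assumes n: "n > 0" and sym: "\<And>i j. i < n \<Longrightarrow> j < n \<Longrightarrow> a i j = a j i"
  shows "\<exists>c u. (\<Sum>i<n. (u i)\<^sup>2) = 1 \<and> (\<forall>i<n. (\<Sum>j<n. a i j * u j) = c * u i) \<and>
    (\<forall>v. (\<Sum>i<n. \<Sum>j<n. a i j * v i * v j) \<le> c * (\<Sum>i<n. (v i)\<^sup>2))"
proof -
  define Q where "Q v = (\<Sum>i<n. \<Sum>j<n. a i j * v i * v j)" for v :: "nat \<Rightarrow> real"
  define N where "N v = (\<Sum>i<n. (v i)\<^sup>2)" for v :: "nat \<Rightarrow> real"
  \<comment> \<open>Coordinates from \<open>n\<close> on are frozen at 0, since otherwise the sphere
    would not be compact in the full function space.\<close>
  define S where "S i = (if i < n then {-1..1} else {0::real})" for i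
  define K where "K = {u. \<forall>i. u i \<in> S i} \<inter> {u. N u = 1}"
  have cN: "continuous_on UNIV N" and cQ: "continuous_on UNIV Q"
    unfolding N_def Q_def by (intro continuous_intros continuous_on_product_coordinates)+
  have "closed {u. N u = 1}"
    using continuous_closed_preimage_constant[OF cN closed_UNIV, of 1] by simp
  moreover have "compact {u. \<forall>i. u i \<in> S i}"
    by (rule compact_function_box) (auto simp: S_def)
  ultimately have "compact K"
    unfolding K_def by (rule compact_Int_closed[rotated])
  moreover have "K \<noteq> {}"
  proof -
    have "(\<lambda>i. if i = 0 then 1 else 0) \<in> K"
      using n unfolding K_def N_def S_def by (auto simp: if_distrib[of "\<lambda>x. x ^ 2"] sum.delta cong: if_cong)
    then show ?thesis by blast
  qed
  ultimately obtain u where u: "u \<in> K" and max: "\<And>v. v \<in> K \<Longrightarrow> Q v \<le> Q u"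
    using continuous_attains_sup[of K Q] continuous_on_subset[OF cQ] by blast
  have Nu: "N u = 1" using u by (simp add: K_def)
  have scale: "Q (\<lambda>i. s * v i) = s\<^sup>2 * Q v" "N (\<lambda>i. s * v i) = s\<^sup>2 * N v" for s v
    by (simp_all add: Q_def N_def sum_distrib_left power2_eq_square mult_ac)
  have le: "Q v \<le> Q u * N v" for v
  proof (cases "N v = 0")
    case True
    then have "v i = 0" if "i < n" for i
      using that unfolding N_def by (subst (asm) sum_nonneg_eq_0_iff) auto
    then show ?thesis using True by (simp add: Q_def)
  next
    case False
    then have pos: "N v > 0"
      unfolding N_def using sum_nonneg[of "{..<n}" "\<lambda>i. (v i)\<^sup>2"] by force
    define s where "s = inverse (sqrt (N v))"
    define w where "w i = (if i < n then s * v i else 0)" for i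
    have Qw: "Q w = s\<^sup>2 * Q v" and Nw: "N w = s\<^sup>2 * N v"
      unfolding scale(1,2)[symmetric] by (simp_all add: Q_def N_def w_def)
    have s2: "s\<^sup>2 * N v = 1"
      using pos by (simp add: s_def power_inverse)
    have "w i \<in> S i" for i
    proof (cases "i < n")
      case True
      have "(w i)\<^sup>2 \<le> N w"
        unfolding N_def using True by (intro member_le_sum) auto
      then have "\<bar>w i\<bar> \<le> 1" using Nw s2 by (simp add: abs_square_le_1)
      then show ?thesis using True by (auto simp: S_def)
    qed (simp add: S_def w_def)
    then have "w \<in> K" using Nw s2 by (simp add: K_def)
    then have "s\<^sup>2 * Q v \<le> Q u" using max Qw by metis
    then have "(s\<^sup>2 * Q v) * N v \<le> Q u * N v" using pos by (intro mult_right_mono) auto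
    moreover have "(s\<^sup>2 * Q v) * N v = Q v" using s2 by (simp add: mult_ac)
    ultimately show ?thesis by simp
  qed
  have "(\<Sum>j<n. a i j * u j) = Q u * u i" if i: "i < n" for i
  proof -
    define b where "b = (\<Sum>j<n. a i j * u j) - Q u * u i"
    define e where "e = (\<lambda>j. if j = i then 1 else 0 :: real)"
    have sume: "(\<Sum>j<n. x j * e j) = x i" for x :: "nat \<Rightarrow> real"
      using i by (simp add: e_def if_distrib[of "(*) _"] sum.delta cong: if_cong)
    have expQ: "Q (\<lambda>j. u j + t * e j) = Q u + 2 * t * (\<Sum>j<n. a i j * u j) + t\<^sup>2 * a i i" for t
    proof -
      have "Q (\<lambda>j. u j + t * e j) = Q u + t * (\<Sum>k<n. \<Sum>j<n. a k j * u k * e j)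
          + t * (\<Sum>k<n. \<Sum>j<n. a k j * e k * u j) + t\<^sup>2 * (\<Sum>k<n. \<Sum>j<n. a k j * e k * e j)"
        by (simp add: Q_def algebra_simps sum.distrib sum_distrib_left power2_eq_square)
      moreover have "(\<Sum>k<n. \<Sum>j<n. a k j * u k * e j) = (\<Sum>j<n. a i j * u j)"
        unfolding sume using i sym by (intro sum.cong) auto
      moreover have "(\<Sum>k<n. \<Sum>j<n. a k j * e k * u j) = (\<Sum>j<n. a i j * u j)"
        using sume[of "\<lambda>k. a k j * u j" for j]
        by (subst sum.swap) (simp add: mult_ac)
      moreover have "(\<Sum>k<n. \<Sum>j<n. a k j * e k * e j) = a i i"
        by (simp add: sume)
      ultimately show ?thesis by simp
    qed
    have expN: "N (\<lambda>j. u j + t * e j) = 1 + 2 * t * u i + t\<^sup>2" for t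
    proof -
      have "N (\<lambda>j. u j + t * e j) = N u + 2 * t * (\<Sum>j<n. u j * e j) + t\<^sup>2 * (\<Sum>j<n. e j * e j)"
        by (simp add: N_def power2_sum algebra_simps sum.distrib sum_distrib_left power2_eq_square)
      moreover have "e i = 1" by (simp add: e_def)
      ultimately show ?thesis using Nu by (simp add: sume)
    qed
    have ineq: "2 * t * b \<le> t\<^sup>2 * (Q u - a i i)" for t
      using le[of "\<lambda>j. u j + t * e j"] unfolding expQ expN b_def by (simp add: algebra_simps)
    have "b = 0"
    proof (rule ccontr)
      assume "b \<noteq> 0"
      \<comment> \<open>A positive upper bound for \<open>Q u - a i i\<close>; the choice t = b / C
        turns \<open>ineq\<close> into 2 b^2 \<le> b^2.\<close>
      define C where "C = \<bar>Q u - a i i\<bar> + 1"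
      have "Q u - a i i \<le> C" unfolding C_def by linarith
      then have "2 * (b / C) * b \<le> (b / C)\<^sup>2 * C"
        using ineq[of "b / C"] mult_left_mono[of "Q u - a i i" C "(b/C)\<^sup>2"] by force
      moreover have "C > 0" by (simp add: C_def)
      ultimately have "2 * b\<^sup>2 \<le> b\<^sup>2" by (simp add: field_simps power2_eq_square)
      with \<open>b \<noteq> 0\<close> show False by simp
    qed
    then show ?thesis by (simp add: b_def)
  qed
  note eig = this
  have le': "(\<Sum>i<n. \<Sum>j<n. a i j * v i * v j) \<le> Q u * (\<Sum>i<n. (v i)\<^sup>2)" for v
    using le[of v] unfolding Q_def[of v] N_def .
  show ?thesis
    using Nu[unfolded N_def] eig le' by (intro exI[of _ "Q u"] exI[of _ u]) simp
qed

lemma quadratic_form_eigenvector: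
  fixes a :: "nat \<Rightarrow> nat \<Rightarrow> real"
  assumes "\<And>i. i < n \<Longrightarrow> (\<Sum>j<n. a i j * w j) = k * w i"
  shows "(\<Sum>i<n. \<Sum>j<n. a i j * w i * w j) = k * (\<Sum>i<n. (w i)\<^sup>2)"
proof -
  have "(\<Sum>j<n. a i j * w i * w j) = k * (w i)\<^sup>2" if "i < n" for i
  proof -
    have "(\<Sum>j<n. a i j * w i * w j) = (\<Sum>j<n. a i j * w j) * w i"
      unfolding sum_distrib_right by (intro sum.cong refl) (rule mult.assoc[THEN trans], simp)
    also have "\<dots> = k * (w i)\<^sup>2"
      unfolding assms[OF that] power2_eq_square by (rule mult.assoc)
    finally show ?thesis .
  qed
  then show ?thesis
    unfolding sum_distrib_left by (intro sum.cong) auto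
qed

text \<open>The maximum of the Rayleigh quotient is itself an eigenvalue, and every eigenvalue is
  the Rayleigh quotient of its eigenvector, so this maximum is the \<open>Max\<close> of the
  spectrum.\<close>

lemma largest_eigenvalue_rayleigh:
  fixes a :: "nat \<Rightarrow> nat \<Rightarrow> real"
  assumes n: "n > 0" and sym: "\<And>i j. i < n \<Longrightarrow> j < n \<Longrightarrow> a i j = a j i"
  defines "X \<equiv> Matrix.mat n n (\<lambda>(i, j). a i j)"
  shows "(\<Sum>i<n. \<Sum>j<n. a i j * v i * v j) \<le> largest_eigenvalue X * (\<Sum>i<n. (v i)\<^sup>2)"
    and "\<exists>u. (\<Sum>i<n. (u i)\<^sup>2) = 1 \<and> (\<Sum>i<n. \<Sum>j<n. a i j * u i * u j) = largest_eigenvalue X"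
proof -
  obtain c u where u: "(\<Sum>i<n. (u i)\<^sup>2) = 1" "\<forall>i<n. (\<Sum>j<n. a i j * u j) = c * u i"
      and le: "\<forall>v. (\<Sum>i<n. \<Sum>j<n. a i j * v i * v j) \<le> c * (\<Sum>i<n. (v i)\<^sup>2)"
    using max_rayleigh_quotient[where a = a, OF n] sym by auto
  have X: "X \<in> carrier_mat n n" by (simp add: X_def)
  have mult: "X *\<^sub>v Matrix.vec n w = Matrix.vec n (\<lambda>i. \<Sum>j<n. a i j * w j)" for w
    by (rule eq_vecI) (auto simp: X_def mult_mat_vec_def scalar_prod_def atLeast0LessThan)
  have ex: "\<exists>i<n. u i \<noteq> 0"
  proof (rule ccontr)
    assume "\<not> ?thesis"
    then have "(\<Sum>i<n. (u i)\<^sup>2) = 0" by (intro sum.neutral) auto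
    with u(1) show False by simp
  qed
  have "eigenvector X (Matrix.vec n u) c"
    unfolding eigenvector_def mult using X u(2) ex
    by (auto simp: vec_eq_iff)
  then have c: "c \<in> spectrum X"
    by (auto simp: spectrum_def eigenvalue_def)
  have "k \<le> c" if "k \<in> spectrum X" for k
  proof -
    have "\<exists>x. eigenvector X x k"
      using that unfolding spectrum_def eigenvalue_def mem_Collect_eq .
    then obtain x where "eigenvector X x k" ..
    then have x: "x \<in> carrier_vec n" "x \<noteq> 0\<^sub>v n" "X *\<^sub>v x = k \<cdot>\<^sub>v x"
      using X by (auto simp: eigenvector_def)
    define w where "w i = vec_index x i" for i
    have xw: "x = Matrix.vec n w" using x(1) by (auto simp: w_def)
    have "(\<Sum>j<n. a i j * w j) = k * w i" if "i < n" for i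
      using x(3) that unfolding xw mult by (auto simp: vec_eq_iff)
    then have "(\<Sum>i<n. \<Sum>j<n. a i j * w i * w j) = k * (\<Sum>i<n. (w i)\<^sup>2)"
      by (rule quadratic_form_eigenvector)
    moreover have "(\<Sum>i<n. (w i)\<^sup>2) > 0"
    proof -
      obtain i where "i < n" "w i \<noteq> 0" using x(1,2) xw by (auto simp: vec_eq_iff)
      then show ?thesis by (intro sum_pos2[of _ i]) auto
    qed
    ultimately show ?thesis using le[rule_format, of w] by simp
  qed
  then have "largest_eigenvalue X = c"
    unfolding largest_eigenvalue_def using c card_finite_spectrum(1)[OF X] by (intro Max_eqI) auto
  moreover have "(\<Sum>i<n. \<Sum>j<n. a i j * u i * u j) = c * (\<Sum>i<n. (u i)\<^sup>2)"
    using u(2)[rule_format] by (rule quadratic_form_eigenvector)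
  ultimately show "(\<Sum>i<n. \<Sum>j<n. a i j * v i * v j) \<le> largest_eigenvalue X * (\<Sum>i<n. (v i)\<^sup>2)"
    and "\<exists>u. (\<Sum>i<n. (u i)\<^sup>2) = 1 \<and> (\<Sum>i<n. \<Sum>j<n. a i j * u i * u j) = largest_eigenvalue X"
    using le u(1) by auto
qed

section \<open>Switchings in regular graphs\<close>

abbreviation vertex_pairs :: "nat \<Rightarrow> nat set set" where
  "vertex_pairs n \<equiv> {e. e \<subseteq> {..<n} \<and> card e = 2}"

definition nbrs :: "'v set set \<Rightarrow> 'v \<Rightarrow> 'v set" where
  "nbrs E x = {y. {x, y} \<in> E}"

lemma finite_vertex_pairs: "finite (vertex_pairs n)"
  by (rule finite_subset[of _ "Pow {..<n}"]) auto

lemma regular_graphsD: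
  assumes "E \<in> regular_graphs d n"
  shows "E \<subseteq> vertex_pairs n" "finite E" "\<And>v. v < n \<Longrightarrow> card {e \<in> E. v \<in> e} = d"
  using assms finite_subset[OF _ finite_vertex_pairs] unfolding regular_graphs_def by auto

lemma finite_regular_graphs: "finite (regular_graphs d n)"
  by (rule finite_subset[of _ "Pow (vertex_pairs n)"])
    (auto simp: regular_graphs_def finite_vertex_pairs simp del: Collect_subset)

lemma regular_graph_edge:
  assumes "E \<in> regular_graphs d n" "{x, y} \<in> E"
  shows "x < n" "y < n" "x \<noteq> y"
  using regular_graphsD(1)[OF assms(1)] assms(2) by auto

lemma nbrs_commute: "y \<in> nbrs E x \<longleftrightarrow> x \<in> nbrs E y"
  by (simp add: nbrs_def insert_commute)

lemma nbrs_bij: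
  assumes "E \<subseteq> {e. card e = 2}"
  shows "bij_betw (\<lambda>y. {x, y}) (nbrs E x) {e \<in> E. x \<in> e}"
proof (rule bij_betwI')
  fix e assume "e \<in> {e \<in> E. x \<in> e}"
  then obtain u v where "e = {u, v}" "x \<in> e" "e \<in> E"
    using assms by (auto simp: card_2_iff)
  then show "\<exists>y\<in>nbrs E x. e = {x, y}"
    by (auto simp: nbrs_def insert_commute)
qed (auto simp: nbrs_def doubleton_eq_iff)

lemma regular_nbrs:
  assumes "E \<in> regular_graphs d n"
  shows "nbrs E x \<subseteq> {..<n}" "finite (nbrs E x)" "x < n \<Longrightarrow> card (nbrs E x) = d"
proof -
  show sub: "nbrs E x \<subseteq> {..<n}"
    using regular_graph_edge[OF assms] by (auto simp: nbrs_def)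
  show "finite (nbrs E x)" by (rule finite_subset[OF sub]) simp
  have "E \<subseteq> {e. card e = 2}" using regular_graphsD(1)[OF assms] by auto
  from bij_betw_same_card[OF nbrs_bij[OF this]]
  show "x < n \<Longrightarrow> card (nbrs E x) = d"
    using regular_graphsD(3)[OF assms] by auto
qed

lemma card_arcs_regular:
  assumes "E \<in> regular_graphs d n"
  shows "card {(a, b). {a, b} \<in> E} = n * d"
proof -
  have "{(a, b). {a, b} \<in> E} = Sigma {..<n} (nbrs E)"
    using regular_graph_edge[OF assms] by (auto simp: nbrs_def)
  then show ?thesis using regular_nbrs[OF assms] by (simp add: card_SigmaI)
qed

definition switch :: "'v set set \<Rightarrow> 'v \<Rightarrow> 'v \<Rightarrow> 'v \<Rightarrow> 'v \<Rightarrow> 'v set set" where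
  "switch E x y a b = (E - {{x, y}, {a, b}}) \<union> {{x, a}, {y, b}}"

text \<open>Each of the four vertices loses one edge and gains one. The conditions on
  \<open>a\<close>, \<open>b\<close> and the two new edges exclude loops and double edges.\<close>

lemma switch_regular:
  assumes E: "E \<in> regular_graphs d n" and xy: "{x, y} \<in> E" and ab: "{a, b} \<in> E"
    and a: "a \<notin> {x, y}" and b: "b \<notin> {x, y}" and xa: "{x, a} \<notin> E" and yb: "{y, b} \<notin> E"
  shows "switch E x y a b \<in> regular_graphs d n"
proof -
  have lt: "x < n" "y < n" "a < n" "b < n" and ne: "x \<noteq> y" "a \<noteq> b"
    using regular_graph_edge[OF E] xy ab by auto
  have sub: "switch E x y a b \<subseteq> vertex_pairs n"
    using regular_graphsD(1)[OF E] lt a b by (auto simp: switch_def)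
  have "card {e \<in> switch E x y a b. v \<in> e} = d" if v: "v < n" for v
  proof -
    define Out where "Out = {e \<in> {{x, y}, {a, b}}. v \<in> e}"
    define In where "In = {e \<in> {{x, a}, {y, b}}. v \<in> e}"
    have "Out = (if v = x \<or> v = y then {{x, y}} else if v = a \<or> v = b then {{a, b}} else {})"
      unfolding Out_def using a b ne by auto
    moreover have "In = (if v = x \<or> v = a then {{x, a}} else if v = y \<or> v = b then {{y, b}} else {})"
      unfolding In_def using a b ne by auto
    ultimately have OI: "card Out = card In" by simp
    have fin: "finite {e \<in> E. v \<in> e}" "finite Out" "finite In"
      using regular_graphsD(2)[OF E] by (auto simp: Out_def In_def)
    have OE: "Out \<subseteq> {e \<in> E. v \<in> e}" using xy ab by (auto simp: Out_def)
    have "{e \<in> switch E x y a b. v \<in> e} = ({e \<in> E. v \<in> e} - Out) \<union> In"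
      by (auto simp: switch_def Out_def In_def)
    also have "card \<dots> = card ({e \<in> E. v \<in> e} - Out) + card In"
      using fin xa yb by (intro card_Un_disjoint) (auto simp: In_def)
    also have "\<dots> = card {e \<in> E. v \<in> e}"
      using card_Diff_subset[OF fin(2) OE] card_mono[OF fin(1) OE] OI by simp
    finally show ?thesis using regular_graphsD(3)[OF E v] by simp
  qed
  with sub show ?thesis unfolding regular_graphs_def by blast
qed

text \<open>Of the \<open>n * d\<close> arcs, at most 4 d have an end in {x, y}, at most d^2 start
  at a neighbour of x, at most d^2 end at a neighbour of y, and at most 2 \<open>card F\<close> run
  along edges of F.\<close>

lemma card_switchable_arcs:
  assumes E: "E \<in> regular_graphs d n" and lt: "x < n" "y < n" and F: "F \<subseteq> E"
  shows "n * d - (4 * d + 2 * d\<^sup>2 + 2 * card F) \<le>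
    card {(a, b). {a, b} \<in> E - F \<and> a \<notin> {x, y} \<and> b \<notin> {x, y} \<and> {x, a} \<notin> E \<and> {y, b} \<notin> E}"
    (is "_ \<le> card ?good")
proof -
  define D where "D = {(a, b). {a, b} \<in> E}"
  define B1 where "B1 = Sigma {x, y} (nbrs E)"
  define B2 where "B2 = Sigma (nbrs E x) (nbrs E)"
  define B3 where "B3 = Sigma (nbrs E y) (nbrs E)"
  define B4 where "B4 = {(a, b). {a, b} \<in> F}"
  note nb = regular_nbrs[OF E]
  have fF: "finite F" using F regular_graphsD(2)[OF E] finite_subset by blast
  have D: "card D = n * d" unfolding D_def by (rule card_arcs_regular[OF E])
  have finD: "finite D"
    by (rule finite_subset[of _ "{..<n} \<times> {..<n}"]) (use regular_graph_edge[OF E] in \<open>auto simp: D_def\<close>)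
  have f123: "finite B1" "finite B2" "finite B3"
    using nb by (auto simp: B1_def B2_def B3_def)
  have "card B1 = (\<Sum>z\<in>{x, y}. card (nbrs E z))"
    unfolding B1_def using nb(2) by (intro card_SigmaI) auto
  also have "\<dots> \<le> 2 * d"
    using lt nb(3) by (cases "x = y") auto
  finally have c1: "card B1 \<le> 2 * d" .
  have 23: "card (Sigma (nbrs E z) (nbrs E)) \<le> d\<^sup>2" if "z < n" for z
  proof -
    have "card (Sigma (nbrs E z) (nbrs E)) = (\<Sum>w\<in>nbrs E z. card (nbrs E w))"
      using nb(2) by (intro card_SigmaI) auto
    also have "\<dots> = (\<Sum>w\<in>nbrs E z. d)"
      using nb(1,3) by (intro sum.cong) auto
    finally show ?thesis using nb(3)[OF that] by (simp add: power2_eq_square)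
  qed
  \<comment> \<open>An arc is determined by its edge and its orientation, hence the factor
    2.\<close>
  have inj4: "inj_on (\<lambda>(a, b). ({a, b}, a < b)) B4"
  proof (rule inj_onI, clarify)
    fix a b a' b' :: nat
    assume eq: "{a, b} = {a', b'}" and lt: "(a < b) = (a' < b')"
    show "a = a' \<and> b = b'"
    proof (cases "a = a'")
      case False
      then have "a = b'" "b = a'" using eq by (auto simp: doubleton_eq_iff)
      then show ?thesis using lt False by (cases a' b' rule: linorder_cases) auto
    qed (use eq in \<open>auto simp: doubleton_eq_iff\<close>)
  qed
  have im4: "(\<lambda>(a, b). ({a, b}, a < b)) ` B4 \<subseteq> F \<times> UNIV"
    by (auto simp: B4_def)
  have c4: "card B4 \<le> 2 * card F"
    using card_inj_on_le[OF inj4 im4] fF by (simp add: card_cartesian_product)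
  have f4: "finite B4" using inj_on_finite[OF inj4 im4] fF by simp
  define Bad where "Bad = B1 \<union> prod.swap ` B1 \<union> B2 \<union> prod.swap ` B3 \<union> B4"
  have "D - Bad \<subseteq> ?good"
    by (auto simp: D_def Bad_def B1_def B2_def B3_def B4_def nbrs_def image_iff insert_commute)
  moreover have "finite ?good"
    by (rule finite_subset[OF _ finD]) (auto simp: D_def)
  ultimately have "card (D - Bad) \<le> card ?good" by (rule card_mono[rotated])
  moreover have "card D - card Bad \<le> card (D - Bad)"
    using f123 f4 by (intro diff_card_le_card_Diff) (auto simp: Bad_def)
  moreover have "card Bad \<le> card B1 + card (prod.swap ` B1) + card B2 + card (prod.swap ` B3) + card B4"
    unfolding Bad_def by (intro order_trans[OF card_Un_le] add_mono order_refl)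
  moreover have "card (prod.swap ` B1) = card B1" "card (prod.swap ` B3) = card B3"
    by (intro card_image; auto simp: inj_on_def)+
  ultimately show ?thesis
    using D c1 c4 23[OF lt(1)] 23[OF lt(2)] unfolding B2_def[symmetric] B3_def[symmetric] by linarith
qed

text \<open>Double counting of switchings. A graph containing the edge xy, together with a
  switchable arc (a, b), is mapped injectively to the switched graph with the same arc. There a is a
  neighbour of x and b one of y, which leaves at most d^2 arcs per image graph. F survives because
  neither removed edge belongs to it.\<close>

lemma switching_inequality:
  assumes xy: "x \<noteq> y" "x < n" "y < n" "{x, y} \<notin> F"
  shows "card {E \<in> regular_graphs d n. insert {x, y} F \<subseteq> E} * (n * d - (4 * d + 2 * d\<^sup>2 + 2 * card F))
    \<le> card {E \<in> regular_graphs d n. F \<subseteq> E} * d\<^sup>2"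
proof -
  define A where "A = {E \<in> regular_graphs d n. insert {x, y} F \<subseteq> E}"
  define B where "B = {E \<in> regular_graphs d n. F \<subseteq> E}"
  define good where "good E =
    {(a, b). {a, b} \<in> E - F \<and> a \<notin> {x, y} \<and> b \<notin> {x, y} \<and> {x, a} \<notin> E \<and> {y, b} \<notin> E}" for E
  have fin: "finite A" "finite B" using finite_regular_graphs by (auto simp: A_def B_def)
  have finite_good: "finite (good E)" if "E \<in> A" for E
  proof (rule finite_subset[of _ "{..<n} \<times> {..<n}"])
    show "good E \<subseteq> {..<n} \<times> {..<n}"
      using that regular_graph_edge by (auto simp: A_def good_def)
  qed simp
  have "card A * (n * d - (4 * d + 2 * d\<^sup>2 + 2 * card F)) \<le> (\<Sum>E\<in>A. card (good E))"
  proof (rule sum_bounded_below[where 'a = nat, unfolded of_nat_id])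
    fix E assume "E \<in> A"
    then show "n * d - (4 * d + 2 * d\<^sup>2 + 2 * card F) \<le> card (good E)"
      unfolding good_def by (intro card_switchable_arcs xy) (simp_all add: A_def)
  qed
  also have "\<dots> = card (Sigma A good)"
    using fin finite_good by (simp add: card_SigmaI)
  also have "\<dots> \<le> card (Sigma B (\<lambda>E. nbrs E x \<times> nbrs E y))"
  proof (rule card_inj_on_le[of "\<lambda>(E, (a, b)). (switch E x y a b, (a, b))"])
    \<comment> \<open>The switching can be undone once the arc is known.\<close>
    have rec: "E = (switch E x y a b - {{x, a}, {y, b}}) \<union> {{x, y}, {a, b}}"
      if "E \<in> A" "(a, b) \<in> good E" for E a b
      using that by (auto simp: switch_def A_def good_def)
    show "inj_on (\<lambda>(E, (a, b)). (switch E x y a b, (a, b))) (Sigma A good)"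
    proof (rule inj_onI, clarsimp)
      fix E E' a b
      assume *: "E \<in> A" "E' \<in> A" "(a, b) \<in> good E" "(a, b) \<in> good E'"
        "switch E x y a b = switch E' x y a b"
      have "E = (switch E x y a b - {{x, a}, {y, b}}) \<union> {{x, y}, {a, b}}"
        by (rule rec[OF *(1,3)])
      also have "\<dots> = E'"
        unfolding *(5) by (rule rec[OF *(2,4), symmetric])
      finally show "E = E'" .
    qed
    show "(\<lambda>(E, (a, b)). (switch E x y a b, (a, b))) ` Sigma A good \<subseteq> Sigma B (\<lambda>E. nbrs E x \<times> nbrs E y)"
    proof clarsimp
      fix E a b assume E: "E \<in> A" and ab: "(a, b) \<in> good E"
      have "switch E x y a b \<in> regular_graphs d n"
        using E ab by (intro switch_regular) (auto simp: A_def good_def)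
      moreover have "F \<subseteq> switch E x y a b"
        using E ab xy by (auto simp: A_def good_def switch_def)
      ultimately show "switch E x y a b \<in> B \<and> a \<in> nbrs (switch E x y a b) x \<and> b \<in> nbrs (switch E x y a b) y"
        by (auto simp: B_def switch_def nbrs_def)
    qed
    show "finite (Sigma B (\<lambda>E. nbrs E x \<times> nbrs E y))"
      using fin regular_nbrs(2) by (auto simp: B_def)
  qed
  also have "\<dots> = (\<Sum>E\<in>B. card (nbrs E x \<times> nbrs E y))"
    using fin regular_nbrs(2) by (intro card_SigmaI) (auto simp: B_def)
  also have "\<dots> = (\<Sum>E\<in>B. d\<^sup>2)"
    using regular_nbrs(3) xy by (intro sum.cong) (auto simp: B_def card_cartesian_product power2_eq_square)
  finally show ?thesis by (simp add: A_def B_def)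
qed

text \<open>The edges of F are imposed one at a time. The lower bound on n keeps the number of
  unusable arcs below half of \<open>n * d\<close>, so each edge costs a factor 2 d / n.\<close>

lemma card_regular_graphs_containing:
  assumes d: "d > 0" and n: "n \<ge> 8 + 4 * d + 4 * k"
    and F: "F \<subseteq> vertex_pairs n" "card F \<le> k"
  shows "real (card {E \<in> regular_graphs d n. F \<subseteq> E})
    \<le> (2 * real d / real n) ^ card F * real (card (regular_graphs d n))"
proof -
  have "finite F" using F(1) finite_vertex_pairs finite_subset by blast
  then show ?thesis using F
  proof (induction F)
    case (insert e F)
    define R where "R F = real (card {E \<in> regular_graphs d n. F \<subseteq> E})" for F
    from insert.prems obtain x y where e: "e = {x, y}" "x \<noteq> y" "x < n" "y < n"
      by (auto simp: card_2_iff)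
    define b where "b = 4 * d + 2 * d\<^sup>2 + 2 * card F"
    have "card F \<le> k" using insert.prems insert.hyps by simp
    then have "2 * b \<le> 8 * d + 4 * d\<^sup>2 + 4 * k" by (simp add: b_def)
    also have "\<dots> \<le> 8 * d + 4 * d\<^sup>2 + 4 * k * d" using d by simp
    also have "\<dots> = (8 + 4 * d + 4 * k) * d" by (simp add: algebra_simps power2_eq_square)
    also have "\<dots> \<le> n * d" using n by (intro mult_right_mono) auto
    finally have b: "2 * b \<le> n * d" .
    have "R (insert e F) * (real n * d / 2) \<le> R (insert e F) * real (n * d - b)"
    proof (intro mult_left_mono)
      have "real (2 * b) \<le> real (n * d)" using b by (simp only: of_nat_le_iff)
      moreover have "real (n * d - b) = real (n * d) - real b" using b by (intro of_nat_diff) linarith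
      moreover have "z / 2 \<le> z - w" if "2 * w \<le> z" for z w :: real using that by simp
      ultimately show "real n * d / 2 \<le> real (n * d - b)" by (simp only: of_nat_mult of_nat_numeral)
    qed (simp add: R_def)
    also have "\<dots> \<le> R F * real (d\<^sup>2)"
      using switching_inequality[OF e(2-4), of F d] insert.hyps e(1)
      unfolding R_def b_def of_nat_mult[symmetric] of_nat_le_iff by simp
    finally have "R (insert e F) \<le> (2 * real d / real n) * R F"
      using d n by (simp add: field_simps power2_eq_square)
    also have "\<dots> \<le> (2 * real d / real n) * ((2 * real d / real n) ^ card F * real (card (regular_graphs d n)))"
      using insert.IH insert.prems insert.hyps unfolding R_def by (intro mult_left_mono) auto
    finally show ?case using insert.hyps by (simp add: R_def mult_ac)
  qed simp
qed

section \<open>Edge sums on the regular tree\<close>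

lemma sum_powr_le_powr_sum:
  fixes a :: "'i \<Rightarrow> real"
  assumes "\<And>i. i \<in> A \<Longrightarrow> 0 \<le> a i" "1 \<le> q"
  shows "(\<Sum>i\<in>A. a i powr q) \<le> (\<Sum>i\<in>A. a i) powr q"
proof (cases "finite A \<and> sum a A \<noteq> 0")
  case False
  then have "a i = 0" if "i \<in> A" "finite A" for i
    using that assms(1) by (simp add: sum_nonneg_eq_0_iff)
  then show ?thesis by (cases "finite A") auto
next
  case True
  define s where "s = sum a A"
  have s: "s > 0" using True sum_nonneg[of A a] assms(1) by (force simp: s_def)
  have "a i powr q \<le> s powr (q - 1) * a i" if "i \<in> A" for i
  proof (cases "a i = 0")
    case False
    have "a i \<le> s"
      unfolding s_def using True that assms(1) by (intro member_le_sum) auto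
    then have ai: "0 < a i" "a i \<le> s"
      using assms(1)[OF that] False by auto
    have "a i powr q = a i powr (q - 1) * a i"
      using ai by (simp add: powr_diff)
    also have "\<dots> \<le> s powr (q - 1) * a i"
      using ai assms(2) by (intro mult_right_mono powr_mono2) auto
    finally show ?thesis .
  qed simp
  then have "(\<Sum>i\<in>A. a i powr q) \<le> (\<Sum>i\<in>A. s powr (q - 1) * a i)"
    by (rule sum_mono)
  also have "\<dots> = s powr (q - 1) * s"
    by (simp only: sum_distrib_left s_def)
  also have "\<dots> = s powr q"
    using s by (simp add: powr_diff)
  finally show ?thesis by (simp add: s_def)
qed

text \<open>Hoelder's inequality with exponents 1 / a and 1 / b. Scaling both sums to 1 reduces it
  to Young's inequality for each term.\<close>

lemma sum_powr_mult_powr_le: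
  fixes x y :: "'i \<Rightarrow> real"
  assumes nn: "\<And>i. i \<in> A \<Longrightarrow> 0 \<le> x i" "\<And>i. i \<in> A \<Longrightarrow> 0 \<le> y i"
    and ab: "0 < a" "0 < b" "a + b = 1"
  shows "(\<Sum>i\<in>A. x i powr a * y i powr b) \<le> (\<Sum>i\<in>A. x i) powr a * (\<Sum>i\<in>A. y i) powr b"
proof (cases "finite A \<and> sum x A \<noteq> 0 \<and> sum y A \<noteq> 0")
  case False
  then have "x i powr a * y i powr b = 0" if "i \<in> A" "finite A" for i
    using that nn by (auto simp: sum_nonneg_eq_0_iff)
  then show ?thesis by (cases "finite A") auto
next
  case True
  define X where "X = sum x A"
  define Y where "Y = sum y A"
  have pos: "X > 0" "Y > 0"
    using True sum_nonneg[of A x] sum_nonneg[of A y] nn by (force simp: X_def Y_def)+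
  have "x i powr a * y i powr b \<le> X powr a * Y powr b * (a * (x i / X) + b * (y i / Y))"
    if i: "i \<in> A" for i
  proof (cases "x i = 0 \<or> y i = 0")
    case True
    then show ?thesis using nn[OF i] pos ab by auto
  next
    case False
    then have xy: "x i > 0" "y i > 0" using nn[OF i] by auto
    have "(x i / X) powr a * (y i / Y) powr b \<le> a * (x i / X) + b * (y i / Y)"
      using xy pos ab by (intro Youngs_inequality_0) auto
    then have "X powr a * Y powr b * ((x i / X) powr a * (y i / Y) powr b)
        \<le> X powr a * Y powr b * (a * (x i / X) + b * (y i / Y))"
      by (intro mult_left_mono) auto
    then show ?thesis using xy pos by (simp add: powr_divide)
  qed
  then have "(\<Sum>i\<in>A. x i powr a * y i powr b)
      \<le> (\<Sum>i\<in>A. X powr a * Y powr b * (a * (x i / X) + b * (y i / Y)))"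
    by (rule sum_mono)
  also have "\<dots> = X powr a * Y powr b * (a * (sum x A / X) + b * (sum y A / Y))"
    by (simp add: sum_distrib_left[symmetric] sum.distrib sum_divide_distrib[symmetric])
  also have "\<dots> = X powr a * Y powr b"
    using pos ab by (simp add: X_def[symmetric] Y_def[symmetric])
  finally show ?thesis by (simp add: X_def Y_def)
qed

section \<open>Tree edges indexed by their lower endpoints\<close>

lemma tree_edges_eq: "tree_edges d = (\<lambda>w. {tl w, w}) ` (tree_verts d - {[]})"
  unfolding tree_edges_def
proof (intro equalityI subsetI)
  fix e assume "e \<in> {{v, a # v} | a v. a # v \<in> tree_verts d}"
  then obtain a v where "e = {v, a # v}" "a # v \<in> tree_verts d" by auto
  then show "e \<in> (\<lambda>w. {tl w, w}) ` (tree_verts d - {[]})"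
    by (intro image_eqI[of _ _ "a # v"]) auto
next
  fix e assume "e \<in> (\<lambda>w. {tl w, w}) ` (tree_verts d - {[]})"
  then obtain w where "e = {tl w, w}" "w \<in> tree_verts d" "w \<noteq> []" by auto
  then show "e \<in> {{v, a # v} | a v. a # v \<in> tree_verts d}"
    by (cases w) auto
qed

lemma tl_neq: "w \<noteq> [] \<Longrightarrow> tl w \<noteq> w"
  by (cases w) auto

lemma tl_in_tree_verts: "w \<in> tree_verts d \<Longrightarrow> tl w \<in> tree_verts d"
  by (cases w) (auto simp: tree_verts_Cons)

lemma inj_on_parent_edge: "inj_on (\<lambda>w. {tl w, w}) (- {[]})"
proof (rule inj_onI)
  fix v w :: "'a list"
  assume ne: "v \<in> - {[]}" "w \<in> - {[]}" and "{tl v, v} = {tl w, w}"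
  then consider "v = w" | "tl v = w" "tl w = v" by (auto simp: doubleton_eq_iff)
  then show "v = w"
  proof cases
    case 2
    moreover have "length v = Suc (length (tl v))" "length w = Suc (length (tl w))"
      using ne by auto
    ultimately show ?thesis by simp
  qed
qed

lemma prod_parent_edge: "w \<noteq> [] \<Longrightarrow> prod u {tl w, w} = u (tl w) * u w"
  using tl_neq by (subst prod.insert) auto

text \<open>Turns edge sums into sums over non-root words, where each word stands for the edge to
  its parent. The arbitrary \<open>f\<close> lets one statement serve square roots as well as plain
  products.\<close>

lemma tree_edge_set_children:
  assumes "finite F" "F \<subseteq> tree_edges d"
  shows "\<exists>C. finite C \<and> C \<subseteq> tree_verts d - {[]} \<and> \<Union>F = C \<union> tl ` C \<and>
    (\<forall>(f :: real \<Rightarrow> real) u. (\<Sum>e\<in>F. f (prod u e)) = (\<Sum>w\<in>C. f (u (tl w) * u w)))"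
proof -
  obtain C where C: "C \<subseteq> tree_verts d - {[]}" "F = (\<lambda>w. {tl w, w}) ` C"
    using assms(2) unfolding tree_edges_eq by (auto simp: subset_image_iff)
  have inj: "inj_on (\<lambda>w. {tl w, w}) C"
    using C(1) by (intro inj_on_subset[OF inj_on_parent_edge]) auto
  have "finite C" using inj assms(1) C(2) finite_image_iff by blast
  moreover have "(\<Sum>e\<in>F. f (prod u e)) = (\<Sum>w\<in>C. f (u (tl w) * u w))" for f :: "real \<Rightarrow> real" and u
  proof -
    have "(\<Sum>e\<in>F. f (prod u e)) = (\<Sum>w\<in>C. f (prod u {tl w, w}))"
      unfolding C(2) using sum.reindex[OF inj] by simp
    also have "\<dots> = (\<Sum>w\<in>C. f (u (tl w) * u w))"
      using C(1) by (intro sum.cong refl arg_cong[of _ _ f] prod_parent_edge) auto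
    finally show ?thesis .
  qed
  moreover have "\<Union>F = C \<union> tl ` C" using C(2) by auto
  ultimately show ?thesis using C(1) by blast
qed

lemma card_children_le:
  assumes "finite C" "C \<subseteq> tree_verts d - {[]}"
  shows "card {w \<in> C. tl w = x} \<le> (if x = [] then d else d - 1)"
proof -
  define L where "L = (if x = [] then {..<d} else {..<d} - {hd x})"
  have "card {w \<in> C. tl w = x} \<le> card L"
  proof (rule card_inj_on_le[of hd])
    show "inj_on hd {w \<in> C. tl w = x}"
      using assms(2) by (auto simp: inj_on_def intro: list.expand)
    have "hd w \<in> L" if "w \<in> C" "tl w = x" for w
      using that assms(2) by (cases w) (auto simp: L_def tree_verts_Cons)
    then show "hd ` {w \<in> C. tl w = x} \<subseteq> L" by blast
  qed (auto simp: L_def)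
  moreover have "card L \<le> (if x = [] then d else d - 1)" if "w \<in> C" "tl w = x" for w
  proof (cases x)
    case (Cons a y)
    have "x \<in> tree_verts d" using that assms(2) tl_in_tree_verts by blast
    then have "a < d" using Cons by (simp add: tree_verts_Cons)
    then show ?thesis using Cons by (simp add: L_def)
  qed (simp add: L_def)
  moreover have "card {w \<in> C. tl w = x} = 0" if "\<not> (\<exists>w. w \<in> C \<and> tl w = x)"
    using that by (metis (mono_tags, lifting) card.empty empty_Collect_eq)
  ultimately show ?thesis
    by (cases "\<exists>w. w \<in> C \<and> tl w = x") (blast intro: order_trans, simp)
qed

text \<open>
  Weighted AM-GM over the edges: the factor \<open>s = \<surd>(d - 1)\<close> balances the \<open>d - 1\<close> children of a
  vertex against its single parent.
\<close>

lemma sum_sqrt_tree_edges_le: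
  assumes d: "d \<ge> 2" and F: "finite F" "F \<subseteq> tree_edges d" and V: "finite V" "\<Union>F \<subseteq> V"
    and u: "\<And>i. 0 \<le> u i"
  shows "(\<Sum>e\<in>F. sqrt (prod u e)) \<le> sqrt (real d - 1) * (\<Sum>i\<in>V. u i)"
proof -
  obtain C where C: "finite C" "C \<subseteq> tree_verts d - {[]}" "\<Union>F = C \<union> tl ` C"
    and sum': "\<forall>(f :: real \<Rightarrow> real) u. (\<Sum>e\<in>F. f (prod u e)) = (\<Sum>w\<in>C. f (u (tl w) * u w))"
    using tree_edge_set_children[OF F] by (elim exE conjE)
  have sum: "(\<Sum>e\<in>F. sqrt (prod u e)) = (\<Sum>w\<in>C. sqrt (u (tl w) * u w))"
    using sum' by simp
  define s where "s = sqrt (real d - 1)"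
  have s: "s > 0" "s\<^sup>2 = real d - 1" using d by (auto simp: s_def)
  have "sqrt (u (tl w) * u w) \<le> (u (tl w) / s + s * u w) / 2" for w
  proof -
    have "sqrt ((u (tl w) / s) * (s * u w)) \<le> (u (tl w) / s + s * u w) / 2"
      using s u by (intro arith_geo_mean_sqrt) auto
    then show ?thesis using s by simp
  qed
  then have "(\<Sum>w\<in>C. sqrt (u (tl w) * u w)) \<le> (\<Sum>w\<in>C. (u (tl w) / s + s * u w) / 2)"
    by (intro sum_mono)
  also have "\<dots> = ((\<Sum>w\<in>C. u (tl w)) / s + s * (\<Sum>w\<in>C. u w)) / 2"
    unfolding sum_divide_distrib[symmetric] sum.distrib sum_distrib_left[symmetric] ..
  also have "(\<Sum>w\<in>C. u (tl w)) = (\<Sum>x\<in>V. (\<Sum>w\<in>{w \<in> C. tl w = x}. u (tl w)))"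
    using C V by (intro sum.group[symmetric]) auto
  also have "\<dots> = (\<Sum>x\<in>V. real (card {w \<in> C. tl w = x}) * u x)"
    by (intro sum.cong) auto
  also have "(\<Sum>w\<in>C. u w) = (\<Sum>x\<in>V. of_bool (x \<in> C) * u x)"
    using C V by (intro sum.mono_neutral_cong_left) auto
  also have "((\<Sum>x\<in>V. real (card {w \<in> C. tl w = x}) * u x) / s + s * (\<Sum>x\<in>V. of_bool (x \<in> C) * u x)) / 2
    = (\<Sum>x\<in>V. (real (card {w \<in> C. tl w = x}) / s + s * of_bool (x \<in> C)) / 2 * u x)"
  proof -
    have "(\<Sum>x\<in>V. (real (card {w \<in> C. tl w = x}) / s + s * of_bool (x \<in> C)) / 2 * u x) =
      (\<Sum>x\<in>V. (real (card {w \<in> C. tl w = x}) * u x / s + s * (of_bool (x \<in> C) * u x)) / 2)"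
      by (intro sum.cong refl) (simp add: algebra_simps add_divide_distrib)
    then show ?thesis
      unfolding sum_divide_distrib[symmetric] sum.distrib sum_distrib_left[symmetric] by simp
  qed
  also have "\<dots> \<le> (\<Sum>x\<in>V. s * u x)"
  proof (intro sum_mono mult_right_mono u)
    fix x
    define c where "c = real (card {w \<in> C. tl w = x})"
    \<comment> \<open>A non-root vertex has at most d - 1 children and one parent edge, which counts
      s^2 = d - 1. The root has no parent edge, and its d children are affordable because d \<le> 2
      (d - 1).\<close>
    have "c + s\<^sup>2 * of_bool (x \<in> C) \<le> 2 * s\<^sup>2"
    proof (cases "x = []")
      case True
      then show ?thesis using card_children_le[OF C(1,2), of x] C(2) d s(2) by (auto simp: c_def)
    next
      case False
      have "c \<le> real (d - 1)"
        using card_children_le[OF C(1,2), of x] False unfolding c_def of_nat_le_iff by auto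
      then have "c \<le> s\<^sup>2" using d s(2) by (simp add: of_nat_diff)
      moreover have "s\<^sup>2 * of_bool (x \<in> C) \<le> s\<^sup>2" by auto
      ultimately show ?thesis by linarith
    qed
    then show "(c / s + s * of_bool (x \<in> C)) / 2 \<le> s"
      using s(1) by (simp add: field_simps power2_eq_square)
  qed
  finally show ?thesis by (simp add: sum s_def sum_distrib_left)
qed

text \<open>The tree is bipartite by parity of the word length. The edge sum is therefore at most
  the product of the even and the odd mass, which is largest when both are half of the
  total.\<close>

lemma sum_prod_tree_edges_le:
  fixes u :: "nat list \<Rightarrow> real"
  assumes F: "finite F" "F \<subseteq> tree_edges d" and V: "finite V" "\<Union>F \<subseteq> V" and u: "\<And>i. 0 \<le> u i"
  shows "(\<Sum>e\<in>F. prod u e) \<le> (\<Sum>i\<in>V. u i)\<^sup>2 / 4"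
proof -
  obtain C where C: "finite C" "C \<subseteq> tree_verts d - {[]}" "\<Union>F = C \<union> tl ` C"
    and sum': "\<forall>(f :: real \<Rightarrow> real) u. (\<Sum>e\<in>F. f (prod u e)) = (\<Sum>w\<in>C. f (u (tl w) * u w))"
    using tree_edge_set_children[OF F] by (elim exE conjE)
  have sum: "(\<Sum>e\<in>F. prod u e) = (\<Sum>w\<in>C. u (tl w) * u w)"
    using sum'[THEN spec, of "\<lambda>x. x"] by simp
  define A where "A = {v \<in> V. even (length v)}"
  define B where "B = {v \<in> V. odd (length v)}"
  define g where "g w = (if even (length w) then (w, tl w) else (tl w, w))" for w :: "nat list"
  have inj: "inj_on g C"
  proof (rule inj_onI)
    fix v w assume "v \<in> C" "w \<in> C" "g v = g w"
    then have "{tl v, v} = {tl w, w}" by (auto simp: g_def split: if_splits)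
    with \<open>v \<in> C\<close> \<open>w \<in> C\<close> show "v = w"
      using C(2) by (intro inj_onD[OF inj_on_parent_edge]) auto
  qed
  have "(\<Sum>w\<in>C. u (tl w) * u w) = (\<Sum>w\<in>C. (\<lambda>(a, b). u a * u b) (g w))"
    by (intro sum.cong) (auto simp: g_def)
  also have "\<dots> = (\<Sum>(a, b)\<in>g ` C. u a * u b)"
    using sum.reindex[OF inj, of "\<lambda>(a, b). u a * u b"] by simp
  also have "\<dots> \<le> (\<Sum>(a, b)\<in>A \<times> B. u a * u b)"
  proof (rule sum_mono2)
    show "finite (A \<times> B)" using V by (auto simp: A_def B_def)
    show "g ` C \<subseteq> A \<times> B"
    proof
      fix z assume "z \<in> g ` C"
      then obtain w where w: "w \<in> C" "z = g w" by auto
      then have "w \<noteq> []" "w \<in> V" "tl w \<in> V" using C V by auto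
      with w show "z \<in> A \<times> B"
        by (cases w) (auto simp: g_def A_def B_def split: if_splits)
    qed
    show "0 \<le> (case z of (a, b) \<Rightarrow> u a * u b)" for z
      using u by (cases z) simp
  qed
  also have "\<dots> = (\<Sum>a\<in>A. u a) * (\<Sum>b\<in>B. u b)"
    by (simp add: sum_product sum.cartesian_product)
  also have "\<dots> \<le> ((\<Sum>a\<in>A. u a) + (\<Sum>b\<in>B. u b))\<^sup>2 / 4"
  proof -
    have "x * y \<le> (x + y)\<^sup>2 / 4" for x y :: real
      using zero_le_power2[of "x - y"] by (simp add: power2_eq_square algebra_simps)
    then show ?thesis .
  qed
  also have "\<dots> = (\<Sum>i\<in>V. u i)\<^sup>2 / 4"
  proof -
    have "sum u (A \<union> B) = sum u A + sum u B"
      using V by (intro sum.union_disjoint) (auto simp: A_def B_def)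
    moreover have "A \<union> B = V" by (auto simp: A_def B_def)
    ultimately show ?thesis by metis
  qed
  finally show ?thesis unfolding sum .
qed

section \<open>The supremum of the edge sums as a function of the exponent\<close>

text \<open>Finite edge sets replace the infinite sums of \<open>tree_functional\<close>. Mass at
  most 1, rather than exactly 1, makes the set stable under restricting a function; the supremum is
  unaffected because missing mass can be added at the root.\<close>

definition tree_sums :: "nat \<Rightarrow> real \<Rightarrow> real set" where
  "tree_sums d p = {\<Sum>e\<in>F. prod u e powr p | F u.
     finite F \<and> F \<subseteq> tree_edges d \<and> (\<forall>i. 0 \<le> u i) \<and> (\<Sum>i\<in>\<Union>F. u i) \<le> 1}"

definition tree_max :: "nat \<Rightarrow> real \<Rightarrow> real" where
  "tree_max d p = Sup (tree_sums d p)"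

lemma tree_sumsI:
  "finite F \<Longrightarrow> F \<subseteq> tree_edges d \<Longrightarrow> (\<And>i. 0 \<le> u i) \<Longrightarrow> (\<Sum>i\<in>\<Union>F. u i) \<le> 1 \<Longrightarrow>
    (\<Sum>e\<in>F. prod u e powr p) \<in> tree_sums d p"
  unfolding tree_sums_def by blast

lemma tree_sumsE:
  assumes "s \<in> tree_sums d p"
  obtains F u where "finite F" "F \<subseteq> tree_edges d" "\<And>i. 0 \<le> u i" "(\<Sum>i\<in>\<Union>F. u i) \<le> 1"
    "s = (\<Sum>e\<in>F. prod u e powr p)"
  using assms unfolding tree_sums_def by blast

lemma finite_Union_tree_edges: "finite F \<Longrightarrow> F \<subseteq> tree_edges d \<Longrightarrow> finite (\<Union>F)"
  by (auto simp: tree_edges_def)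

text \<open>With x^p = (sqrt x)^(2 p) and 2 p \<ge> 1, superadditivity of the power reduces the
  bound to the case p = 1/2.\<close>

lemma tree_sums_le_powr:
  assumes d: "d \<ge> 2" and p: "p \<ge> 1/2" and s: "s \<in> tree_sums d p"
  shows "s \<le> sqrt (real d - 1) powr (2 * p)"
  using s
proof (rule tree_sumsE)
  fix F u assume F: "finite F" "F \<subseteq> tree_edges d" and u: "\<And>i. 0 \<le> u i" "(\<Sum>i\<in>\<Union>F. u i) \<le> 1"
    and s: "s = (\<Sum>e\<in>F. prod u e powr p)"
  have nn: "0 \<le> prod u e" for e using u(1) by (simp add: prod_nonneg)
  have "s = (\<Sum>e\<in>F. sqrt (prod u e) powr (2 * p))"
    unfolding s using nn by (intro sum.cong refl) (simp add: powr_half_sqrt[symmetric] powr_powr)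
  also have "\<dots> \<le> (\<Sum>e\<in>F. sqrt (prod u e)) powr (2 * p)"
    using p nn by (intro sum_powr_le_powr_sum) auto
  also have "\<dots> \<le> sqrt (real d - 1) powr (2 * p)"
  proof (intro powr_mono2)
    have "(\<Sum>e\<in>F. sqrt (prod u e)) \<le> sqrt (real d - 1) * (\<Sum>i\<in>\<Union>F. u i)"
      using d F u finite_Union_tree_edges[OF F] by (intro sum_sqrt_tree_edges_le) auto
    also have "\<dots> \<le> sqrt (real d - 1) * 1"
      using u d by (intro mult_left_mono) auto
    finally show "(\<Sum>e\<in>F. sqrt (prod u e)) \<le> sqrt (real d - 1)" by simp
  qed (use p nn in \<open>auto intro: sum_nonneg\<close>)
  finally show ?thesis .
qed

lemma bdd_above_tree_sums: "d \<ge> 2 \<Longrightarrow> p \<ge> 1/2 \<Longrightarrow> bdd_above (tree_sums d p)"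
  using tree_sums_le_powr by (meson bdd_aboveI)

lemma tree_sums_nonneg: "s \<in> tree_sums d p \<Longrightarrow> 0 \<le> s"
  by (erule tree_sumsE) (simp add: sum_nonneg)

lemma tree_sums_nonempty: "tree_sums d p \<noteq> {}"
proof -
  show ?thesis using tree_sumsI[of "{}" d "\<lambda>_. 0" p] by auto
qed

lemma le_tree_max: "d \<ge> 2 \<Longrightarrow> p \<ge> 1/2 \<Longrightarrow> s \<in> tree_sums d p \<Longrightarrow> s \<le> tree_max d p"
  unfolding tree_max_def by (intro cSup_upper bdd_above_tree_sums)

lemma tree_max_le: "(\<And>s. s \<in> tree_sums d p \<Longrightarrow> s \<le> c) \<Longrightarrow> tree_max d p \<le> c"
  unfolding tree_max_def by (intro cSup_least tree_sums_nonempty)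

lemma tree_max_upper: "d \<ge> 2 \<Longrightarrow> p \<ge> 1/2 \<Longrightarrow> tree_max d p \<le> sqrt (real d - 1) powr (2 * p)"
  by (intro tree_max_le tree_sums_le_powr)

lemma path_edges:
  assumes "d \<ge> 2"
  shows "{[], [0]} \<in> tree_edges d" "{[], [1]} \<in> tree_edges d"
proof -
  have "{[], [a]} \<in> tree_edges d" if "a < d" for a
    unfolding tree_edges_eq using that by (intro image_eqI[of _ _ "[a]"]) (auto simp: tree_verts_def)
  then show "{[], [0]} \<in> tree_edges d" "{[], [1]} \<in> tree_edges d" using assms by auto
qed

lemma tree_max_ge_single_edge:
  assumes d: "d \<ge> 2" and p: "p \<ge> 1/2"
  shows "(1/4) powr p \<le> tree_max d p"
proof -
  define u :: "nat list \<Rightarrow> real" where "u = (\<lambda>_. 1/2)"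
  have "(\<Sum>e\<in>{{[], [0]}}. prod u e powr p) \<in> tree_sums d p"
    using path_edges[OF d] by (intro tree_sumsI) (auto simp: u_def)
  moreover have "(\<Sum>e\<in>{{[], [0]}}. prod u e powr p) = (1/4) powr p"
    by (simp add: u_def)
  ultimately show ?thesis using le_tree_max[OF d p] by metis
qed

text \<open>Splitting the mass 1/2 at one end of an edge equally between two neighbours of the other
  end multiplies the sum by 2^(1 - p), which exceeds 1. This is the source of the strict bound h >
  1.\<close>

lemma tree_max_gt_single_edge:
  assumes d: "d \<ge> 2" and p: "1/2 \<le> p" "p < 1"
  shows "(1/4) powr p < tree_max d p"
proof -
  define u :: "nat list \<Rightarrow> real" where "u = (\<lambda>v. if v = [] then 1/2 else 1/4)"
  define F :: "nat list set set" where "F = {{[], [0]}, {[], [1]}}"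
  have "{[], [0]} \<noteq> {[], [1::nat]}" by (simp add: doubleton_eq_iff)
  then have sum: "(\<Sum>e\<in>F. prod u e powr p) = 2 * (1/8) powr p"
    by (simp add: F_def u_def)
  have "\<Union>F = {[], [0], [1]}" by (auto simp: F_def)
  then have "(\<Sum>i\<in>\<Union>F. u i) \<le> 1" by (simp add: u_def)
  then have "2 * (1/8) powr p \<le> tree_max d p"
    unfolding sum[symmetric] using path_edges[OF d]
    by (intro le_tree_max d p tree_sumsI) (auto simp: u_def F_def)
  moreover have "(1/4) powr p < 2 * (1/8) powr p"
  proof -
    have "(1/4) powr p = 2 powr p * (1/8) powr p"
      by (simp add: powr_mult[symmetric])
    also have "\<dots> < 2 powr 1 * (1/8) powr p"
      using p by (intro mult_strict_right_mono powr_less_mono) auto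
    finally show ?thesis by simp
  qed
  ultimately show ?thesis by simp
qed

lemma tree_max_pos: "d \<ge> 2 \<Longrightarrow> p \<ge> 1/2 \<Longrightarrow> 0 < tree_max d p"
  by (rule less_le_trans[OF _ tree_max_ge_single_edge]) auto

text \<open>The exponent p = 1 corresponds to \<alpha> = 2. There a single edge is optimal, and 2
  (1/4)^(1/2) = 1 matches the limit for smaller \<alpha>.\<close>

lemma tree_max_one:
  assumes d: "d \<ge> 2"
  shows "tree_max d 1 = 1/4"
proof (rule antisym)
  show "tree_max d 1 \<le> 1/4"
  proof (rule tree_max_le)
    fix s assume "s \<in> tree_sums d 1"
    then show "s \<le> 1/4"
    proof (rule tree_sumsE)
      fix F u assume F: "finite F" "F \<subseteq> tree_edges d" and u: "\<And>i. 0 \<le> u i" "(\<Sum>i\<in>\<Union>F. u i) \<le> 1"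
        and s: "s = (\<Sum>e\<in>F. prod u e powr 1)"
      have "s = (\<Sum>e\<in>F. prod u e)"
        unfolding s using u by (simp add: prod_nonneg)
      also have "\<dots> \<le> (\<Sum>i\<in>\<Union>F. u i)\<^sup>2 / 4"
        using F u finite_Union_tree_edges[OF F] by (intro sum_prod_tree_edges_le) auto
      also have "\<dots> \<le> 1 / 4"
        using u by (simp add: power_le_one sum_nonneg)
      finally show ?thesis .
    qed
  qed
  show "1/4 \<le> tree_max d 1" using tree_max_ge_single_edge[OF d, of 1] by simp
qed

text \<open>Homogeneity: an edge product has degree 2, so the edge sum has degree 2 p and can be
  rescaled to total mass 1.\<close>

lemma sum_prod_powr_le_tree_max:
  assumes d: "d \<ge> 2" and p: "p \<ge> 1/2" and F: "finite F" "F \<subseteq> tree_edges d"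
    and V: "finite V" "\<Union>F \<subseteq> V" and u: "\<And>i. 0 \<le> u i"
  shows "(\<Sum>e\<in>F. prod u e powr p) \<le> tree_max d p * (\<Sum>i\<in>V. u i) powr (2 * p)"
proof -
  define S where "S = (\<Sum>i\<in>V. u i)"
  have card2: "e \<subseteq> V \<and> card e = 2" if "e \<in> F" for e
  proof -
    obtain w where "e = {tl w, w}" "w \<noteq> []" using \<open>e \<in> F\<close> F(2) unfolding tree_edges_eq by blast
    then have "card e = 2" using tl_neq by (auto simp: card_2_iff)
    with \<open>e \<in> F\<close> V(2) show ?thesis by blast
  qed
  show ?thesis
  proof (cases "S = 0")
    case True
    then have zero: "u i = 0" if "i \<in> V" for i
      using that V u by (simp add: S_def sum_nonneg_eq_0_iff)
    have "prod u e = 0" if e: "e \<in> F" for e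
    proof -
      obtain x y where "e = {x, y}" using card2[OF e] unfolding card_2_iff by blast
      then have "x \<in> e" "finite e" "u x = 0" using zero[of x] card2[OF e] by auto
      then show ?thesis by (metis prod_zero)
    qed
    then show ?thesis using True by (simp add: S_def)
  next
    case False
    then have S: "S > 0" using u sum_nonneg[of V u] by (force simp: S_def)
    define w where "w i = u i / S" for i
    have "prod w e powr p = S powr (- 2 * p) * prod u e powr p" if "e \<in> F" for e
    proof -
      have "prod w e = prod u e / S ^ card e" unfolding w_def by (simp add: prod_dividef)
      also have "\<dots> = S powr (- 2) * prod u e"
        using S card2[OF that] by (simp add: powr_minus divide_simps powr_numeral)
      finally show ?thesis
        using u S by (simp add: powr_mult powr_powr prod_nonneg)
    qed
    then have "(\<Sum>e\<in>F. prod w e powr p) = S powr (- 2 * p) * (\<Sum>e\<in>F. prod u e powr p)"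
      by (simp add: sum_distrib_left)
    moreover have "(\<Sum>e\<in>F. prod w e powr p) \<le> tree_max d p"
    proof (intro le_tree_max d p tree_sumsI F)
      have "(\<Sum>i\<in>\<Union>F. w i) \<le> (\<Sum>i\<in>V. w i)"
        using V u S by (intro sum_mono2) (auto simp: w_def)
      then show "(\<Sum>i\<in>\<Union>F. w i) \<le> 1"
        using S by (simp add: w_def sum_divide_distrib[symmetric] S_def[symmetric])
    qed (use u S in \<open>simp add: w_def\<close>)
    ultimately have "S powr (- 2 * p) * (\<Sum>e\<in>F. prod u e powr p) \<le> tree_max d p" by simp
    then have "S powr (2 * p) * (S powr (- 2 * p) * (\<Sum>e\<in>F. prod u e powr p)) \<le> S powr (2 * p) * tree_max d p"
      by (intro mult_left_mono) auto
    moreover have "S powr (2 * p) * S powr (- 2 * p) = 1"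
      using S by (simp add: powr_add[symmetric])
    ultimately have "1 * (\<Sum>e\<in>F. prod u e powr p) \<le> S powr (2 * p) * tree_max d p"
      by (metis mult.assoc)
    then show ?thesis by (simp add: S_def mult.commute)
  qed
qed

lemma tree_max_log_convex:
  assumes d: "d \<ge> 2" and pq: "1/2 \<le> p" "1/2 \<le> q" and ab: "0 < a" "0 < b" "a + b = 1"
  shows "tree_max d (a * p + b * q) \<le> tree_max d p powr a * tree_max d q powr b"
proof (rule tree_max_le)
  fix s assume "s \<in> tree_sums d (a * p + b * q)"
  then show "s \<le> tree_max d p powr a * tree_max d q powr b"
  proof (rule tree_sumsE)
    fix F u assume F: "finite F" "F \<subseteq> tree_edges d" and u: "\<And>i. 0 \<le> u i" "(\<Sum>i\<in>\<Union>F. u i) \<le> 1"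
      and s: "s = (\<Sum>e\<in>F. prod u e powr (a * p + b * q))"
    have "s = (\<Sum>e\<in>F. (prod u e powr p) powr a * (prod u e powr q) powr b)"
      unfolding s by (simp add: powr_powr powr_add mult.commute)
    also have "\<dots> \<le> (\<Sum>e\<in>F. prod u e powr p) powr a * (\<Sum>e\<in>F. prod u e powr q) powr b"
      using ab by (intro sum_powr_mult_powr_le) auto
    also have "\<dots> \<le> tree_max d p powr a * tree_max d q powr b"
      using ab F u by (intro mult_mono powr_mono2 le_tree_max d pq tree_sumsI sum_nonneg) auto
    finally show ?thesis .
  qed
qed

lemma continuous_on_tree_max:
  assumes d: "d \<ge> 2"
  shows "continuous_on {1/2<..} (tree_max d)"
proof -
  have "convex_on {1/2<..} (\<lambda>p. ln (tree_max d p))"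
  proof (rule convex_onI)
    fix t p q :: real
    assume t: "0 < t" "t < 1" and pq: "p \<in> {1/2<..}" "q \<in> {1/2<..}"
    then have pos: "tree_max d p > 0" "tree_max d q > 0" using tree_max_pos[OF d] by auto
    have conv: "(1 - t) * p + t * q \<ge> 1/2"
    proof -
      have "(1 - t) * (1/2) + t * (1/2) \<le> (1 - t) * p + t * q"
        using t pq by (intro add_mono mult_left_mono) auto
      moreover have "(1 - t) * (1/2) + t * (1/2) = 1/2" by (simp add: field_simps)
      ultimately show ?thesis by metis
    qed
    have "ln (tree_max d ((1 - t) * p + t * q)) \<le> ln (tree_max d p powr (1 - t) * tree_max d q powr t)"
      using t pq pos tree_max_pos[OF d conv]
      by (subst ln_le_cancel_iff) (auto intro!: tree_max_log_convex d)
    also have "\<dots> = (1 - t) * ln (tree_max d p) + t * ln (tree_max d q)"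
      using pos by (simp add: ln_mult ln_powr)
    finally show "ln (tree_max d ((1 - t) *\<^sub>R p + t *\<^sub>R q)) \<le> (1 - t) * ln (tree_max d p) + t * ln (tree_max d q)"
      by simp
  qed (rule convex_real_interval)
  then have "continuous_on {1/2<..} (\<lambda>p. exp (ln (tree_max d p)))"
    by (intro continuous_intros convex_on_continuous) auto
  moreover have "exp (ln (tree_max d p)) = tree_max d p" if "p \<in> {1/2<..}" for p
    using tree_max_pos[OF d, of p] that by simp
  ultimately show ?thesis by (simp cong: continuous_on_cong_simp)
qed

section \<open>The growth constant\<close>

text \<open>The supremum of the form 2 \<Sum> t e |v x v y| over edges e = {x, y} of the tree, taken
  over weights t of l^\<alpha> norm 1 and unit vectors v. Optimising t first leaves an l^q norm with
  q = \<alpha> / (\<alpha> - 1), and u = v^2 turns q into p = q / 2; the outer exponent is 1 /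
  q.\<close>

definition growth_const :: "nat \<Rightarrow> real \<Rightarrow> real" where
  "growth_const d \<alpha> = 2 * tree_max d (\<alpha> / (2 * (\<alpha> - 1))) powr ((\<alpha> - 1) / \<alpha>)"

lemma Union_tree_edges_subset: "F \<subseteq> tree_edges d \<Longrightarrow> \<Union>F \<subseteq> tree_verts d"
  unfolding tree_edges_eq using tl_in_tree_verts by fastforce

lemma tree_functional_sums:
  assumes d: "d \<ge> 2" and p: "p \<ge> 1/2" and u: "u \<in> l1_unit_sphere (tree_verts d)"
  shows "finite F \<Longrightarrow> F \<subseteq> tree_edges d \<Longrightarrow> (\<Sum>e\<in>F. (\<Prod>i\<in>e. \<bar>u i\<bar>) powr p) \<le> tree_max d p"
    and "(\<lambda>e. (\<Prod>i\<in>e. \<bar>u i\<bar>) powr p) summable_on tree_edges d"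
    and "(\<Sum>\<^sub>\<infinity>e\<in>tree_edges d. (\<Prod>i\<in>e. \<bar>u i\<bar>) powr p) \<le> tree_max d p"
proof -
  have le: "(\<Sum>e\<in>F. (\<Prod>i\<in>e. \<bar>u i\<bar>) powr p) \<le> tree_max d p"
    if F: "finite F" "F \<subseteq> tree_edges d" for F
  proof (intro le_tree_max d p tree_sumsI F)
    have "((\<lambda>i. \<bar>u i\<bar>) has_sum 1) (tree_verts d)" using u by (simp add: l1_unit_sphere_def)
    then show "(\<Sum>i\<in>\<Union>F. \<bar>u i\<bar>) \<le> 1"
      using finite_Union_tree_edges[OF F] Union_tree_edges_subset[OF F(2)]
      by (intro finite_sum_le_has_sum) auto
  qed simp
  show "finite F \<Longrightarrow> F \<subseteq> tree_edges d \<Longrightarrow> (\<Sum>e\<in>F. (\<Prod>i\<in>e. \<bar>u i\<bar>) powr p) \<le> tree_max d p"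
    by (rule le)
  show sm: "(\<lambda>e. (\<Prod>i\<in>e. \<bar>u i\<bar>) powr p) summable_on tree_edges d"
    using le by (intro nonneg_bdd_above_summable_on bdd_aboveI[of _ "tree_max d p"]) auto
  show "(\<Sum>\<^sub>\<infinity>e\<in>tree_edges d. (\<Prod>i\<in>e. \<bar>u i\<bar>) powr p) \<le> tree_max d p"
    using le by (intro infsum_le_finite_sums sm) auto
qed

text \<open>The mass missing from 1 is placed on the root, which can only increase the edge
  products.\<close>

lemma tree_sums_le_infsum:
  assumes d: "d \<ge> 2" and p: "p \<ge> 1/2" and s: "s \<in> tree_sums d p"
  shows "\<exists>u\<in>l1_unit_sphere (tree_verts d). s \<le> (\<Sum>\<^sub>\<infinity>e\<in>tree_edges d. (\<Prod>i\<in>e. \<bar>u i\<bar>) powr p)"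
  using s
proof (rule tree_sumsE)
  fix F u assume F: "finite F" "F \<subseteq> tree_edges d" and u: "\<And>i. 0 \<le> u i" "(\<Sum>i\<in>\<Union>F. u i) \<le> 1"
    and s: "s = (\<Sum>e\<in>F. prod u e powr p)"
  define V where "V = insert [] (\<Union>F)"
  define m where "m = 1 - (\<Sum>i\<in>\<Union>F. u i)"
  define w where "w i = (if i \<in> \<Union>F then u i else 0) + (if i = [] then m else 0)" for i
  have m: "m \<ge> 0" using u by (simp add: m_def)
  have finV: "finite V" and V: "V \<subseteq> tree_verts d"
    using finite_Union_tree_edges[OF F] Union_tree_edges_subset[OF F(2)]
    by (auto simp: V_def tree_verts_def)
  have w0: "0 \<le> w i" for i using u m by (simp add: w_def)
  have "(\<Sum>i\<in>V. w i) = (\<Sum>i\<in>V. if i \<in> \<Union>F then u i else 0) + (\<Sum>i\<in>V. if i = [] then m else 0)"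
    unfolding w_def by (rule sum.distrib)
  also have "(\<Sum>i\<in>V. if i \<in> \<Union>F then u i else 0) = (\<Sum>i\<in>\<Union>F. u i)"
    using finV by (intro sum.mono_neutral_cong_right) (auto simp: V_def)
  also have "(\<Sum>i\<in>V. if i = [] then m else 0) = m"
    using finV by (simp add: V_def)
  finally have "(\<Sum>i\<in>V. w i) = 1" by (simp add: m_def)
  then have "((\<lambda>i. \<bar>w i\<bar>) has_sum 1) (tree_verts d)"
    using finV V w0 by (intro has_sum_finite_neutralI[of V]) (auto simp: w_def V_def)
  then have w: "w \<in> l1_unit_sphere (tree_verts d)" by (simp add: l1_unit_sphere_def)
  have "s \<le> (\<Sum>e\<in>F. (\<Prod>i\<in>e. \<bar>w i\<bar>) powr p)"
    unfolding s
  proof (intro sum_mono powr_mono2)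
    fix e assume e: "e \<in> F"
    show "prod u e \<le> (\<Prod>i\<in>e. \<bar>w i\<bar>)"
    proof (intro prod_mono conjI u)
      fix i assume "i \<in> e"
      then have "i \<in> \<Union>F" using e by blast
      then have "u i \<le> w i" using m by (simp add: w_def)
      then show "u i \<le> \<bar>w i\<bar>" by linarith
    qed
  qed (use p u in \<open>auto simp: prod_nonneg\<close>)
  also have "\<dots> \<le> (\<Sum>\<^sub>\<infinity>e\<in>tree_edges d. (\<Prod>i\<in>e. \<bar>w i\<bar>) powr p)"
    using F by (intro finite_sum_le_infsum tree_functional_sums(2)[OF d p w]) auto
  finally show ?thesis using w by blast
qed

lemma growth_exponent:
  fixes \<alpha> :: real
  assumes "\<alpha> > 2"
  shows "1/2 < \<alpha> / (2 * (\<alpha> - 1))" "\<alpha> / (2 * (\<alpha> - 1)) < 1"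
    "(\<alpha> - 1) / \<alpha> = 1 / (2 * (\<alpha> / (2 * (\<alpha> - 1))))" "(\<alpha> - 1) / \<alpha> > 0"
  using assms by (auto simp: field_simps)

lemma growth_const_eq_SUP:
  assumes d: "d \<ge> 2" and \<alpha>: "\<alpha> > 2"
  shows "growth_const d \<alpha> = 2 * (SUP u\<in>l1_unit_sphere (tree_verts d). tree_functional d \<alpha> u)"
proof -
  define p where "p = \<alpha> / (2 * (\<alpha> - 1))"
  define c where "c = (\<alpha> - 1) / \<alpha>"
  have p: "p \<ge> 1/2" and c: "c > 0"
    using growth_exponent[OF \<alpha>] by (auto simp: p_def c_def)
  define T where "T u = (\<Sum>\<^sub>\<infinity>e\<in>tree_edges d. (\<Prod>i\<in>e. \<bar>u i\<bar>) powr p)" for u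
  define S where "S = l1_unit_sphere (tree_verts d)"
  have tf: "tree_functional d \<alpha> u = T u powr c" for u
    unfolding tree_functional_def T_def p_def c_def ..
  have T0: "T u \<ge> 0" for u unfolding T_def by (rule infsum_nonneg) simp
  have le: "T u powr c \<le> tree_max d p powr c" if "u \<in> S" for u
    using that tree_functional_sums(3)[OF d p] c T0 unfolding S_def T_def by (intro powr_mono2) auto
  have ne: "S \<noteq> {}" using tree_sums_le_infsum[OF d p] tree_sums_nonempty unfolding S_def by blast
  have bdd: "bdd_above ((\<lambda>u. T u powr c) ` S)" using le by (intro bdd_aboveI[of _ "tree_max d p powr c"]) auto
  define R where "R = (SUP u\<in>S. T u powr c)"
  have "R \<le> tree_max d p powr c" unfolding R_def using ne le by (rule cSUP_least)
  moreover have "tree_max d p powr c \<le> R"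
  proof -
    have upper: "T u powr c \<le> R" if "u \<in> S" for u
      unfolding R_def using bdd that by (rule cSUP_upper2) simp
    then have R0: "R \<ge> 0" using ne by (meson equals0I order_trans powr_ge_zero)
    \<comment> \<open>Inverting the outer power makes the least upper bound property of
      \<open>tree_max\<close> applicable.\<close>
    have "tree_max d p \<le> R powr (1 / c)"
    proof (rule tree_max_le)
      fix s assume s: "s \<in> tree_sums d p"
      then obtain u where u: "u \<in> S" "s \<le> T u"
        using tree_sums_le_infsum[OF d p] unfolding S_def T_def by blast
      have "s \<le> (T u powr c) powr (1 / c)" using u c T0[of u] by (simp add: powr_powr)
      also have "\<dots> \<le> R powr (1 / c)" using c upper[OF u(1)] by (intro powr_mono2) auto
      finally show "s \<le> R powr (1 / c)" .
    qed
    then have "tree_max d p powr c \<le> (R powr (1 / c)) powr c"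
      using c less_imp_le[OF tree_max_pos[OF d p]] by (intro powr_mono2) auto
    also have "\<dots> = R" using c R0 by (simp add: powr_powr)
    finally show ?thesis .
  qed
  ultimately have "tree_max d p powr c = R" by (rule antisym[rotated])
  then show ?thesis unfolding growth_const_def tf R_def S_def p_def c_def by simp
qed

lemma continuous_on_growth_const:
  assumes d: "d \<ge> 2"
  shows "continuous_on {2<..} (growth_const d)"
proof -
  have "continuous_on {2<..} (\<lambda>\<alpha>. tree_max d (\<alpha> / (2 * (\<alpha> - 1))))"
    using growth_exponent(1)
    by (intro continuous_on_compose2[OF continuous_on_tree_max[OF d]] continuous_intros) auto
  then have "continuous_on {2<..} (\<lambda>\<alpha>. 2 * tree_max d (\<alpha> / (2 * (\<alpha> - 1))) powr ((\<alpha> - 1) / \<alpha>))"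
    using tree_max_pos[OF d] growth_exponent(1)
    by (intro continuous_intros) (auto simp: less_le)
  then show ?thesis unfolding growth_const_def by simp
qed

lemma growth_const_gt_1:
  assumes d: "d \<ge> 2" and \<alpha>: "\<alpha> > 2"
  shows "growth_const d \<alpha> > 1"
proof -
  define p where "p = \<alpha> / (2 * (\<alpha> - 1))"
  have p: "1/2 < p" "p < 1" and c: "(\<alpha> - 1) / \<alpha> = 1 / (2 * p)"
    using growth_exponent[OF \<alpha>] by (auto simp: p_def)
  have "((1/4) powr p) powr (1 / (2 * p)) < tree_max d p powr (1 / (2 * p))"
    using p tree_max_gt_single_edge[OF d, of p] by (intro powr_less_mono2) auto
  moreover have "((1/4) powr p) powr (1 / (2 * p)) = 1/2"
    using p by (simp add: powr_powr powr_half_sqrt real_sqrt_divide)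
  ultimately show ?thesis unfolding growth_const_def c p_def[symmetric] by simp
qed

lemma growth_const_tendsto_at_2:
  assumes d: "d \<ge> 2"
  shows "(growth_const d \<longlongrightarrow> 1) (at_right 2)"
proof -
  have "isCont (tree_max d) 1"
    using continuous_on_tree_max[OF d] by (rule continuous_on_interior) (simp add: interior_open)
  then have "((\<lambda>\<alpha>. tree_max d (\<alpha> / (2 * (\<alpha> - 1)))) \<longlongrightarrow> tree_max d 1) (at_right 2)"
    by (rule isCont_tendsto_compose) (auto intro!: tendsto_eq_intros)
  then have "(growth_const d \<longlongrightarrow> 2 * (1/4) powr (1/2)) (at_right 2)"
    unfolding growth_const_def tree_max_one[OF d]
    by (auto intro!: tendsto_eq_intros)
  moreover have "2 * (1/4) powr (1/2) = (1::real)" by (simp add: powr_half_sqrt real_sqrt_divide)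
  ultimately show ?thesis by simp
qed

lemma growth_const_upper:
  assumes d: "d \<ge> 2" and \<alpha>: "\<alpha> > 2"
  shows "growth_const d \<alpha> \<le> 2 * sqrt (real d - 1)"
proof -
  define p where "p = \<alpha> / (2 * (\<alpha> - 1))"
  have p: "1/2 < p" "p < 1" and c: "(\<alpha> - 1) / \<alpha> = 1 / (2 * p)"
    using growth_exponent[OF \<alpha>] by (auto simp: p_def)
  have "tree_max d p powr (1 / (2 * p)) \<le> (sqrt (real d - 1) powr (2 * p)) powr (1 / (2 * p))"
    using p tree_max_upper[OF d, of p] tree_max_pos[OF d, of p] by (intro powr_mono2) auto
  also have "\<dots> = sqrt (real d - 1)" using p d by (simp add: powr_powr)
  finally show ?thesis unfolding growth_const_def c p_def[symmetric] by simp
qed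

lemma card_children_ge:
  assumes "x \<in> tree_verts d"
  shows "d - 1 \<le> card {w \<in> tree_verts d. w \<noteq> [] \<and> tl w = x}" "finite {w \<in> tree_verts d. w \<noteq> [] \<and> tl w = x}"
proof -
  define L where "L = (if x = [] then {..<d} else {..<d} - {hd x})"
  have eq: "{w \<in> tree_verts d. w \<noteq> [] \<and> tl w = x} = (\<lambda>a. a # x) ` L"
  proof (intro equalityI subsetI)
    fix w assume "w \<in> {w \<in> tree_verts d. w \<noteq> [] \<and> tl w = x}"
    then show "w \<in> (\<lambda>a. a # x) ` L" by (cases w) (auto simp: L_def tree_verts_Cons)
  qed (use assms in \<open>auto simp: L_def tree_verts_Cons split: if_splits\<close>)
  have "d - 1 \<le> card L" by (simp add: L_def card_Diff_singleton_if)
  then show "d - 1 \<le> card {w \<in> tree_verts d. w \<noteq> [] \<and> tl w = x}"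
    unfolding eq by (subst card_image) (auto simp: inj_on_def)
  show "finite {w \<in> tree_verts d. w \<noteq> [] \<and> tl w = x}" unfolding eq by (simp add: L_def)
qed

text \<open>
  The radial function \<open>(d - 1) ^ (- length v)\<close> on a large ball almost attains the spectral radius
  of the tree: every edge contributes \<open>\<surd>(d - 1)\<close> times the mass of its lower endpoint.
\<close>

lemma radial_test_function:
  assumes d: "d \<ge> 2"
  shows "\<exists>F u. finite F \<and> F \<subseteq> tree_edges d \<and> (\<forall>i. 0 < u i) \<and> (\<Sum>i\<in>\<Union>F. u i) \<le> 1 \<and>
    sqrt (real d - 1) * (1 - 1 / (real r + 1)) \<le> (\<Sum>e\<in>F. prod u e powr (1/2))"
proof -
  define b where "b = real d - 1"
  have b: "b \<ge> 1" using d by (simp add: b_def)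
  define f where "f v = (1 / b) ^ length v" for v :: "nat list"
  define lev where "lev k = {v \<in> tree_verts d. length v = k}" for k
  have fin: "finite (lev k)" for k
    by (rule finite_subset[OF _ finite_lists_length_eq[of "{..<d}" k]]) (auto simp: lev_def tree_verts_def)
  \<comment> \<open>Every vertex has at least d - 1 children, each with value f v / (d - 1), so no
    mass is lost from one level to the next.\<close>
  have mass: "1 \<le> (\<Sum>v\<in>lev k. f v)" for k
  proof (induction k)
    case 0
    have "lev 0 = {[]}" by (auto simp: lev_def tree_verts_def)
    then show ?case by (simp add: f_def)
  next
    case (Suc k)
    define ch where "ch x = {w \<in> tree_verts d. w \<noteq> [] \<and> tl w = x}" for x
    have "(\<Sum>v\<in>lev k. f v) \<le> (\<Sum>v\<in>lev k. (\<Sum>w\<in>ch v. f w))"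
    proof (rule sum_mono)
      fix v assume v: "v \<in> lev k"
      then have "d - 1 \<le> card (ch v)" using card_children_ge(1) by (simp add: ch_def lev_def)
      then have "b \<le> real (card (ch v))" using d by (simp add: b_def)
      then have "b * (f v / b) \<le> real (card (ch v)) * (f v / b)"
        using b by (intro mult_right_mono) (auto simp: f_def)
      moreover have "f w = f v / b" if "w \<in> ch v" for w
        using that by (cases w) (auto simp: ch_def f_def)
      ultimately show "f v \<le> (\<Sum>w\<in>ch v. f w)" using b by simp
    qed
    also have "\<dots> = (\<Sum>w\<in>(\<Union>v\<in>lev k. ch v). f w)"
      using fin card_children_ge(2) by (intro sum.UNION_disjoint[symmetric]) (auto simp: ch_def lev_def)
    also have "(\<Union>v\<in>lev k. ch v) = lev (Suc k)"
    proof (intro equalityI subsetI)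
      fix w assume "w \<in> lev (Suc k)"
      then show "w \<in> (\<Union>v\<in>lev k. ch v)" by (cases w) (auto simp: ch_def lev_def tree_verts_Cons)
    next
      fix w assume "w \<in> (\<Union>v\<in>lev k. ch v)"
      then show "w \<in> lev (Suc k)" by (cases w) (auto simp: ch_def lev_def)
    qed
    finally show ?case using Suc by simp
  qed
  define C where "C = (\<Union>k\<in>{1..r}. lev k)"
  have finC: "finite C" using fin by (simp add: C_def)
  define S where "S = (\<Sum>v\<in>C. f v)"
  have "S = (\<Sum>k\<in>{1..r}. \<Sum>v\<in>lev k. f v)"
    unfolding S_def C_def using fin by (intro sum.UNION_disjoint) (auto simp: lev_def)
  also have "\<dots> \<ge> (\<Sum>k\<in>{1..r}. 1)" by (rule sum_mono) (rule mass)
  finally have S: "S \<ge> real r" by simp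
  define F where "F = (\<lambda>w. {tl w, w}) ` C"
  \<comment> \<open>The normalising constant consists of 1 for the root and \<open>S\<close> for the
    levels 1 to r.\<close>
  define u where "u v = f v / (1 + S)" for v
  have C: "C \<subseteq> tree_verts d - {[]}" by (auto simp: C_def lev_def)
  have F: "F \<subseteq> tree_edges d" unfolding F_def tree_edges_eq using C by blast
  have upos: "0 < u v" for v using b S by (simp add: u_def f_def)
  have "\<Union>F \<subseteq> insert [] C"
  proof
    fix v assume "v \<in> \<Union>F"
    then obtain w where w: "w \<in> C" "v = w \<or> v = tl w" unfolding F_def by blast
    then show "v \<in> insert [] C"
      by (cases w; cases "tl w") (auto simp: C_def lev_def tree_verts_Cons)
  qed
  then have "(\<Sum>i\<in>\<Union>F. u i) \<le> (\<Sum>i\<in>insert [] C. u i)"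
    using finC upos by (intro sum_mono2) (auto intro: less_imp_le)
  also have "\<dots> = u [] + (\<Sum>i\<in>C. u i)" using finC C by (subst sum.insert) auto
  also have "\<dots> = 1 / (1 + S) + S / (1 + S)"
    by (simp add: u_def f_def S_def sum_divide_distrib)
  also have "\<dots> = 1" using S by (simp add: add_divide_distrib[symmetric])
  finally have sum1: "(\<Sum>i\<in>\<Union>F. u i) \<le> 1" .
  have inj: "inj_on (\<lambda>w. {tl w, w}) C" using C by (intro inj_on_subset[OF inj_on_parent_edge]) auto
  have "(\<Sum>e\<in>F. prod u e powr (1/2)) = (\<Sum>w\<in>C. prod u {tl w, w} powr (1/2))"
    unfolding F_def using sum.reindex[OF inj] by simp
  also have "\<dots> = (\<Sum>w\<in>C. sqrt b * u w)"
  proof (rule sum.cong[OF refl])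
    fix w assume w: "w \<in> C"
    then obtain a x where ax: "w = a # x" using C by (cases w) auto
    have "u x = b * u w" using ax b by (simp add: u_def f_def)
    then have "prod u {tl w, w} = b * (u w)\<^sup>2"
      using prod_parent_edge[of w u] ax by (simp add: power2_eq_square)
    then show "prod u {tl w, w} powr (1/2) = sqrt b * u w"
      using upos[of w] b by (simp add: powr_half_sqrt real_sqrt_mult)
  qed
  also have "\<dots> = sqrt b * (S / (1 + S))"
    by (simp add: u_def S_def sum_distrib_left sum_divide_distrib)
  also have "S / (1 + S) = 1 - 1 / (1 + S)" using S by (simp add: field_simps)
  also have "sqrt b * (1 - 1 / (1 + S)) \<ge> sqrt b * (1 - 1 / (real r + 1))"
    using S b by (intro mult_left_mono diff_left_mono divide_left_mono) auto
  finally have "sqrt b * (1 - 1 / (real r + 1)) \<le> (\<Sum>e\<in>F. prod u e powr (1/2))" .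
  moreover have "finite F" using finC by (simp add: F_def)
  ultimately show ?thesis using F upos sum1 unfolding b_def by blast
qed

text \<open>Here the exponent tends to 1/2, the excluded endpoint of
  \<open>continuous_on_tree_max\<close>. The limit is therefore squeezed between
  \<open>growth_const_upper\<close> and the values of one fixed finite test function, which depend
  continuously on the exponent.\<close>

lemma growth_const_tendsto_at_top:
  assumes d: "d \<ge> 2"
  shows "(growth_const d \<longlongrightarrow> 2 * sqrt (real d - 1)) at_top"
proof (rule order_tendstoI)
  define s where "s = sqrt (real d - 1)"
  have s: "s > 0" using d by (simp add: s_def)
  fix c assume "c < 2 * sqrt (real d - 1)"
  then have c: "c < 2 * s" by (simp add: s_def)
  have "((\<lambda>r. 2 * (s * (1 - 1 / (real r + 1)))) \<longlongrightarrow> 2 * (s * (1 - 0))) sequentially"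
    by (intro tendsto_intros) real_asymp
  then have "\<forall>\<^sub>F r in sequentially. c < 2 * (s * (1 - 1 / (real r + 1)))"
    using c by (intro order_tendstoD(1)) auto
  then obtain r :: nat where r: "c < 2 * (s * (1 - 1 / (real r + 1)))"
    using eventually_happens by force
  obtain F u where F: "finite F" "F \<subseteq> tree_edges d" and u: "\<forall>i. 0 < u i" "(\<Sum>i\<in>\<Union>F. u i) \<le> 1"
    and ge: "s * (1 - 1 / (real r + 1)) \<le> (\<Sum>e\<in>F. prod u e powr (1/2))"
    using radial_test_function[OF d, of r] unfolding s_def by blast
  have pos: "prod u e > 0" for e using u by (simp add: prod_pos)
  define p where "p \<alpha> = \<alpha> / (2 * (\<alpha> - 1))" for \<alpha> :: real
  define g where "g \<alpha> = 2 * (\<Sum>e\<in>F. prod u e powr p \<alpha>) powr ((\<alpha> - 1) / \<alpha>)" for \<alpha>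
  have p: "(p \<longlongrightarrow> 1/2) at_top" unfolding p_def by real_asymp
  have e: "((\<lambda>\<alpha>::real. (\<alpha> - 1) / \<alpha>) \<longlongrightarrow> 1) at_top" by real_asymp
  have "c < 2 * (\<Sum>e\<in>F. prod u e powr (1/2))" using r ge by linarith
  moreover have "(g \<longlongrightarrow> 2 * (\<Sum>e\<in>F. prod u e powr (1/2))) at_top"
  proof (cases "F = {}")
    case False
    then have pos': "(\<Sum>e\<in>F. prod u e powr (1/2)) > 0" using F pos by (intro sum_pos) (auto simp: less_le)
    then have "(g \<longlongrightarrow> 2 * (\<Sum>e\<in>F. prod u e powr (1/2)) powr 1) at_top"
      unfolding g_def using pos by (intro tendsto_intros p e) (auto simp: less_le)
    with pos' show ?thesis by simp
  qed (simp add: g_def[abs_def])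
  ultimately have "\<forall>\<^sub>F \<alpha> in at_top. c < g \<alpha>" by (rule order_tendstoD(1)[rotated])
  moreover have "\<forall>\<^sub>F \<alpha> in at_top. g \<alpha> \<le> growth_const d \<alpha>"
    using eventually_gt_at_top[of 2]
  proof eventually_elim
    case (elim \<alpha>)
    then have "p \<alpha> \<ge> 1/2" using growth_exponent(1)[of \<alpha>] by (simp add: p_def)
    then have "(\<Sum>e\<in>F. prod u e powr p \<alpha>) \<le> tree_max d (p \<alpha>)"
      using F u by (intro le_tree_max d tree_sumsI) (auto intro: less_imp_le)
    then show ?case
      unfolding g_def growth_const_def p_def[symmetric] using elim
      by (intro mult_left_mono powr_mono2 sum_nonneg) auto
  qed
  ultimately show "\<forall>\<^sub>F \<alpha> in at_top. c < growth_const d \<alpha>"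
    by eventually_elim auto
next
  fix c assume c: "c > 2 * sqrt (real d - 1)"
  show "\<forall>\<^sub>F \<alpha> in at_top. growth_const d \<alpha> < c"
    using eventually_gt_at_top[of 2]
    by eventually_elim (rule le_less_trans[OF growth_const_upper[OF d] c])
qed

section \<open>Upper bound for sparse weighted graphs\<close>

definition limit_const :: "nat \<Rightarrow> real \<Rightarrow> real" where
  "limit_const d \<alpha> = (if \<alpha> \<le> 2 then 1 else growth_const d \<alpha>)"

lemma limit_const_ge_1: "d \<ge> 2 \<Longrightarrow> limit_const d \<alpha> \<ge> 1"
  using growth_const_gt_1[of d \<alpha>] by (auto simp: limit_const_def)

section \<open>Trees grown inside a graph and their embedding into the regular tree\<close>

text \<open>Building trees by attaching leaves gives an induction principle for the vertex count,
  for truncation to a given size and for the embedding, without any reference to paths or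
  cycles.\<close>

inductive grown_tree :: "'v set set \<Rightarrow> 'v set \<Rightarrow> 'v set set \<Rightarrow> bool" for E where
  root: "grown_tree E {x} {}"
| grow: "grown_tree E V F \<Longrightarrow> y \<in> V \<Longrightarrow> z \<notin> V \<Longrightarrow> {y, z} \<in> E \<Longrightarrow>
    grown_tree E (insert z V) (insert {y, z} F)"

lemma grown_treeD:
  assumes "grown_tree E V F"
  shows "finite V" "finite F" "F \<subseteq> E" "\<Union>F \<subseteq> V" "card V = card F + 1"
proof -
  have "finite V \<and> finite F \<and> F \<subseteq> E \<and> \<Union>F \<subseteq> V \<and> card V = card F + 1"
    using assms
  proof induction
    case (grow V F y z)
    then have "{y, z} \<notin> F" by blast
    with grow show ?case by (auto simp: card_insert_disjoint)
  qed auto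
  then show "finite V" "finite F" "F \<subseteq> E" "\<Union>F \<subseteq> V" "card V = card F + 1" by auto
qed

text \<open>Vertices are added one at a time, so some stage of the construction has the required
  size.\<close>

lemma grown_tree_subtree:
  assumes "grown_tree E V F" "1 \<le> k" "k \<le> card V"
  shows "\<exists>V' F'. grown_tree E V' F' \<and> V' \<subseteq> V \<and> card V' = k"
  using assms
proof induction
  case (root x)
  then show ?case using grown_tree.root[of E x] by auto
next
  case (grow V F y z)
  show ?case
  proof (cases "k \<le> card V")
    case False
    have "grown_tree E (insert z V) (insert {y, z} F)" using grow.hyps by (rule grown_tree.grow)
    moreover have "card (insert z V) = k"
      using grow False grown_treeD(1)[OF grow.hyps(1)] by auto
    ultimately show ?thesis by blast
  qed (use grow in auto)
qed

text \<open>A largest grown tree containing x spans the component of x: an edge leaving it would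
  attach a further leaf. The closed finite set U bounds the size.\<close>

lemma grown_tree_component:
  assumes U: "finite U" "x \<in> U" "\<forall>e\<in>E. e \<inter> U \<noteq> {} \<longrightarrow> e \<subseteq> U" and card2: "\<And>e. e \<in> E \<Longrightarrow> card e = 2"
  shows "\<exists>V F. grown_tree E V F \<and> x \<in> V \<and> V \<subseteq> U \<and> (\<forall>e\<in>E. e \<inter> V \<noteq> {} \<longrightarrow> e \<subseteq> V)"
proof -
  define P where "P V \<longleftrightarrow> (\<exists>F. grown_tree E V F) \<and> x \<in> V \<and> V \<subseteq> U" for V
  have "P {x}" using U grown_tree.root[of E x] by (auto simp: P_def)
  moreover have "\<forall>V. P V \<longrightarrow> card V < Suc (card U)"
    using U by (auto simp: P_def less_Suc_eq_le intro: card_mono)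
  ultimately obtain V where V: "P V" and max: "\<And>V'. P V' \<Longrightarrow> card V' \<le> card V"
    using ex_has_greatest_nat[of P "{x}" card "Suc (card U)"] by blast
  then obtain F where F: "grown_tree E V F" by (auto simp: P_def)
  have "e \<subseteq> V" if e: "e \<in> E" "e \<inter> V \<noteq> {}" for e
  proof (rule ccontr)
    assume "\<not> e \<subseteq> V"
    moreover obtain a b where "e = {a, b}" using card2[OF e(1)] unfolding card_2_iff by blast
    ultimately obtain y z where yz: "e = {y, z}" "y \<in> V" "z \<notin> V" using e(2) by blast
    then have "grown_tree E (insert z V) (insert {y, z} F)"
      using F e by (intro grown_tree.grow) auto
    moreover have "e \<inter> U \<noteq> {}" using V yz by (auto simp: P_def)
    then have "z \<in> U" using U(3)[rule_format, OF e(1)] yz by auto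
    ultimately have "P (insert z V)" using V by (auto simp: P_def)
    then show False using max yz grown_treeD(1)[OF F] by fastforce
  qed
  with V F show ?thesis unfolding P_def by blast
qed

text \<open>When a leaf z is attached at y, fewer than d edges of the old tree contain y, while d
  tree edges meet the image of y, so one of them is free. The last conjunct is the invariant that
  makes its other end usable: the image edges are exactly the parent edges of the non-root image
  vertices.\<close>

lemma grown_tree_embedding:
  assumes "grown_tree E V F" "\<And>x. card {e \<in> F. x \<in> e} \<le> d"
  shows "\<exists>\<psi>. inj_on \<psi> V \<and> \<psi> ` V \<subseteq> tree_verts d \<and>
    (\<lambda>e. \<psi> ` e) ` F = (\<lambda>w. {tl w, w}) ` (\<psi> ` V - {[]})"
  using assms
proof induction
  case (root x)
  show ?case by (intro exI[of _ "\<lambda>_. []"]) (auto simp: tree_verts_def)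
next
  case (grow V F y z)
  note gt = grown_treeD[OF grow.hyps(1)]
  have notin: "{y, z} \<notin> F" using gt grow.hyps by blast
  have deg: "card {e \<in> F. x \<in> e} \<le> card {e \<in> insert {y, z} F. x \<in> e}" for x
    using gt by (intro card_mono) auto
  obtain \<psi> where \<psi>: "inj_on \<psi> V" "\<psi> ` V \<subseteq> tree_verts d"
    "(\<lambda>e. \<psi> ` e) ` F = (\<lambda>w. {tl w, w}) ` (\<psi> ` V - {[]})"
    using grow.IH[OF order_trans[OF deg grow.prems]] by (elim exE conjE)
  define A where "A = {e \<in> tree_edges d. \<psi> y \<in> e}"
  define B where "B = (\<lambda>e. \<psi> ` e) ` {e \<in> F. y \<in> e}"
  have "card B \<le> card {e \<in> F. y \<in> e}" unfolding B_def using gt by (intro card_image_le) auto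
  also have "\<dots> < card {e \<in> insert {y, z} F. y \<in> e}"
    using gt notin by (intro psubset_card_mono) auto
  also have "\<dots> \<le> d" by (rule grow.prems)
  also have "d = card A"
    unfolding A_def using \<psi>(2) grow.hyps by (intro card_incident_tree_edges[symmetric]) auto
  finally have "\<not> A \<subseteq> B" using gt card_mono[of B A] by (auto simp: B_def)
  then obtain f where f: "f \<in> A" "f \<notin> B" by blast
  then obtain w where w: "f = {tl w, w}" "w \<in> tree_verts d" "w \<noteq> []"
    unfolding A_def tree_edges_eq by blast
  \<comment> \<open>If w were already an image vertex, the invariant would make its parent edge f
    the image of an edge of F at y, against the choice of f.\<close>
  have wV: "w \<notin> \<psi> ` V"
  proof
    assume "w \<in> \<psi> ` V"
    then have "f \<in> (\<lambda>e. \<psi> ` e) ` F" using \<psi>(3) w by blast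
    then obtain e where e: "e \<in> F" "f = \<psi> ` e" by blast
    then have "\<psi> y \<in> \<psi> ` e" using f by (auto simp: A_def)
    moreover have "e \<subseteq> V" using gt e by blast
    ultimately have "y \<in> e" using \<psi>(1) grow.hyps(2) by (auto dest: inj_onD)
    then show False using f e by (auto simp: B_def)
  qed
  then have tl: "tl w = \<psi> y" using f(1) w(1) grow.hyps by (auto simp: A_def)
  define \<phi> where "\<phi> = \<psi>(z := w)"
  have eqV: "\<phi> i = \<psi> i" if "i \<in> V" for i using that grow.hyps by (auto simp: \<phi>_def)
  have im: "\<phi> ` V = \<psi> ` V" using eqV by auto
  have "inj_on \<phi> (insert z V)"
    using \<psi>(1) wV eqV grow.hyps by (auto simp: inj_on_def \<phi>_def)
  moreover have "\<phi> ` insert z V \<subseteq> tree_verts d" using im \<psi>(2) w by (auto simp: \<phi>_def)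
  moreover have "(\<lambda>e. \<phi> ` e) ` insert {y, z} F = (\<lambda>w. {tl w, w}) ` (\<phi> ` insert z V - {[]})"
  proof -
    have "(\<lambda>e. \<phi> ` e) ` F = (\<lambda>e. \<psi> ` e) ` F"
      using gt(4) eqV by (intro image_cong refl) blast
    moreover have "\<phi> ` {y, z} = {tl w, w}" using tl grow.hyps by (auto simp: \<phi>_def)
    moreover have "\<phi> ` insert z V - {[]} = insert w (\<psi> ` V - {[]})"
      using im w by (auto simp: \<phi>_def)
    ultimately show ?thesis using \<psi>(3) by simp
  qed
  ultimately show ?case by blast
qed

text \<open>The quantified \<open>g\<close> allows the same transported function to be used with
  plain products for \<alpha> \<le> 2 and with p-th powers for \<alpha> > 2.\<close>

lemma grown_tree_transfer:
  fixes u :: "'v \<Rightarrow> real"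
  assumes gt: "grown_tree E V F" and deg: "\<And>x. card {e \<in> F. x \<in> e} \<le> d" and u: "\<And>i. 0 \<le> u i"
  shows "\<exists>F' V' u'. finite F' \<and> F' \<subseteq> tree_edges d \<and> finite V' \<and> \<Union>F' \<subseteq> V' \<and> (\<forall>i. 0 \<le> u' i) \<and>
    (\<Sum>i\<in>V'. u' i) = (\<Sum>i\<in>V. u i) \<and>
    (\<forall>g :: real \<Rightarrow> real. (\<Sum>e\<in>F'. g (prod u' e)) = (\<Sum>e\<in>F. g (prod u e)))"
proof -
  note gtD = grown_treeD[OF gt]
  obtain \<psi> where \<psi>: "inj_on \<psi> V" "\<psi> ` V \<subseteq> tree_verts d"
    "(\<lambda>e. \<psi> ` e) ` F = (\<lambda>w. {tl w, w}) ` (\<psi> ` V - {[]})"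
    using grown_tree_embedding[OF gt deg] by (elim exE conjE)
  define u' where "u' t = (if t \<in> \<psi> ` V then u (inv_into V \<psi> t) else 0)" for t
  have u': "u' (\<psi> i) = u i" if "i \<in> V" for i using that \<psi>(1) by (simp add: u'_def)
  have prod: "prod u' (\<psi> ` e) = prod u e" if "e \<in> F" for e
  proof -
    have e: "e \<subseteq> V" using gtD that by blast
    then have "prod u' (\<psi> ` e) = prod (u' \<circ> \<psi>) e"
      by (intro prod.reindex inj_on_subset[OF \<psi>(1)])
    also have "\<dots> = prod u e" using e u' by (intro prod.cong) auto
    finally show ?thesis .
  qed
  have inj: "inj_on (\<lambda>e. \<psi> ` e) F"
    using \<psi>(1) gtD(4) by (intro inj_on_image inj_on_subset[OF \<psi>(1)])
  show ?thesis
  proof (intro exI conjI allI)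
    show "finite ((\<lambda>e. \<psi> ` e) ` F)" "finite (\<psi> ` V)" using gtD by auto
    show "(\<lambda>e. \<psi> ` e) ` F \<subseteq> tree_edges d" unfolding \<psi>(3) tree_edges_eq using \<psi>(2) by auto
    show "\<Union>((\<lambda>e. \<psi> ` e) ` F) \<subseteq> \<psi> ` V" using gtD(4) by blast
    show "0 \<le> u' i" for i using u by (simp add: u'_def)
    show "(\<Sum>i\<in>\<psi> ` V. u' i) = (\<Sum>i\<in>V. u i)"
      using \<psi>(1) u' by (simp add: sum.reindex)
    show "(\<Sum>e\<in>(\<lambda>e. \<psi> ` e) ` F. g (prod u' e)) = (\<Sum>e\<in>F. g (prod u e))" for g :: "real \<Rightarrow> real"
      using inj prod by (simp add: sum.reindex)
  qed
qed

text \<open>For \<alpha> \<le> 2, Cauchy-Schwarz combines the comparison of the l^2 and l^\<alpha>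
  norms of the weights with the bipartite bound N^2 / 4. For \<alpha> > 2, Hoelder's inequality with
  exponent \<alpha> leaves the p-th power sum bounded by \<open>tree_max\<close>.\<close>

lemma grown_tree_form_bound:
  fixes v :: "'v \<Rightarrow> real" and w :: "'v set \<Rightarrow> real"
  assumes d: "d \<ge> 2" and \<alpha>: "\<alpha> > 0"
    and gt: "grown_tree E V F" and deg: "\<And>x. card {e \<in> F. x \<in> e} \<le> d"
  shows "2 * (\<Sum>e\<in>F. \<bar>w e\<bar> * \<bar>prod v e\<bar>) \<le>
    limit_const d \<alpha> * (\<Sum>e\<in>F. \<bar>w e\<bar> powr \<alpha>) powr (1 / \<alpha>) * (\<Sum>i\<in>V. (v i)\<^sup>2)"
proof -
  define u where "u i = (v i)\<^sup>2" for i
  have pu: "prod u e = (prod v e)\<^sup>2" for e unfolding u_def by (rule prod_power_distrib[symmetric])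
  have u0: "0 \<le> u i" for i by (simp add: u_def)
  define N where "N = (\<Sum>i\<in>V. u i)"
  define Z where "Z = (\<Sum>e\<in>F. \<bar>w e\<bar> powr \<alpha>)"
  have N0: "N \<ge> 0" and Z0: "Z \<ge> 0" using u0 by (auto simp: N_def Z_def intro: sum_nonneg)
  obtain F' V' u' where F': "finite F'" "F' \<subseteq> tree_edges d" "finite V'" "\<Union>F' \<subseteq> V'"
      and u': "\<forall>i. 0 \<le> u' i" "(\<Sum>i\<in>V'. u' i) = N"
      and tr: "\<forall>g :: real \<Rightarrow> real. (\<Sum>e\<in>F'. g (prod u' e)) = (\<Sum>e\<in>F. g (prod u e))"
    using grown_tree_transfer[where u = u, OF gt deg u0] unfolding N_def by (elim exE conjE)
  show ?thesis
  proof (cases "\<alpha> \<le> 2")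
    case True
    have "(\<Sum>e\<in>F. prod u e) = (\<Sum>e\<in>F'. prod u' e)" using tr[THEN spec, of "\<lambda>x. x"] by simp
    also have "\<dots> \<le> N\<^sup>2 / 4"
      using sum_prod_tree_edges_le[OF F'(1-4), of u'] u' by simp
    finally have y: "(\<Sum>e\<in>F. (prod v e)\<^sup>2) \<le> N\<^sup>2 / 4" by (simp add: pu)
    have "(\<Sum>e\<in>F. (w e)\<^sup>2) = (\<Sum>e\<in>F. (\<bar>w e\<bar> powr \<alpha>) powr (2 / \<alpha>))"
      using \<alpha> by (simp add: powr_powr)
    also have "\<dots> \<le> Z powr (2 / \<alpha>)"
      unfolding Z_def using True \<alpha> by (intro sum_powr_le_powr_sum) auto
    finally have x: "(\<Sum>e\<in>F. (w e)\<^sup>2) \<le> Z powr (2 / \<alpha>)" .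
    have "(\<Sum>e\<in>F. \<bar>w e\<bar> * \<bar>prod v e\<bar>) = (\<Sum>e\<in>F. (w e)\<^sup>2 powr (1/2) * (prod v e)\<^sup>2 powr (1/2))"
      by (simp add: powr_half_sqrt)
    also have "\<dots> \<le> (\<Sum>e\<in>F. (w e)\<^sup>2) powr (1/2) * (\<Sum>e\<in>F. (prod v e)\<^sup>2) powr (1/2)"
      using sum_powr_mult_powr_le[of F "\<lambda>e. (w e)\<^sup>2" "\<lambda>e. (prod v e)\<^sup>2" "1/2" "1/2"] by simp
    also have "\<dots> \<le> (Z powr (2 / \<alpha>)) powr (1/2) * (N\<^sup>2 / 4) powr (1/2)"
      using x y by (intro mult_mono powr_mono2 sum_nonneg) auto
    also have "\<dots> = Z powr (1 / \<alpha>) * N / 2"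
      using N0 by (simp add: powr_powr powr_half_sqrt real_sqrt_divide)
    finally show ?thesis using True by (simp add: limit_const_def Z_def N_def u_def)
  next
    case False
    define p where "p = \<alpha> / (2 * (\<alpha> - 1))"
    define b where "b = (\<alpha> - 1) / \<alpha>"
    have p: "p \<ge> 1/2" and b: "b > 0" "2 * p * b = 1" "1 / \<alpha> + b = 1"
      using growth_exponent[of \<alpha>] False by (auto simp: p_def b_def field_simps)
    have "(\<Sum>e\<in>F. prod u e powr p) = (\<Sum>e\<in>F'. prod u' e powr p)"
      using tr[THEN spec, of "\<lambda>x. x powr p"] by simp
    also have "\<dots> \<le> tree_max d p * N powr (2 * p)"
      using sum_prod_powr_le_tree_max[OF d p F'(1-4), of u'] u' by simp
    finally have y: "(\<Sum>e\<in>F. prod u e powr p) \<le> tree_max d p * N powr (2 * p)" .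
    have "(\<Sum>e\<in>F. \<bar>w e\<bar> * \<bar>prod v e\<bar>) = (\<Sum>e\<in>F. (\<bar>w e\<bar> powr \<alpha>) powr (1 / \<alpha>) * (prod u e powr p) powr b)"
    proof (intro sum.cong refl arg_cong2[of _ _ _ _ "(*)"])
      fix e
      show "\<bar>w e\<bar> = (\<bar>w e\<bar> powr \<alpha>) powr (1 / \<alpha>)" using \<alpha> by (simp add: powr_powr)
      have "p * b = 1/2" using b by simp
      then show "\<bar>prod v e\<bar> = (prod u e powr p) powr b"
        by (simp only: powr_powr pu) (simp add: powr_half_sqrt)
    qed
    also have "\<dots> \<le> Z powr (1 / \<alpha>) * (\<Sum>e\<in>F. prod u e powr p) powr b"
      unfolding Z_def using b \<alpha> by (intro sum_powr_mult_powr_le) auto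
    also have "\<dots> \<le> Z powr (1 / \<alpha>) * (tree_max d p * N powr (2 * p)) powr b"
      using y b by (intro mult_left_mono powr_mono2 sum_nonneg) auto
    also have "(tree_max d p * N powr (2 * p)) powr b = tree_max d p powr b * N"
      using b N0 tree_max_pos[OF d p] by (simp add: powr_mult powr_powr)
    finally have "2 * (\<Sum>e\<in>F. \<bar>w e\<bar> * \<bar>prod v e\<bar>) \<le> 2 * (Z powr (1 / \<alpha>) * (tree_max d p powr b * N))"
      by simp
    also have "\<dots> = limit_const d \<alpha> * Z powr (1 / \<alpha>) * N"
      unfolding limit_const_def growth_const_def p_def[symmetric] b_def[symmetric] using False by simp
    finally show ?thesis unfolding Z_def N_def u_def .
  qed
qed

section \<open>Light edges and components of heavy edges\<close>

text \<open>The crude bound by the maximal degree, from 2 |x y| \<le> x^2 + y^2 on each edge. It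
  suffices wherever all weights involved are of smaller order.\<close>

lemma sum_abs_prod_edges_le:
  fixes v :: "'v \<Rightarrow> real"
  assumes S: "finite S" "\<And>e. e \<in> S \<Longrightarrow> card e = 2" "\<And>x. card {e \<in> S. x \<in> e} \<le> d"
    and V: "finite V" "\<Union>S \<subseteq> V"
  shows "2 * (\<Sum>e\<in>S. \<bar>prod v e\<bar>) \<le> real d * (\<Sum>i\<in>V. (v i)\<^sup>2)"
proof -
  have "2 * \<bar>prod v e\<bar> \<le> (\<Sum>i\<in>{i \<in> V. i \<in> e}. (v i)\<^sup>2)" if e: "e \<in> S" for e
  proof -
    obtain x y where xy: "e = {x, y}" "x \<noteq> y" using S(2)[OF e] by (auto simp: card_2_iff)
    then have "{i \<in> V. i \<in> e} = {x, y}" using V e by auto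
    moreover have "2 * \<bar>v x * v y\<bar> \<le> (v x)\<^sup>2 + (v y)\<^sup>2"
      using sum_squares_bound[of "\<bar>v x\<bar>" "\<bar>v y\<bar>"] by (simp add: abs_mult)
    ultimately show ?thesis using xy by simp
  qed
  then have "2 * (\<Sum>e\<in>S. \<bar>prod v e\<bar>) \<le> (\<Sum>e\<in>S. \<Sum>i\<in>{i \<in> V. i \<in> e}. (v i)\<^sup>2)"
    unfolding sum_distrib_left by (rule sum_mono)
  also have "\<dots> = (\<Sum>i\<in>V. \<Sum>e\<in>{e \<in> S. i \<in> e}. (v i)\<^sup>2)"
    using S V by (intro sum.swap_restrict) auto
  also have "\<dots> = (\<Sum>i\<in>V. real (card {e \<in> S. i \<in> e}) * (v i)\<^sup>2)" by simp
  also have "\<dots> \<le> (\<Sum>i\<in>V. real d * (v i)\<^sup>2)"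
    using S(3) by (intro sum_mono mult_right_mono) auto
  finally show ?thesis by (simp add: sum_distrib_left)
qed

text \<open>
  Edges with \<open>\<bar>w e\<bar> \<le> \<tau>\<close> contribute at most \<open>d \<tau>\<close>. By the sparsity hypotheses the components of
  the remaining graph have fewer than \<open>K\<close> vertices; tree components obey the sharp bound, and
  components with a cycle carry little weight.
\<close>

lemma quadratic_form_upper:
  fixes v :: "'v \<Rightarrow> real" and w :: "'v set \<Rightarrow> real" and \<tau> T1 T2 :: real
  assumes d: "d \<ge> 2" and \<alpha>: "\<alpha> > 0" and \<tau>: "\<tau> \<ge> 0" and K: "K \<ge> 1"
    and E: "finite E" "\<And>e. e \<in> E \<Longrightarrow> card e = 2" "\<And>x. card {e \<in> E. x \<in> e} \<le> d"
    and U: "finite U" "\<Union>E \<subseteq> U"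
    and T1: "\<And>V F. F \<subseteq> E \<Longrightarrow> V \<subseteq> U \<Longrightarrow> V \<noteq> {} \<Longrightarrow> \<Union>F \<subseteq> V \<Longrightarrow> card V \<le> K \<Longrightarrow>
      card V \<le> card F + 1 \<Longrightarrow> (\<Sum>e\<in>F. \<bar>w e\<bar> powr \<alpha>) \<le> T1"
    and T2: "\<And>V F. F \<subseteq> E \<Longrightarrow> V \<subseteq> U \<Longrightarrow> V \<noteq> {} \<Longrightarrow> \<Union>F \<subseteq> V \<Longrightarrow> card V \<le> K \<Longrightarrow>
      card V \<le> card F \<Longrightarrow> (\<Sum>e\<in>F. \<bar>w e\<bar> powr \<alpha>) \<le> T2"
    and KT: "T1 < real (K - 1) * \<tau> powr \<alpha>"
  shows "2 * (\<Sum>e\<in>E. \<bar>w e\<bar> * \<bar>prod v e\<bar>) \<le>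
    (d * \<tau> + limit_const d \<alpha> * T1 powr (1 / \<alpha>) + d * T2 powr (1 / \<alpha>)) * (\<Sum>i\<in>U. (v i)\<^sup>2)"
proof -
  define H where "H = limit_const d \<alpha>"
  have H: "H \<ge> 0" using limit_const_ge_1[OF d, of \<alpha>] by (simp add: H_def)
  define c where "c = H * T1 powr (1 / \<alpha>) + d * T2 powr (1 / \<alpha>)"
  define B where "B = {e \<in> E. \<tau> < \<bar>w e\<bar>}"
  define f where "f e = \<bar>w e\<bar> * \<bar>prod v e\<bar>" for e
  have BE: "B \<subseteq> E" and finB: "finite B" using E by (auto simp: B_def)
  have degS: "card {e \<in> S. x \<in> e} \<le> d" if "S \<subseteq> E" for S x
  proof -
    have "card {e \<in> S. x \<in> e} \<le> card {e \<in> E. x \<in> e}" using E that by (intro card_mono) auto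
    then show ?thesis using E(3)[of x] by simp
  qed
  have comp: "2 * (\<Sum>e\<in>{e \<in> B. e \<subseteq> V}. f e) \<le> c * (\<Sum>i\<in>V. (v i)\<^sup>2)"
    if gt: "grown_tree B V F" and VU: "V \<subseteq> U" for V F
  proof -
    note gtD = grown_treeD[OF gt]
    define N where "N = (\<Sum>i\<in>V. (v i)\<^sup>2)"
    have N: "N \<ge> 0" by (auto simp: N_def intro: sum_nonneg)
    have V0: "V \<noteq> {}" using gtD(5) by auto
    \<comment> \<open>A larger component would contain a tree with K vertices, whose K - 1 heavy
      edges alone violate \<open>T1\<close> by the choice of K.\<close>
    have "card V \<le> K"
    proof (rule ccontr)
      assume "\<not> card V \<le> K"
      then obtain V' F' where gt': "grown_tree B V' F'" "card V' = K" and sub: "V' \<subseteq> V"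
        using grown_tree_subtree[OF gt K] by auto
      note gtD' = grown_treeD[OF gt'(1)]
      have "real (K - 1) * \<tau> powr \<alpha> = (\<Sum>e\<in>F'. \<tau> powr \<alpha>)" using gtD'(5) gt'(2) by simp
      also have "\<dots> \<le> (\<Sum>e\<in>F'. \<bar>w e\<bar> powr \<alpha>)"
        using gtD'(3) \<tau> \<alpha> by (intro sum_mono powr_mono2) (auto simp: B_def)
      also have "\<dots> \<le> T1"
        using gtD' gt'(2) BE sub VU K by (intro T1[of F' V']) auto
      finally show False using KT by simp
    qed
    define S where "S = {e \<in> B. e \<subseteq> V}"
    have S: "finite S" "S \<subseteq> E" "\<Union>S \<subseteq> V" using finB BE by (auto simp: S_def)
    have FS: "F \<subseteq> S" using gtD by (auto simp: S_def)
    show ?thesis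
    \<comment> \<open>If the spanning tree F misses an edge of the component, there are at least as
      many edges as vertices and \<open>T2\<close> bounds every single weight.\<close>
    proof (cases "F = S")
      case True
      have "2 * (\<Sum>e\<in>S. f e) \<le> H * (\<Sum>e\<in>F. \<bar>w e\<bar> powr \<alpha>) powr (1 / \<alpha>) * N"
        unfolding f_def H_def N_def True[symmetric]
        using degS S True by (intro grown_tree_form_bound[OF d \<alpha> gt]) auto
      also have "\<dots> \<le> H * T1 powr (1 / \<alpha>) * N"
        using N H \<alpha> S VU V0 \<open>card V \<le> K\<close> gtD True
        by (intro mult_right_mono mult_left_mono powr_mono2 T1[of F V] sum_nonneg) auto
      also have "\<dots> \<le> c * N" using N by (intro mult_right_mono) (auto simp: c_def)
      finally show ?thesis by (simp add: S_def N_def)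
    next
      case False
      then have "card F < card S" using FS S by (intro psubset_card_mono) auto
      then have Z: "(\<Sum>e\<in>S. \<bar>w e\<bar> powr \<alpha>) \<le> T2"
        using S VU V0 \<open>card V \<le> K\<close> gtD(5) by (intro T2[of S V]) auto
      have we: "\<bar>w e\<bar> \<le> T2 powr (1 / \<alpha>)" if "e \<in> S" for e
      proof -
        have "\<bar>w e\<bar> powr \<alpha> \<le> T2"
          using member_le_sum[of e S "\<lambda>e. \<bar>w e\<bar> powr \<alpha>"] that S Z by auto
        then have "(\<bar>w e\<bar> powr \<alpha>) powr (1 / \<alpha>) \<le> T2 powr (1 / \<alpha>)"
          using \<alpha> by (intro powr_mono2) auto
        then show ?thesis using \<alpha> by (simp add: powr_powr)
      qed
      have "2 * (\<Sum>e\<in>S. f e) \<le> 2 * (\<Sum>e\<in>S. T2 powr (1 / \<alpha>) * \<bar>prod v e\<bar>)"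
        unfolding f_def using we by (intro mult_left_mono sum_mono mult_right_mono) auto
      also have "\<dots> = T2 powr (1 / \<alpha>) * (2 * (\<Sum>e\<in>S. \<bar>prod v e\<bar>))"
        by (simp add: sum_distrib_left mult_ac)
      also have "\<dots> \<le> T2 powr (1 / \<alpha>) * (d * N)"
        unfolding N_def using S degS E(2) gtD(1)
        by (intro mult_left_mono sum_abs_prod_edges_le) auto
      also have "\<dots> \<le> c * N" using N H by (simp add: c_def algebra_simps)
      finally show ?thesis by (simp add: S_def N_def)
    qed
  qed
  \<comment> \<open>Components are split off one at a time; what remains is again closed under edges
    of B.\<close>
  have closed: "2 * (\<Sum>e\<in>{e \<in> B. e \<subseteq> X}. f e) \<le> c * (\<Sum>i\<in>X. (v i)\<^sup>2)"
    if "X \<subseteq> U" "\<forall>e\<in>B. e \<inter> X \<noteq> {} \<longrightarrow> e \<subseteq> X" for X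
    using that
  proof (induction "card X" arbitrary: X rule: less_induct)
    case less
    have finX: "finite X" using less.prems U finite_subset by blast
    show ?case
    proof (cases "X = {}")
      case True
      have "{} \<notin> B" using BE E(2)[of "{}"] by auto
      then have "{e \<in> B. e \<subseteq> X} = {}" using True by auto
      then have "(\<Sum>e\<in>{e \<in> B. e \<subseteq> X}. f e) = 0" by (simp only: sum.empty)
      then show ?thesis using True by simp
    next
      case False
      then obtain x where x: "x \<in> X" by blast
      obtain V F where V: "grown_tree B V F" "x \<in> V" "V \<subseteq> X" "\<forall>e\<in>B. e \<inter> V \<noteq> {} \<longrightarrow> e \<subseteq> V"
        using grown_tree_component[OF finX x less.prems(2)] BE E(2) by blast
      define Y where "Y = X - V"
      have "card Y < card X" unfolding Y_def using finX V x by (intro psubset_card_mono) auto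
      moreover have "\<forall>e\<in>B. e \<inter> Y \<noteq> {} \<longrightarrow> e \<subseteq> Y"
        using less.prems(2) V(4) unfolding Y_def by blast
      ultimately have IH: "2 * (\<Sum>e\<in>{e \<in> B. e \<subseteq> Y}. f e) \<le> c * (\<Sum>i\<in>Y. (v i)\<^sup>2)"
        using less.hyps[of Y] less.prems(1) by (auto simp: Y_def)
      have eq: "{e \<in> B. e \<subseteq> X} = {e \<in> B. e \<subseteq> V} \<union> {e \<in> B. e \<subseteq> Y}"
        using V less.prems(2) unfolding Y_def by blast
      have disj: "{e \<in> B. e \<subseteq> V} \<inter> {e \<in> B. e \<subseteq> Y} = {}"
      proof -
        have "e \<noteq> {}" if "e \<in> B" for e using that BE E(2) by force
        then show ?thesis unfolding Y_def by blast
      qed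
      have "(\<Sum>e\<in>{e \<in> B. e \<subseteq> X}. f e) = (\<Sum>e\<in>{e \<in> B. e \<subseteq> V}. f e) + (\<Sum>e\<in>{e \<in> B. e \<subseteq> Y}. f e)"
        unfolding eq using finB disj by (intro sum.union_disjoint) auto
      moreover have "(\<Sum>i\<in>X. (v i)\<^sup>2) = (\<Sum>i\<in>V. (v i)\<^sup>2) + (\<Sum>i\<in>Y. (v i)\<^sup>2)"
        unfolding Y_def using V finX by (simp add: sum.subset_diff[of V X] add.commute)
      moreover have "2 * (\<Sum>e\<in>{e \<in> B. e \<subseteq> V}. f e) \<le> c * (\<Sum>i\<in>V. (v i)\<^sup>2)"
        using V less.prems(1) by (intro comp) auto
      ultimately show ?thesis using IH by (simp add: algebra_simps)
    qed
  qed
  have UB: "{e \<in> B. e \<subseteq> U} = B" using BE U by auto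
  have big: "2 * (\<Sum>e\<in>B. f e) \<le> c * (\<Sum>i\<in>U. (v i)\<^sup>2)"
    using closed[of U] BE U unfolding UB by blast
  have light: "2 * (\<Sum>e\<in>E - B. \<bar>prod v e\<bar>) \<le> d * (\<Sum>i\<in>U. (v i)\<^sup>2)"
  proof (rule sum_abs_prod_edges_le)
    show "card {e \<in> E - B. x \<in> e} \<le> d" for x by (rule degS) auto
  qed (use E U in auto)
  have "2 * (\<Sum>e\<in>E - B. f e) \<le> 2 * (\<Sum>e\<in>E - B. \<tau> * \<bar>prod v e\<bar>)"
    unfolding f_def by (intro mult_left_mono sum_mono mult_right_mono) (auto simp: B_def)
  also have "\<dots> = \<tau> * (2 * (\<Sum>e\<in>E - B. \<bar>prod v e\<bar>))"
    by (simp add: sum_distrib_left mult_ac)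
  also have "\<dots> \<le> \<tau> * (d * (\<Sum>i\<in>U. (v i)\<^sup>2))"
    using light \<tau> by (rule mult_left_mono)
  finally have small: "2 * (\<Sum>e\<in>E - B. f e) \<le> \<tau> * (d * (\<Sum>i\<in>U. (v i)\<^sup>2))" .
  have "2 * sum f E = 2 * sum f (E - B) + 2 * sum f B"
    using sum.subset_diff[OF BE E(1), of f] by simp
  also have "\<dots> \<le> \<tau> * (d * (\<Sum>i\<in>U. (v i)\<^sup>2)) + c * (\<Sum>i\<in>U. (v i)\<^sup>2)"
    using small big by (rule add_mono)
  also have "\<dots> = (d * \<tau> + c) * (\<Sum>i\<in>U. (v i)\<^sup>2)"
    by (simp only: distrib_right mult_ac)
  finally show ?thesis unfolding f_def H_def c_def by (simp only: add.assoc)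
qed

section \<open>The universal covering of a regular graph\<close>

definition ports :: "nat \<Rightarrow> 'v set set \<Rightarrow> 'v \<Rightarrow> nat \<Rightarrow> 'v \<Rightarrow> nat \<Rightarrow> 'v" where
  "ports d E x a y = (SOME b. bij_betw b {..<d} (nbrs E x) \<and> (y \<in> nbrs E x \<longrightarrow> b a = y))"

lemma ports:
  assumes "finite (nbrs E x)" "card (nbrs E x) = d" "a < d"
  shows "bij_betw (ports d E x a y) {..<d} (nbrs E x)" "y \<in> nbrs E x \<Longrightarrow> ports d E x a y a = y"
proof -
  have "\<exists>b. bij_betw b {..<d} (nbrs E x) \<and> (y \<in> nbrs E x \<longrightarrow> b a = y)"
  proof (cases "y \<in> nbrs E x")
    case True
    have "card ({..<d} - {a}) = card (nbrs E x - {y})" using assms True by simp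
    then obtain b where b: "bij_betw b ({..<d} - {a}) (nbrs E x - {y})"
      using finite_same_card_bij[of "{..<d} - {a}" "nbrs E x - {y}"] assms by auto
    have "bij_betw (b(a := y)) ({..<d} - {a}) (nbrs E x - {y})"
      using b by (subst bij_betw_cong[of _ _ b]) auto
    moreover have "bij_betw (b(a := y)) {a} {y}" by (simp add: bij_betw_def)
    ultimately have "bij_betw (b(a := y)) (({..<d} - {a}) \<union> {a}) ((nbrs E x - {y}) \<union> {y})"
      by (rule bij_betw_combine) blast
    moreover have "({..<d} - {a}) \<union> {a} = {..<d}" "(nbrs E x - {y}) \<union> {y} = nbrs E x"
      using assms True by auto
    ultimately show ?thesis by (intro exI[of _ "b(a := y)"]) auto
  next
    case False
    then show ?thesis using finite_same_card_bij[of "{..<d}" "nbrs E x"] assms by auto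
  qed
  from someI_ex[OF this]
  show "bij_betw (ports d E x a y) {..<d} (nbrs E x)" "y \<in> nbrs E x \<Longrightarrow> ports d E x a y a = y"
    unfolding ports_def by auto
qed

text \<open>
  The universal covering of a \<open>d\<close>-regular graph: the word \<open>a # v\<close> is sent to the neighbour with
  label \<open>a\<close> of the image of \<open>v\<close>, where the labels at \<open>v\<close> are chosen such that \<open>hd v\<close> leads back
  to the image of \<open>tl v\<close>.
\<close>

fun cover :: "nat \<Rightarrow> 'v set set \<Rightarrow> 'v \<Rightarrow> nat list \<Rightarrow> 'v" where
  "cover d E x [] = x"
| "cover d E x [a] = ports d E x 0 x a"
| "cover d E x (a # b # v) = ports d E (cover d E x (b # v)) b (cover d E x v) a"

definition cover_ports :: "nat \<Rightarrow> 'v set set \<Rightarrow> 'v \<Rightarrow> nat list \<Rightarrow> nat \<Rightarrow> 'v" where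
  "cover_ports d E x v = (case v of [] \<Rightarrow> ports d E x 0 x
     | b # v' \<Rightarrow> ports d E (cover d E x v) b (cover d E x v'))"

lemma cover_Cons: "cover d E x (a # v) = cover_ports d E x v a"
  by (cases v) (auto simp: cover_ports_def)

lemma cover_ports:
  assumes E: "E \<in> regular_graphs d n" and d: "d > 0" and x: "x < n" and v: "v \<in> tree_verts d"
  shows "cover d E x v < n \<and> bij_betw (cover_ports d E x v) {..<d} (nbrs E (cover d E x v)) \<and>
    (v \<noteq> [] \<longrightarrow> cover_ports d E x v (hd v) = cover d E x (tl v))"
  using v
proof (induction v)
  case Nil
  then show ?case using x d ports(1)[OF regular_nbrs(2,3)[OF E]] by (simp add: cover_ports_def)
next
  case (Cons b v)
  then have b: "b < d" and v: "v \<in> tree_verts d" by (auto simp: tree_verts_Cons)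
  have "cover d E x (b # v) \<in> nbrs E (cover d E x v)"
    unfolding cover_Cons using Cons.IH[OF v] b by (auto simp: bij_betw_def)
  then have backward: "cover d E x v \<in> nbrs E (cover d E x (b # v))" by (simp add: nbrs_commute)
  have lt: "cover d E x (b # v) < n"
    using \<open>cover d E x (b # v) \<in> _\<close> regular_nbrs(1)[OF E] by blast
  have "bij_betw (cover_ports d E x (b # v)) {..<d} (nbrs E (cover d E x (b # v)))"
    unfolding cover_ports_def list.case
    by (rule ports(1)[OF regular_nbrs(2)[OF E] regular_nbrs(3)[OF E lt] b])
  moreover have "cover_ports d E x (b # v) b = cover d E x v"
    unfolding cover_ports_def list.case
    by (rule ports(2)[OF regular_nbrs(2)[OF E] regular_nbrs(3)[OF E lt] b backward])
  ultimately show ?case using lt by simp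
qed

lemma cover_edge:
  assumes E: "E \<in> regular_graphs d n" and d: "d > 0" and x: "x < n" and f: "f \<in> tree_edges d"
  shows "cover d E x ` f \<in> E"
proof -
  obtain a v where f: "f = {v, a # v}" and av: "a # v \<in> tree_verts d"
    using f unfolding tree_edges_def by blast
  then have "a < d" "v \<in> tree_verts d" by (auto simp: tree_verts_Cons)
  then have "cover d E x (a # v) \<in> nbrs E (cover d E x v)"
    using cover_ports[OF E d x, of v] unfolding cover_Cons by (auto simp: bij_betw_def)
  then show ?thesis by (simp add: f nbrs_def)
qed

text \<open>The neighbours of s in the tree correspond to the labels at s: \<open>hd s\<close> leads
  to the parent, every other letter to a child. Since the labels are mapped bijectively to
  neighbours, the covering is injective on the neighbours of s.\<close>

lemma cover_port_of_tree_edge: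
  assumes E: "E \<in> regular_graphs d n" and d: "d > 0" and x: "x < n" and st: "{s, t} \<in> tree_edges d"
  shows "s \<in> tree_verts d \<and> (\<exists>a<d. cover d E x t = cover_ports d E x s a \<and>
    (if s \<noteq> [] \<and> a = hd s then t = tl s else t = a # s))"
proof -
  obtain a v where "{s, t} = {v, a # v}" and av: "a # v \<in> tree_verts d"
    using st unfolding tree_edges_def by blast
  then consider "s = v" "t = a # v" | "s = a # v" "t = v" by (auto simp: doubleton_eq_iff)
  then show ?thesis
  proof cases
    case 1
    then have "a < d" "s \<in> tree_verts d" "\<not> (s \<noteq> [] \<and> a = hd s)"
      using av by (auto simp: tree_verts_Cons)
    then show ?thesis using 1 by (auto simp: cover_Cons intro!: exI[of _ a])
  next
    case 2
    have "cover_ports d E x s a = cover d E x t"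
      using cover_ports[OF E d x av] 2 by simp
    then show ?thesis using 2 av by (auto simp: tree_verts_Cons intro!: exI[of _ a])
  qed
qed

lemma cover_locally_inj:
  assumes E: "E \<in> regular_graphs d n" and d: "d > 0" and x: "x < n"
    and st: "{s, t} \<in> tree_edges d" "{s, t'} \<in> tree_edges d" and eq: "cover d E x t = cover d E x t'"
  shows "t = t'"
proof -
  obtain a where a: "s \<in> tree_verts d" "a < d" "cover d E x t = cover_ports d E x s a"
      "if s \<noteq> [] \<and> a = hd s then t = tl s else t = a # s"
    using cover_port_of_tree_edge[OF E d x st(1)] by blast
  obtain b where b: "b < d" "cover d E x t' = cover_ports d E x s b"
      "if s \<noteq> [] \<and> b = hd s then t' = tl s else t' = b # s"
    using cover_port_of_tree_edge[OF E d x st(2)] by blast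
  have "inj_on (cover_ports d E x s) {..<d}"
    using cover_ports[OF E d x a(1)] by (auto simp: bij_betw_def)
  then have "a = b" using a b eq by (auto dest: inj_onD)
  then show ?thesis using a b by (auto split: if_splits)
qed

text \<open>
  Pushing a function forward along the covering does not decrease the functional, since \<open>2 p \<ge> 1\<close>:
  this is why every \<open>d\<close>-regular graph does at least as well as the tree.
\<close>

lemma pushforward_increases:
  fixes u :: "nat list \<Rightarrow> real"
  assumes E: "E \<in> regular_graphs d n" and d: "d > 0" and x: "x < n" and p: "p \<ge> 1/2"
    and F: "finite F" "F \<subseteq> tree_edges d" and u: "\<And>i. 0 \<le> u i"
  defines "\<phi> \<equiv> cover d E x"
  defines "U \<equiv> \<lambda>y. \<Sum>s\<in>{s \<in> \<Union>F. \<phi> s = y}. u s"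
  shows "(\<Sum>f\<in>F. prod u f powr p) \<le> (\<Sum>e\<in>(\<lambda>f. \<phi> ` f) ` F. prod U e powr p)"
proof -
  have U0: "0 \<le> U y" for y unfolding U_def using u by (intro sum_nonneg)
  have finV: "finite (\<Union>F)" using finite_Union_tree_edges[OF F] .
  have "(\<Sum>f\<in>F. prod u f powr p) = (\<Sum>e\<in>(\<lambda>f. \<phi> ` f) ` F. \<Sum>f\<in>{f \<in> F. \<phi> ` f = e}. prod u f powr p)"
    by (rule sum.image_gen[OF F(1)])
  also have "\<dots> \<le> (\<Sum>e\<in>(\<lambda>f. \<phi> ` f) ` F. prod U e powr p)"
  proof (rule sum_mono)
    fix e assume "e \<in> (\<lambda>f. \<phi> ` f) ` F"
    then obtain f0 where "f0 \<in> F" "e = \<phi> ` f0" by blast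
    then have "e \<in> E" unfolding \<phi>_def using F(2) cover_edge[OF E d x] by auto
    then have "card e = 2" using regular_graphsD(1)[OF E] by auto
    then obtain a b where e: "e = {a, b}" "a \<noteq> b" by (auto simp: card_2_iff)
    define Fe where "Fe = {f \<in> F. \<phi> ` f = e}"
    \<comment> \<open>A tree edge has only two ends, so each edge above e = {a, b} has exactly one
      end above a and one above b.\<close>
    define endp where "endp z f = (SOME s. s \<in> f \<and> \<phi> s = z)" for z f
    have endp: "endp z f \<in> f \<and> \<phi> (endp z f) = z" if "f \<in> Fe" "z \<in> e" for f z
    proof -
      have "\<exists>s. s \<in> f \<and> \<phi> s = z" using that unfolding Fe_def by auto
      then show ?thesis unfolding endp_def by (rule someI_ex)
    qed
    have ends: "{endp a f, endp b f} = f \<and> endp a f \<noteq> endp b f" if f: "f \<in> Fe" for f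
    proof -
      have ne: "endp a f \<noteq> endp b f" using endp[OF f, of a] endp[OF f, of b] e by auto
      have "f \<in> tree_edges d" using f F(2) by (auto simp: Fe_def)
      then obtain w where "f = {tl w, w}" unfolding tree_edges_eq by blast
      then show ?thesis using ne endp[OF f, of a] endp[OF f, of b] e by auto
    qed
    \<comment> \<open>Edges above e sharing their end above z coincide by local injectivity. The
      ends above z are thus distinct, and their masses add up to at most \<open>U z\<close>.\<close>
    have inj: "inj_on (endp z) Fe" if "z \<in> e" for z
    proof (rule inj_onI)
      fix f g assume f: "f \<in> Fe" and g: "g \<in> Fe" and eq: "endp z f = endp z g"
      define z' where "z' = (if z = a then b else a)"
      have zz: "z = a \<and> z' = b \<or> z = b \<and> z' = a" using that e by (auto simp: z'_def)
      then have z': "e = {z, z'}" using e by auto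
      from zz have fz: "{endp z f, endp z' f} = f" and gz: "{endp z g, endp z' g} = g"
        using ends[OF f] ends[OF g] by (metis insert_commute)+
      have "\<phi> (endp z' f) = \<phi> (endp z' g)" using endp[OF f, of z'] endp[OF g, of z'] z' by auto
      moreover have "{endp z f, endp z' f} \<in> tree_edges d" "{endp z f, endp z' g} \<in> tree_edges d"
        using f g F(2) fz gz eq by (auto simp: Fe_def)
      ultimately have "endp z' f = endp z' g"
        unfolding \<phi>_def using cover_locally_inj[OF E d x] by blast
      then show "f = g" using fz gz eq by metis
    qed
    have le: "(\<Sum>f\<in>Fe. u (endp z f)) \<le> U z" if z: "z \<in> e" for z
    proof -
      have "(\<Sum>f\<in>Fe. u (endp z f)) = (\<Sum>s\<in>endp z ` Fe. u s)"
        using sum.reindex[OF inj[OF z], of u] by simp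
      also have "\<dots> \<le> U z"
        unfolding U_def
      proof (rule sum_mono2)
        show "finite {s \<in> \<Union>F. \<phi> s = z}" by (rule finite_subset[OF _ finV]) blast
        show "endp z ` Fe \<subseteq> {s \<in> \<Union>F. \<phi> s = z}" using endp[OF _ z] unfolding Fe_def by blast
      qed (rule u)
      finally show ?thesis .
    qed
    \<comment> \<open>With 2 p \<ge> 1 the p-th powers are collected into the power 2 p of a sum of
      square roots, to which Cauchy-Schwarz applies.\<close>
    have "(\<Sum>f\<in>Fe. prod u f powr p) = (\<Sum>f\<in>Fe. (u (endp a f) powr (1/2) * u (endp b f) powr (1/2)) powr (2 * p))"
    proof (rule sum.cong[OF refl])
      fix f assume "f \<in> Fe"
      note ends[OF this]
      then have "prod u f = prod u {endp a f, endp b f}" "endp a f \<noteq> endp b f" by simp_all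
      then have "prod u f = u (endp a f) * u (endp b f)" by simp
      then show "prod u f powr p = (u (endp a f) powr (1/2) * u (endp b f) powr (1/2)) powr (2 * p)"
        using u by (simp add: powr_mult powr_powr)
    qed
    also have "\<dots> \<le> (\<Sum>f\<in>Fe. u (endp a f) powr (1/2) * u (endp b f) powr (1/2)) powr (2 * p)"
      using p by (intro sum_powr_le_powr_sum) auto
    also have "\<dots> \<le> ((\<Sum>f\<in>Fe. u (endp a f)) powr (1/2) * (\<Sum>f\<in>Fe. u (endp b f)) powr (1/2)) powr (2 * p)"
      using p u by (intro powr_mono2 sum_powr_mult_powr_le sum_nonneg) auto
    also have "\<dots> \<le> (U a powr (1/2) * U b powr (1/2)) powr (2 * p)"
      using p u e by (intro powr_mono2 mult_mono le mult_nonneg_nonneg sum_nonneg) auto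
    also have "\<dots> = prod U e powr p"
      using e U0 by (simp add: powr_mult powr_powr)
    finally show "(\<Sum>f\<in>{f \<in> F. \<phi> ` f = e}. prod u f powr p) \<le> prod U e powr p"
      unfolding Fe_def .
  qed
  finally show ?thesis .
qed

section \<open>Balls in regular graphs\<close>

text \<open>Including the diagonal in the relation makes its r-th power describe distance at most r
  instead of walks of length exactly r.\<close>

definition gball :: "'v set set \<Rightarrow> nat \<Rightarrow> 'v \<Rightarrow> 'v set" where
  "gball E r x = {y. (x, y) \<in> {(a, b). a = b \<or> {a, b} \<in> E} ^^ r}"

lemma gball_0: "gball E 0 x = {x}"
  by (auto simp: gball_def)

lemma gball_Suc: "gball E (Suc r) x = (\<Union>y\<in>gball E r x. insert y (nbrs E y))"
  by (auto simp: gball_def nbrs_def relcomp_unfold)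

lemma gball_commute: "y \<in> gball E r x \<longleftrightarrow> x \<in> gball E r y"
proof -
  have "(y, x) \<in> R ^^ r" if "(x, y) \<in> R ^^ r" "sym R" for x y and R :: "'a rel"
    using that(1)
  proof (induction r arbitrary: y)
    case (Suc r)
    then obtain z where "(x, z) \<in> R ^^ r" "(z, y) \<in> R" by auto
    then show ?case using Suc.IH[of z] that(2) by (intro relpow_Suc_I2[of y z]) (auto dest: symD)
  qed simp
  moreover have "sym {(a, b). a = b \<or> {a, b} \<in> E}" by (auto simp: sym_def insert_commute)
  ultimately show ?thesis unfolding gball_def by blast
qed

lemma gball_regular:
  assumes E: "E \<in> regular_graphs d n" and x: "x < n"
  shows "gball E r x \<subseteq> {..<n}" "card (gball E r x) \<le> (d + 1) ^ r"
proof -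
  have *: "gball E r x \<subseteq> {..<n} \<and> card (gball E r x) \<le> (d + 1) ^ r"
  proof (induction r)
    case (Suc r)
    have fin: "finite (gball E r x)" using Suc finite_subset by blast
    have "card (gball E (Suc r) x) \<le> (\<Sum>y\<in>gball E r x. card (insert y (nbrs E y)))"
      unfolding gball_Suc using fin by (rule card_UN_le)
    also have "\<dots> \<le> (\<Sum>y\<in>gball E r x. d + 1)"
    proof (rule sum_mono)
      fix y assume "y \<in> gball E r x"
      then have "card (nbrs E y) = d" using Suc regular_nbrs(3)[OF E] by auto
      then show "card (insert y (nbrs E y)) \<le> d + 1"
        using card_insert_le_m1[of "d + 1" "nbrs E y" y] by simp
    qed
    also have "\<dots> = card (gball E r x) * (d + 1)" by simp
    also have "\<dots> \<le> (d + 1) ^ r * (d + 1)" using Suc by (intro mult_right_mono) auto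
    also have "\<dots> = (d + 1) ^ Suc r" by simp
    finally show ?case using Suc regular_nbrs(1)[OF E] unfolding gball_Suc by auto
  qed (use x in \<open>auto simp: gball_0\<close>)
  then show "gball E r x \<subseteq> {..<n}" "card (gball E r x) \<le> (d + 1) ^ r" by auto
qed

lemma gball_mono: "r \<le> s \<Longrightarrow> gball E r x \<subseteq> gball E s x"
  by (induction rule: dec_induct) (auto simp: gball_Suc)

lemma cover_in_gball:
  assumes E: "E \<in> regular_graphs d n" and d: "d > 0" and x: "x < n"
  shows "v \<in> tree_verts d \<Longrightarrow> cover d E x v \<in> gball E (length v) x"
proof (induction v)
  case (Cons a v)
  then have v: "v \<in> tree_verts d" "a < d" by (auto simp: tree_verts_Cons)
  then have "cover d E x (a # v) \<in> nbrs E (cover d E x v)"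
    using cover_ports[OF E d x, of v] unfolding cover_Cons by (auto simp: bij_betw_def)
  then show ?case using Cons.IH[OF v(1)] by (auto simp: gball_Suc)
qed (simp add: gball_0)

text \<open>The equality case of Hoelder's inequality.\<close>

lemma optimal_weights:
  fixes a :: "'e \<Rightarrow> real"
  assumes \<alpha>: "\<alpha> > 1" and a: "\<And>e. e \<in> S \<Longrightarrow> 0 \<le> a e"
  shows "\<exists>t. (\<forall>e. 0 \<le> t e) \<and> (\<Sum>e\<in>S. t e powr \<alpha>) \<le> 1 \<and>
    (\<Sum>e\<in>S. a e powr (\<alpha> / (\<alpha> - 1))) powr ((\<alpha> - 1) / \<alpha>) \<le> (\<Sum>e\<in>S. t e * a e)"
proof -
  define \<beta> where "\<beta> = \<alpha> / (\<alpha> - 1)"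
  define A where "A = (\<Sum>e\<in>S. a e powr \<beta>)"
  define t where "t e = a e powr (\<beta> / \<alpha>) / A powr (1 / \<alpha>)" for e
  have \<beta>: "\<beta> > 0" "\<beta> / \<alpha> + 1 = \<beta>" using \<alpha> by (auto simp: \<beta>_def field_simps)
  have A0: "A \<ge> 0" by (simp add: A_def sum_nonneg)
  show ?thesis
  proof (cases "A = 0")
    case True
    then show ?thesis using \<alpha> a
      by (intro exI[of _ "\<lambda>_. 0"]) (auto simp: \<beta>_def[symmetric] A_def[symmetric])
  next
    case False
    then have A: "A > 0" using A0 by simp
    have "t e powr \<alpha> = a e powr \<beta> / A" for e
      using A \<alpha> by (simp add: t_def powr_divide powr_powr)
    then have "(\<Sum>e\<in>S. t e powr \<alpha>) = 1"
      using A by (simp add: sum_divide_distrib[symmetric] A_def[symmetric])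
    moreover have "(\<Sum>e\<in>S. t e * a e) = A powr ((\<alpha> - 1) / \<alpha>)"
    proof -
      have "t e * a e = a e powr \<beta> / A powr (1 / \<alpha>)" if "e \<in> S" for e
      proof -
        have "a e powr (\<beta> / \<alpha>) * a e = a e powr (\<beta> / \<alpha>) * a e powr 1"
          using a[OF that] by simp
        also have "\<dots> = a e powr \<beta>" unfolding powr_add[symmetric] \<beta>(2) ..
        finally show ?thesis by (simp add: t_def)
      qed
      then have "(\<Sum>e\<in>S. t e * a e) = A / A powr (1 / \<alpha>)"
        by (simp add: sum_divide_distrib[symmetric] A_def)
      also have "\<dots> = A powr (1 - 1 / \<alpha>)" using A by (simp add: powr_diff)
      also have "1 - 1 / \<alpha> = (\<alpha> - 1) / \<alpha>" using \<alpha> by (simp add: field_simps)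
      finally show ?thesis .
    qed
    moreover have "\<forall>e. 0 \<le> t e" by (simp add: t_def)
    ultimately show ?thesis unfolding \<beta>_def[symmetric] A_def[symmetric]
      by (intro exI[of _ t]) simp
  qed
qed

text \<open>
  Edge weights \<open>\<ell> t\<close> cost a factor \<open>exp (- \<ell>\<^sup>\<alpha>)\<close> in probability and make the quadratic form of
  the test vector \<open>v\<close> exceed \<open>\<ell> c\<close>.
\<close>

definition local_witness ::
    "nat \<Rightarrow> real \<Rightarrow> real \<Rightarrow> nat set set \<Rightarrow> nat set \<Rightarrow> (nat set \<Rightarrow> real) \<Rightarrow> (nat \<Rightarrow> real) \<Rightarrow> bool" where
  "local_witness n \<alpha> c E N t v \<longleftrightarrow> (\<forall>e. 0 \<le> t e) \<and> (\<forall>i. 0 \<le> v i) \<and> (\<forall>i. i \<notin> N \<longrightarrow> v i = 0) \<and>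
     (\<Sum>i<n. (v i)\<^sup>2) \<le> 1 \<and> (\<Sum>e\<in>{e \<in> E. e \<subseteq> N}. t e powr \<alpha>) \<le> 1 \<and>
     c < 2 * (\<Sum>e\<in>{e \<in> E. e \<subseteq> N}. t e * prod v e)"

text \<open>The radius depends on d, \<alpha> and c alone, neither on n nor on the graph. For
  \<alpha> \<le> 2 one edge suffices. For \<alpha> > 2 a nearly optimal finitely supported function
  on the tree is fixed first, and r is the length of the longest word in its support.\<close>

lemma local_witness_exists:
  assumes d: "d \<ge> 2" and \<alpha>: "\<alpha> > 0" and c: "0 \<le> c" "c < limit_const d \<alpha>"
  shows "\<exists>r. \<forall>n. \<forall>E\<in>regular_graphs d n. \<forall>x<n. \<exists>t v. local_witness n \<alpha> c E (gball E r x) t v"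
proof (cases "\<alpha> \<le> 2")
  case True
  have "\<exists>t v. local_witness n \<alpha> c E (gball E 1 x) t v" if E: "E \<in> regular_graphs d n" and x: "x < n" for n E x
  proof -
    define N where "N = gball E 1 x"
    have N: "N = insert x (nbrs E x)" using gball_Suc[of E 0 x] by (simp add: N_def gball_0)
    obtain y where y: "{x, y} \<in> E"
      using regular_nbrs(3)[OF E x] d by (force simp: nbrs_def)
    then have xy: "x \<noteq> y" "y < n" using regular_graph_edge[OF E y] by auto
    define t where "t e = (if e = {x, y} then 1 else 0 :: real)" for e
    \<comment> \<open>A unit vector spread evenly over the edge, so that 2 v x v y = 1.\<close>
    define v where "v i = (if i = x \<or> i = y then sqrt (1/2) else 0)" for i
    define S where "S = {e \<in> E. e \<subseteq> N}"
    have S: "finite S" "{x, y} \<in> S"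
      using regular_graphsD(2)[OF E] y N by (auto simp: S_def nbrs_def)
    have "(\<Sum>i<n. (v i)\<^sup>2) = (\<Sum>i\<in>{x, y}. (v i)\<^sup>2)"
      using x xy by (intro sum.mono_neutral_right) (auto simp: v_def)
    also have "\<dots> = 1" using xy by (simp add: v_def)
    finally have 1: "(\<Sum>i<n. (v i)\<^sup>2) = 1" .
    have "(\<Sum>e\<in>S. t e powr \<alpha>) = (\<Sum>e\<in>{{x, y}}. t e powr \<alpha>)"
      using S \<alpha> by (intro sum.mono_neutral_right) (auto simp: t_def)
    then have 2: "(\<Sum>e\<in>S. t e powr \<alpha>) = 1" by (simp add: t_def)
    have "(\<Sum>e\<in>S. t e * prod v e) = (\<Sum>e\<in>{{x, y}}. t e * prod v e)"
      using S by (intro sum.mono_neutral_right) (auto simp: t_def)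
    then have 3: "(\<Sum>e\<in>S. t e * prod v e) = 1/2" using xy by (simp add: t_def v_def)
    have "v i = 0" if "i \<notin> N" for i using that N y by (auto simp: v_def nbrs_def)
    moreover have "0 \<le> t e" "0 \<le> v i" for e i by (auto simp: t_def v_def)
    ultimately have "local_witness n \<alpha> c E N t v"
      unfolding local_witness_def S_def[symmetric] using 1 2 3 c True by (simp add: limit_const_def)
    then show ?thesis unfolding N_def by blast
  qed
  then show ?thesis by blast
next
  case False
  define p where "p = \<alpha> / (2 * (\<alpha> - 1))"
  define b where "b = (\<alpha> - 1) / \<alpha>"
  have p: "p \<ge> 1/2" and b: "b > 0"
    using growth_exponent[of \<alpha>] False by (auto simp: p_def b_def)
  have "c < 2 * tree_max d p powr b"
    using c False by (simp add: limit_const_def growth_const_def p_def b_def)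
  then have "(c / 2) powr (1 / b) < (tree_max d p powr b) powr (1 / b)"
    using c b by (intro powr_less_mono2) auto
  also have "\<dots> = tree_max d p" using b tree_max_pos[OF d p] by (simp add: powr_powr)
  finally obtain s where s: "s \<in> tree_sums d p" "(c / 2) powr (1 / b) < s"
    unfolding tree_max_def using less_cSupE[OF _ tree_sums_nonempty] by blast
  have "((c / 2) powr (1 / b)) powr b < s powr b"
    using s(2) b by (intro powr_less_mono2) auto
  then have cs: "c < 2 * s powr b" using b c by (simp add: powr_powr)
  obtain F u where F: "finite F" "F \<subseteq> tree_edges d" and u: "\<And>i. 0 \<le> u i" "(\<Sum>i\<in>\<Union>F. u i) \<le> 1"
    and sF: "s = (\<Sum>e\<in>F. prod u e powr p)"
    using s(1) by (rule tree_sumsE) blast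
  define r where "r = Max (insert 0 (length ` \<Union>F))"
  have finV: "finite (\<Union>F)" and V: "\<Union>F \<subseteq> tree_verts d"
    using finite_Union_tree_edges[OF F] Union_tree_edges_subset[OF F(2)] by auto
  have "\<exists>t v. local_witness n \<alpha> c E (gball E r x) t v" if E: "E \<in> regular_graphs d n" and x: "x < n" for n E x
  proof -
    define N where "N = gball E r x"
    define S where "S = {e \<in> E. e \<subseteq> N}"
    define \<phi> where "\<phi> = cover d E x"
    define U where "U y = (\<Sum>s\<in>{s \<in> \<Union>F. \<phi> s = y}. u s)" for y
    \<comment> \<open>The square root turns total mass at most 1 into Euclidean norm at most
      1.\<close>
    define v where "v y = sqrt (U y)" for y
    have d0: "d > 0" using d by simp
    have U0: "0 \<le> U y" for y unfolding U_def using u by (intro sum_nonneg)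
    have v0: "0 \<le> v y" for y using U0 by (simp add: v_def)
    have \<phi>N: "\<phi> s \<in> N" if "s \<in> \<Union>F" for s
    proof -
      have "length s \<le> r" unfolding r_def using finV that by (intro Max_ge) auto
      then show ?thesis
        using cover_in_gball[OF E d0 x, of s] gball_mono[of "length s" r E x] that V
        unfolding N_def \<phi>_def by blast
    qed
    have finS: "finite S" using regular_graphsD(2)[OF E] by (simp add: S_def)
    have imS: "(\<lambda>f. \<phi> ` f) ` F \<subseteq> S"
      using cover_edge[OF E d0 x] F(2) \<phi>N unfolding S_def \<phi>_def by blast
    have "s \<le> (\<Sum>e\<in>(\<lambda>f. \<phi> ` f) ` F. prod U e powr p)"
      unfolding sF U_def \<phi>_def by (rule pushforward_increases[OF E d0 x p F u(1)])
    also have "\<dots> \<le> (\<Sum>e\<in>S. prod U e powr p)"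
      using finS imS by (intro sum_mono2) auto
    also have "\<dots> = (\<Sum>e\<in>S. prod v e powr (\<alpha> / (\<alpha> - 1)))"
    proof (rule sum.cong[OF refl])
      fix e
      have "prod U e = (prod v e)\<^sup>2"
        using U0 unfolding v_def by (simp add: prod_power_distrib)
      also have "\<dots> = prod v e powr 2" using v0 by (simp add: prod_nonneg)
      finally have "prod U e powr p = prod v e powr (2 * p)" by (simp only: powr_powr)
      moreover have "2 * p = \<alpha> / (\<alpha> - 1)" using False by (simp add: p_def field_simps)
      ultimately show "prod U e powr p = prod v e powr (\<alpha> / (\<alpha> - 1))" by simp
    qed
    finally have "s powr b \<le> (\<Sum>e\<in>S. prod v e powr (\<alpha> / (\<alpha> - 1))) powr b"
      using b tree_sums_nonneg[OF s(1)] by (intro powr_mono2) auto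
    moreover obtain t where t: "\<forall>e. 0 \<le> t e" "(\<Sum>e\<in>S. t e powr \<alpha>) \<le> 1"
      "(\<Sum>e\<in>S. prod v e powr (\<alpha> / (\<alpha> - 1))) powr b \<le> (\<Sum>e\<in>S. t e * prod v e)"
      unfolding b_def using optimal_weights[of \<alpha> S "prod v"] False v0 prod_nonneg[of _ v] by auto
    ultimately have form: "c < 2 * (\<Sum>e\<in>S. t e * prod v e)" using cs by linarith
    have "(\<Sum>i<n. (v i)\<^sup>2) = (\<Sum>i<n. U i)" using U0 by (simp add: v_def)
    also have "\<dots> = (\<Sum>s\<in>\<Union>F. u s)"
      unfolding U_def
    proof (rule sum.group[OF finV])
      have "\<phi> ` \<Union>F \<subseteq> N" by (intro image_subsetI \<phi>N)
      also have "\<dots> \<subseteq> {..<n}" unfolding N_def by (rule gball_regular(1)[OF E x])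
      finally show "\<phi> ` \<Union>F \<subseteq> {..<n}" .
    qed simp
    finally have "(\<Sum>i<n. (v i)\<^sup>2) \<le> 1" using u by simp
    moreover have "v i = 0" if "i \<notin> N" for i
    proof -
      have "{s \<in> \<Union>F. \<phi> s = i} = {}" using \<phi>N that by blast
      then show ?thesis unfolding v_def U_def by (simp only: sum.empty real_sqrt_zero)
    qed
    ultimately have "local_witness n \<alpha> c E N t v"
      unfolding local_witness_def S_def[symmetric] using t form v0 by blast
    then show ?thesis unfolding N_def by blast
  qed
  then show ?thesis by blast
qed

section \<open>Many disjoint balls\<close>

text \<open>Greedy choice: a selected x removes at most D members, including itself because
  \<open>N x\<close> is nonempty.\<close>

lemma disjoint_subfamily:
  assumes "finite A" and "\<And>x. x \<in> A \<Longrightarrow> N x \<noteq> {}"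
    and "\<And>x. x \<in> A \<Longrightarrow> card {y \<in> A. N y \<inter> N x \<noteq> {}} \<le> D"
  shows "\<exists>C\<subseteq>A. disjoint_family_on N C \<and> card A \<le> D * card C"
  using assms
proof (induction "card A" arbitrary: A rule: less_induct)
  case less
  show ?case
  proof (cases "A = {}")
    case True
    then show ?thesis by (intro exI[of _ "{}"]) (auto simp: disjoint_family_on_def)
  next
    case False
    then obtain x where x: "x \<in> A" by blast
    define X where "X = {y \<in> A. N y \<inter> N x \<noteq> {}}"
    have xX: "x \<in> X" "X \<subseteq> A" using x less.prems(2)[OF x] by (auto simp: X_def)
    have fin: "finite (A - X)" using less.prems(1) by simp
    have "card (A - X) < card A" using xX x less.prems(1) by (intro psubset_card_mono) auto
    moreover have "card {z \<in> A - X. N z \<inter> N y \<noteq> {}} \<le> D" if "y \<in> A - X" for y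
    proof -
      have "card {z \<in> A - X. N z \<inter> N y \<noteq> {}} \<le> card {z \<in> A. N z \<inter> N y \<noteq> {}}"
        using less.prems(1) by (intro card_mono) auto
      then show ?thesis using less.prems(3)[of y] that by simp
    qed
    ultimately obtain C where C: "C \<subseteq> A - X" "disjoint_family_on N C" "card (A - X) \<le> D * card C"
      using less.hyps[OF _ fin] less.prems(2) by blast
    have xC: "x \<notin> C" using C(1) xX by blast
    have finC: "finite C" using C(1) fin finite_subset by blast
    have "disjoint_family_on N (insert x C)"
      using C(1,2) unfolding disjoint_family_on_def X_def by blast
    moreover have "card A = card X + card (A - X)"
      using xX(2) less.prems(1) by (metis card_Diff_subset card_mono finite_subset le_add_diff_inverse)
    then have "card A \<le> D * card (insert x C)"
      using C(3) less.prems(3)[OF x] xC finC by (simp add: X_def)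
    ultimately show ?thesis using C(1) x by (intro exI[of _ "insert x C"]) auto
  qed
qed

text \<open>By symmetry of distance, the ball around y meets the ball around x only if y lies in the
  ball around some point of the latter. This leaves at most ((d + 1)^r)^2 centres y.\<close>

lemma disjoint_gballs:
  assumes E: "E \<in> regular_graphs d n"
  shows "\<exists>C\<subseteq>{..<n}. disjoint_family_on (gball E r) C \<and> n \<le> (d + 1) ^ (2 * r) * card C"
proof -
  have "\<exists>C\<subseteq>{..<n}. disjoint_family_on (gball E r) C \<and> card {..<n} \<le> (d + 1) ^ (2 * r) * card C"
  proof (rule disjoint_subfamily)
    fix x assume "x \<in> {..<n}"
    then have x: "x < n" by simp
    note gb = gball_regular[OF E]
    have fin: "finite (gball E r x)" using gb(1)[OF x] finite_subset by blast
    show "gball E r x \<noteq> {}" using gball_mono[of 0 r E x] by (auto simp: gball_0)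
    have "{y \<in> {..<n}. gball E r y \<inter> gball E r x \<noteq> {}} \<subseteq> (\<Union>z\<in>gball E r x. gball E r z)"
      using gball_commute by fast
    moreover have "finite (\<Union>z\<in>gball E r x. gball E r z)"
      using fin gb(1) gb(1)[OF x] finite_subset[OF _ finite_lessThan] by blast
    ultimately have "card {y \<in> {..<n}. gball E r y \<inter> gball E r x \<noteq> {}} \<le> card (\<Union>z\<in>gball E r x. gball E r z)"
      by (intro card_mono)
    also have "\<dots> \<le> (\<Sum>z\<in>gball E r x. card (gball E r z))" using fin by (rule card_UN_le)
    also have "\<dots> \<le> (\<Sum>z\<in>gball E r x. (d + 1) ^ r)"
      using gb(1)[OF x] by (intro sum_mono gb(2)) auto
    also have "\<dots> \<le> (d + 1) ^ r * (d + 1) ^ r" using gb(2)[OF x, of r] by simp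
    finally show "card {y \<in> {..<n}. gball E r y \<inter> gball E r x \<noteq> {}} \<le> (d + 1) ^ (2 * r)"
      by (simp add: mult_2 power_add)
  qed simp
  then show ?thesis by simp
qed

section \<open>Random weights on random regular graphs\<close>

lemma weibull_lawE:
  assumes "weibull_law \<alpha> \<mu>"
  obtains C1 C2 where "0 < C1" "0 < C2"
    "\<And>t. t \<ge> 1 \<Longrightarrow> C1 / 2 * exp (- (t powr \<alpha>)) \<le> measure \<mu> {t..}"
    "\<And>t. t \<ge> 1 \<Longrightarrow> measure \<mu> ({t..} \<union> {..-t}) \<le> C2 * exp (- (t powr \<alpha>))"
proof -
  obtain C1 C2 where C: "C1 > 0" "C2 > 0" and
    t: "\<And>t. t \<ge> 1 \<Longrightarrow> measure \<mu> {t..} \<in> {C1 / 2 * exp (- (t powr \<alpha>)) .. C2 / 2 * exp (- (t powr \<alpha>))} \<and>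
        measure \<mu> {..-t} \<in> {C1 / 2 * exp (- (t powr \<alpha>)) .. C2 / 2 * exp (- (t powr \<alpha>))}"
    using assms unfolding weibull_law_def by blast
  have sets: "sets \<mu> = sets borel" and "prob_space \<mu>" using assms by (auto simp: weibull_law_def)
  interpret prob_space \<mu> by fact
  have "measure \<mu> ({t..} \<union> {..-t}) \<le> C2 * exp (- (t powr \<alpha>))" if "t \<ge> 1" for t
    using measure_Un_le[of "{t..}" \<mu> "{..-t}"] t[OF that] by (simp add: sets)
  with C t show ?thesis using that[of C1 C2] by auto
qed

text \<open>The variable |x|^\<alpha> exceeds m with probability at most C exp (- m). Bounding the
  integrand by exp (s (m + 1)) where |x|^\<alpha> lies between m and m + 1 gives a geometric series
  of ratio exp (s - 1).\<close>

lemma weibull_exp_moment: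
  assumes law: "weibull_law \<alpha> \<mu>" and \<alpha>: "\<alpha> > 0" and s: "0 < s" "s < 1"
  shows "(\<integral>\<^sup>+x. ennreal (exp (s * \<bar>x\<bar> powr \<alpha>)) \<partial>\<mu>) < \<infinity>"
proof -
  obtain C1 C2 where C: "C2 > 0"
    and tail: "\<And>t. t \<ge> 1 \<Longrightarrow> measure \<mu> ({t..} \<union> {..-t}) \<le> C2 * exp (- (t powr \<alpha>))"
    using weibull_lawE[OF law] by metis
  have [measurable_cong]: "sets \<mu> = sets borel" and "prob_space \<mu>" using law by (auto simp: weibull_law_def)
  interpret prob_space \<mu> by fact
  define A where "A m = {x. real m \<le> \<bar>x\<bar> powr \<alpha>}" for m :: nat
  have A[measurable]: "A m \<in> sets \<mu>" for m
  proof -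
    have "{x \<in> space borel. real m \<le> \<bar>x\<bar> powr \<alpha>} \<in> sets borel" by measurable
    then show ?thesis by (simp add: A_def \<open>sets \<mu> = _\<close>)
  qed
  \<comment> \<open>The maximum with 1 covers m = 0, where the tail estimate, valid for t \<ge> 1
    only, says nothing.\<close>
  define C where "C = max 1 C2"
  have prA: "emeasure \<mu> (A m) \<le> ennreal (C * exp (- real m))" for m
  proof (cases "m = 0")
    case True
    have "prob (A 0) \<le> C" unfolding C_def by (intro max.coboundedI1 prob_le_1)
    then show ?thesis using True by (simp add: emeasure_eq_measure ennreal_leI)
  next
    case False
    define t where "t = real m powr (1 / \<alpha>)"
    have t: "t \<ge> 1" "t powr \<alpha> = real m"
      using False \<alpha> by (auto simp: t_def powr_powr ge_one_powr_ge_zero)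
    have "t \<le> \<bar>x\<bar>" if "x \<in> A m" for x
    proof -
      have "t \<le> (\<bar>x\<bar> powr \<alpha>) powr (1 / \<alpha>)"
        using that \<alpha> unfolding t_def A_def by (intro powr_mono2) auto
      then show ?thesis using \<alpha> by (simp add: powr_powr)
    qed
    then have "A m \<subseteq> {t..} \<union> {..-t}" by fastforce
    then have "measure \<mu> (A m) \<le> measure \<mu> ({t..} \<union> {..-t})"
      by (intro finite_measure_mono) auto
    also have "\<dots> \<le> C * exp (- real m)"
      using tail[OF t(1)] t(2) by (auto simp: C_def intro: order_trans[OF _ mult_right_mono])
    finally show ?thesis unfolding emeasure_eq_measure by (rule ennreal_leI)
  qed
  define f where "f m x = ennreal (exp (s * (real m + 1))) * indicator (A m) x" for m :: nat and x
  have "(\<integral>\<^sup>+x. ennreal (exp (s * \<bar>x\<bar> powr \<alpha>)) \<partial>\<mu>) \<le> (\<integral>\<^sup>+x. (\<Sum>m. f m x) \<partial>\<mu>)"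
  proof (rule nn_integral_mono)
    fix x
    define m where "m = nat \<lfloor>\<bar>x\<bar> powr \<alpha>\<rfloor>"
    have m: "real m \<le> \<bar>x\<bar> powr \<alpha>" "\<bar>x\<bar> powr \<alpha> \<le> real m + 1"
      unfolding m_def by (auto simp: of_nat_nat)
    have "ennreal (exp (s * \<bar>x\<bar> powr \<alpha>)) \<le> f m x"
      using m s by (auto simp: f_def A_def intro!: ennreal_leI)
    also have "\<dots> \<le> (\<Sum>m. f m x)"
      using sum_le_suminf[of "\<lambda>m. f m x" "{m}"] by (simp add: summableI)
    finally show "ennreal (exp (s * \<bar>x\<bar> powr \<alpha>)) \<le> (\<Sum>m. f m x)" .
  qed
  also have "\<dots> = (\<Sum>m. \<integral>\<^sup>+x. f m x \<partial>\<mu>)"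
    by (rule nn_integral_suminf) (simp add: f_def[abs_def])
  also have "\<dots> \<le> (\<Sum>m. ennreal (C * exp s * exp (s - 1) ^ m))"
  proof (intro suminf_le summableI)
    fix m
    have "(\<integral>\<^sup>+x. f m x \<partial>\<mu>) = ennreal (exp (s * (real m + 1))) * emeasure \<mu> (A m)"
      unfolding f_def by (simp add: nn_integral_cmult_indicator)
    also have "\<dots> \<le> ennreal (exp (s * (real m + 1))) * ennreal (C * exp (- real m))"
      by (intro mult_left_mono prA) auto
    also have "\<dots> = ennreal (exp (s * (real m + 1)) * (C * exp (- real m)))"
      by (rule ennreal_mult'[symmetric]) simp
    also have "exp (s * (real m + 1)) * (C * exp (- real m)) = C * exp s * exp (s - 1) ^ m"
      by (simp add: exp_of_nat_mult[symmetric] mult_exp_exp algebra_simps)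
    finally show "(\<integral>\<^sup>+x. f m x \<partial>\<mu>) \<le> ennreal (C * exp s * exp (s - 1) ^ m)" .
  qed
  also have "\<dots> < \<infinity>"
  proof -
    have "summable (\<lambda>m. C * exp s * exp (s - 1) ^ m)"
      using s by (intro summable_mult summable_geometric) auto
    then have "(\<Sum>m. ennreal (C * exp s * exp (s - 1) ^ m)) \<noteq> \<infinity>"
      unfolding infinity_ennreal_def by (rule ennreal_suminf_neq_top) (simp add: C_def)
    then show ?thesis by (simp add: less_top)
  qed
  finally show ?thesis .
qed

section \<open>Weights on edges and their independence from the graph\<close>

context weighted_random_regular_graph
begin

text \<open>The entry above the diagonal is chosen as the weight of an undirected edge, because the
  law and the independence are given there.\<close>

definition wt :: "nat set \<Rightarrow> 'a \<Rightarrow> real" where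
  "wt e = W (Min e) (Max e)"

lemma vertex_pair_ends:
  assumes "e \<in> vertex_pairs n"
  shows "Min e < Max e" "Max e < n" "e = {Min e, Max e}"
proof -
  obtain x y where xy: "e = {x, y}" "x < y"
    using assms by (metis (mono_tags, lifting) card_2_iff insert_commute linorder_less_linear mem_Collect_eq)
  then show "Min e < Max e" "Max e < n" "e = {Min e, Max e}" using assms by auto
qed

text \<open>Used for the edge sets of disjoint balls. The map from an edge to its ordered pair of
  ends carries disjoint edge sets to disjoint index sets of the matrix W.\<close>

lemma indep_blocks:
  assumes K: "\<And>j. j \<in> L \<Longrightarrow> K j \<subseteq> vertex_pairs n" "disjoint_family_on K L"
    and A: "\<And>j. j \<in> L \<Longrightarrow> A j \<in> sets (PiM (K j) (\<lambda>_. borel))" and L: "finite L"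
  shows "prob {\<omega> \<in> space M. \<forall>j\<in>L. (\<lambda>e\<in>K j. wt e \<omega>) \<in> A j} =
    (\<Prod>j\<in>L. prob {\<omega> \<in> space M. (\<lambda>e\<in>K j. wt e \<omega>) \<in> A j})"
proof (cases "L = {}")
  case False
  define p where "p e = (Min e, Max e)" for e :: "nat set"
  have inj: "inj_on p (vertex_pairs n)"
    by (intro inj_onI) (metis p_def prod.inject vertex_pair_ends(3))
  have "indep_vars (\<lambda>j. PiM (p ` K j) (\<lambda>_. borel))
      (\<lambda>j \<omega>. restrict (\<lambda>i. (case i of (i, j) \<Rightarrow> W i j) \<omega>) (p ` K j)) L"
  proof (rule indep_vars_restrict[OF W_indep])
    fix j assume j: "j \<in> L"
    have "p e \<in> {(i, j). i < j \<and> j < n}" if "e \<in> K j" for e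
      using vertex_pair_ends(1,2)[of e] K(1)[OF j] that by (auto simp: p_def)
    then show "p ` K j \<subseteq> {(i, j). i < j \<and> j < n}" by (rule image_subsetI)
  next
    show "disjoint_family_on (\<lambda>j. p ` K j) L"
      unfolding disjoint_family_on_def
    proof (intro ballI impI)
      fix i j assume ij: "i \<in> L" "j \<in> L" "i \<noteq> j"
      have "p ` K i \<inter> p ` K j = p ` (K i \<inter> K j)"
        using inj_on_image_Int[OF inj K(1)[OF ij(1)] K(1)[OF ij(2)]] by simp
      then show "p ` K i \<inter> p ` K j = {}" using K(2) ij by (simp add: disjoint_family_on_def)
    qed
  qed
  then have "indep_vars (\<lambda>j. PiM (K j) (\<lambda>_. borel))
      (\<lambda>j \<omega>. (\<lambda>y. \<lambda>e\<in>K j. y (p e)) (restrict (\<lambda>i. (case i of (i, j) \<Rightarrow> W i j) \<omega>) (p ` K j))) L"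
    by (rule indep_vars_compose2) (intro measurable_restrict measurable_component_singleton imageI)
  moreover have "(\<lambda>y. \<lambda>e\<in>K j. y (p e)) (restrict (\<lambda>i. (case i of (i, j) \<Rightarrow> W i j) \<omega>) (p ` K j)) =
      (\<lambda>e\<in>K j. wt e \<omega>)" for j \<omega>
    by (auto simp: p_def wt_def fun_eq_iff restrict_def)
  ultimately have "indep_vars (\<lambda>j. PiM (K j) (\<lambda>_. borel)) (\<lambda>j \<omega>. \<lambda>e\<in>K j. wt e \<omega>) L" by simp
  from indep_varsD_finite[OF this False L A]
  have "prob (\<Inter>j\<in>L. (\<lambda>\<omega>. \<lambda>e\<in>K j. wt e \<omega>) -` A j \<inter> space M) =
      (\<Prod>j\<in>L. prob ((\<lambda>\<omega>. \<lambda>e\<in>K j. wt e \<omega>) -` A j \<inter> space M))" by simp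
  moreover have "(\<Inter>j\<in>L. (\<lambda>\<omega>. \<lambda>e\<in>K j. wt e \<omega>) -` A j \<inter> space M) =
      {\<omega> \<in> space M. \<forall>j\<in>L. (\<lambda>e\<in>K j. wt e \<omega>) \<in> A j}" using False by auto
  moreover have "(\<lambda>\<omega>. \<lambda>e\<in>K j. wt e \<omega>) -` A j \<inter> space M = {\<omega> \<in> space M. (\<lambda>e\<in>K j. wt e \<omega>) \<in> A j}" for j
    by auto
  ultimately show ?thesis by simp
qed (simp add: prob_space)

lemma wt_measurable[measurable]: "e \<in> vertex_pairs n \<Longrightarrow> random_variable borel (wt e)"
  unfolding wt_def using vertex_pair_ends[of e] by (intro W_measurable) auto

lemma distr_wt: "e \<in> vertex_pairs n \<Longrightarrow> distr M borel (wt e) = \<mu>"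
  unfolding wt_def using vertex_pair_ends[of e] by (intro W_law) auto

lemma indep_wt: "indep_vars (\<lambda>_. borel) wt (vertex_pairs n)"
proof -
  define p where "p e = (Min e, Max e)" for e :: "nat set"
  have "indep_vars (\<lambda>e. PiM {p e} (\<lambda>_. borel))
      (\<lambda>e \<omega>. restrict (\<lambda>i. (case i of (i, j) \<Rightarrow> W i j) \<omega>) {p e}) (vertex_pairs n)"
  proof (rule indep_vars_restrict[OF W_indep])
    show "disjoint_family_on (\<lambda>e. {p e}) (vertex_pairs n)"
      unfolding disjoint_family_on_def
      by (metis (mono_tags, lifting) disjoint_insert(1) inf_bot_right p_def prod.inject singleton_iff vertex_pair_ends(3))
  qed (use vertex_pair_ends in \<open>auto simp: p_def\<close>)
  then have "indep_vars (\<lambda>_. borel)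
      (\<lambda>e \<omega>. (\<lambda>y. y (p e)) (restrict (\<lambda>i. (case i of (i, j) \<Rightarrow> W i j) \<omega>) {p e})) (vertex_pairs n)"
    by (rule indep_vars_compose2) (intro measurable_component_singleton, simp)
  moreover have "(\<lambda>e \<omega>. (\<lambda>y. y (p e)) (restrict (\<lambda>i. (case i of (i, j) \<Rightarrow> W i j) \<omega>) {p e})) = wt"
    by (auto simp: p_def wt_def fun_eq_iff)
  ultimately show ?thesis by simp
qed

text \<open>Chernoff's bound: by independence the exponential moment of the sum factorises into at
  most m per edge.\<close>

lemma prob_sum_wt_ge:
  assumes F: "F \<subseteq> vertex_pairs n" and s: "s > 0" and \<alpha>: "\<alpha> > 0"
    and m: "(\<integral>\<^sup>+x. ennreal (exp (s * \<bar>x\<bar> powr \<alpha>)) \<partial>\<mu>) \<le> ennreal m" "m \<ge> 0"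
  shows "prob {\<omega> \<in> space M. (\<Sum>e\<in>F. \<bar>wt e \<omega>\<bar> powr \<alpha>) \<ge> T} \<le> m ^ card F * exp (- s * T)"
proof -
  have fin: "finite F" using F finite_vertex_pairs finite_subset by blast
  have [measurable]: "wt e \<in> borel_measurable M" if "e \<in> F" for e using F that by auto
  have "emeasure M {\<omega> \<in> space M. (\<Sum>e\<in>F. \<bar>wt e \<omega>\<bar> powr \<alpha>) \<ge> T}
      \<le> ennreal (exp (- s * T)) * (\<integral>\<^sup>+\<omega>\<in>space M. ennreal (exp (s * (\<Sum>e\<in>F. \<bar>wt e \<omega>\<bar> powr \<alpha>))) \<partial>M)"
    by (rule Chernoff_ineq_nn_integral_ge[OF s]) auto
  also have "(\<integral>\<^sup>+\<omega>\<in>space M. ennreal (exp (s * (\<Sum>e\<in>F. \<bar>wt e \<omega>\<bar> powr \<alpha>))) \<partial>M) =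
      (\<integral>\<^sup>+\<omega>. (\<Prod>e\<in>F. ennreal (exp (s * \<bar>wt e \<omega>\<bar> powr \<alpha>))) \<partial>M)"
    by (intro nn_integral_cong) (simp add: sum_distrib_left exp_sum fin prod_ennreal)
  also have "\<dots> = (\<Prod>e\<in>F. \<integral>\<^sup>+\<omega>. ennreal (exp (s * \<bar>wt e \<omega>\<bar> powr \<alpha>)) \<partial>M)"
    by (intro indep_vars_nn_integral fin indep_vars_compose2[OF indep_vars_subset[OF indep_wt F]]) auto
  also have "\<dots> \<le> (\<Prod>e\<in>F. ennreal m)"
  proof (intro prod_mono_ennreal)
    fix e assume e: "e \<in> F"
    have "(\<integral>\<^sup>+\<omega>. ennreal (exp (s * \<bar>wt e \<omega>\<bar> powr \<alpha>)) \<partial>M) =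
        (\<integral>\<^sup>+x. ennreal (exp (s * \<bar>x\<bar> powr \<alpha>)) \<partial>distr M borel (wt e))"
      using e by (intro nn_integral_distr[symmetric]) auto
    also have "\<dots> \<le> ennreal m" using m distr_wt[of e] F e by auto
    finally show "(\<integral>\<^sup>+\<omega>. ennreal (exp (s * \<bar>wt e \<omega>\<bar> powr \<alpha>)) \<partial>M) \<le> ennreal m" .
  qed
  also have "(\<Prod>e\<in>F. ennreal m) = ennreal (m ^ card F)" using m by (simp add: ennreal_power)
  finally have "emeasure M {\<omega> \<in> space M. (\<Sum>e\<in>F. \<bar>wt e \<omega>\<bar> powr \<alpha>) \<ge> T}
      \<le> ennreal (exp (- s * T)) * ennreal (m ^ card F)" by (simp add: mult_left_mono)
  also have "\<dots> = ennreal (m ^ card F * exp (- s * T))"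
    using m by (simp add: ennreal_mult[symmetric] mult.commute)
  finally show ?thesis using m by (simp add: emeasure_eq_measure)
qed

lemma regular_graphs_nonempty: "regular_graphs d n \<noteq> {}"
  using measurable_space[OF G_measurable] not_empty by (auto simp: space_count_space)

lemma prob_G_in:
  assumes "\<G> \<subseteq> regular_graphs d n"
  shows "prob {\<omega> \<in> space M. G \<omega> \<in> \<G>} = card \<G> / card (regular_graphs d n)"
proof -
  have "prob (G -` \<G> \<inter> space M) = measure (distr M (count_space (regular_graphs d n)) G) \<G>"
    using assms by (intro measure_distr[symmetric] G_measurable) auto
  also have "\<dots> = card \<G> / card (regular_graphs d n)"
    unfolding G_uniform by (rule measure_uniform_count_measure[OF finite_regular_graphs assms])
  finally show ?thesis by (simp add: vimage_def Int_def conj_commute)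
qed

lemma G_regular: "\<omega> \<in> space M \<Longrightarrow> G \<omega> \<in> regular_graphs d n"
  using measurable_space[OF G_measurable] by (simp add: space_count_space)

text \<open>Independence is given for the adjacency matrix and W. The matrix determines the graph
  among the finitely many regular graphs, and the edge weights are a measurable function of
  W.\<close>

lemma prob_graph_and_weights:
  assumes \<G>: "\<G> \<subseteq> regular_graphs d n"
    and Q: "{y \<in> space (PiM (vertex_pairs n) (\<lambda>_. borel)). Q y} \<in> sets (PiM (vertex_pairs n) (\<lambda>_. borel))"
  shows "prob {\<omega> \<in> space M. G \<omega> \<in> \<G> \<and> Q (\<lambda>e\<in>vertex_pairs n. wt e \<omega>)} =
    prob {\<omega> \<in> space M. G \<omega> \<in> \<G>} * prob {\<omega> \<in> space M. Q (\<lambda>e\<in>vertex_pairs n. wt e \<omega>)}"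
proof -
  define I where "I = {..<n} \<times> {..<n}"
  define P where "P = PiM I (\<lambda>_. borel :: real measure)"
  define adj where "adj E = (\<lambda>(i, j)\<in>I. adjacency E i j)" for E
  define Wm where "Wm \<omega> = (\<lambda>(i, j)\<in>I. W i j \<omega>)" for \<omega>
  define h where "h y = (\<lambda>e\<in>vertex_pairs n. y (Min e, Max e))" for y :: "nat \<times> nat \<Rightarrow> real"
  have finI: "finite I" by (simp add: I_def)
  have indep: "indep_var P (\<lambda>\<omega>. adj (G \<omega>)) P Wm"
    using adjacency_indep_W unfolding P_def I_def adj_def Wm_def .
  have hm: "h \<in> P \<rightarrow>\<^sub>M PiM (vertex_pairs n) (\<lambda>_. borel)"
    unfolding h_def P_def I_def using vertex_pair_ends
    by (intro measurable_restrict measurable_component_singleton) (meson SigmaI lessThan_iff order.strict_trans)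
  have hW: "h (Wm \<omega>) = (\<lambda>e\<in>vertex_pairs n. wt e \<omega>)" for \<omega>
  proof
    fix e
    show "h (Wm \<omega>) e = (\<lambda>e\<in>vertex_pairs n. wt e \<omega>) e"
      using vertex_pair_ends[of e] by (auto simp: h_def Wm_def I_def wt_def restrict_def)
  qed
  define Xb where "Xb = h -` {y \<in> space (PiM (vertex_pairs n) (\<lambda>_. borel)). Q y} \<inter> space P"
  have Xb: "Xb \<in> sets P" unfolding Xb_def using hm Q by (rule measurable_sets)
  have inj: "inj_on adj (regular_graphs d n)"
  proof (rule inj_onI)
    fix E E' assume EE: "E \<in> regular_graphs d n" "E' \<in> regular_graphs d n" "adj E = adj E'"
    have "e \<in> E \<longleftrightarrow> e \<in> E'" if e: "e \<in> vertex_pairs n" for e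
    proof -
      have "(Min e, Max e) \<in> I" using vertex_pair_ends[OF e] by (auto simp: I_def)
      then have "adjacency E (Min e) (Max e) = adjacency E' (Min e) (Max e)"
        using fun_cong[OF EE(3), of "(Min e, Max e)"] by (simp add: adj_def)
      then show ?thesis using vertex_pair_ends(3)[OF e] by (simp add: adjacency_def of_bool_eq_iff)
    qed
    then show "E = E'" using regular_graphsD(1)[OF EE(1)] regular_graphsD(1)[OF EE(2)] by blast
  qed
  have adjP: "{adj E} \<in> sets P" for E
  proof -
    have "(\<Pi>\<^sub>E i\<in>I. {adj E i}) \<in> sets P"
      unfolding P_def using finI by (intro sets_PiM_I_finite) auto
    moreover have "(\<Pi>\<^sub>E i\<in>I. {adj E i}) = {adj E}"
      unfolding adj_def by (rule PiE_singleton[OF restrict_extensional])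
    ultimately show ?thesis by simp
  qed
  have "finite \<G>" using \<G> finite_regular_graphs by (rule finite_subset)
  then have cnt: "countable (adj ` \<G>)" by (intro countable_finite finite_imageI)
  have Xa: "adj ` \<G> \<in> sets P"
    by (rule sets.countable[OF _ cnt]) (elim imageE, simp only: adjP)
  have "prob ((\<lambda>\<omega>. (adj (G \<omega>), Wm \<omega>)) -` (adj ` \<G> \<times> Xb) \<inter> space M) =
      prob ((\<lambda>\<omega>. adj (G \<omega>)) -` (adj ` \<G>) \<inter> space M) * prob (Wm -` Xb \<inter> space M)"
    by (rule indep_varD[OF indep Xa Xb])
  moreover have Geq: "adj (G \<omega>) \<in> adj ` \<G> \<longleftrightarrow> G \<omega> \<in> \<G>" if "\<omega> \<in> space M" for \<omega>
    using inj_on_image_mem_iff[OF inj G_regular[OF that] \<G>] .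
  moreover have Weq: "Wm \<omega> \<in> Xb \<longleftrightarrow> Q (\<lambda>e\<in>vertex_pairs n. wt e \<omega>)" if \<omega>: "\<omega> \<in> space M" for \<omega>
  proof -
    have WP: "Wm \<omega> \<in> space P" by (simp add: Wm_def P_def space_PiM)
    have "h (Wm \<omega>) \<in> space (PiM (vertex_pairs n) (\<lambda>_. borel))" by (rule measurable_space[OF hm WP])
    with WP show ?thesis by (simp add: Xb_def hW)
  qed
  moreover have "(\<lambda>\<omega>. (adj (G \<omega>), Wm \<omega>)) -` (adj ` \<G> \<times> Xb) \<inter> space M =
      {\<omega> \<in> space M. G \<omega> \<in> \<G> \<and> Q (\<lambda>e\<in>vertex_pairs n. wt e \<omega>)}"
    using Geq Weq by (auto simp only: vimage_eq Int_iff mem_Collect_eq mem_Times_iff fst_conv snd_conv)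
  moreover have "(\<lambda>\<omega>. adj (G \<omega>)) -` (adj ` \<G>) \<inter> space M = {\<omega> \<in> space M. G \<omega> \<in> \<G>}"
    using Geq by (auto simp only: vimage_eq Int_iff mem_Collect_eq)
  moreover have "Wm -` Xb \<inter> space M = {\<omega> \<in> space M. Q (\<lambda>e\<in>vertex_pairs n. wt e \<omega>)}"
    using Weq by (auto simp only: vimage_eq Int_iff mem_Collect_eq)
  ultimately show ?thesis by simp
qed

end

abbreviation top_eigenvalue ::
    "nat \<Rightarrow> ('a \<Rightarrow> nat set set) \<Rightarrow> (nat \<Rightarrow> nat \<Rightarrow> 'a \<Rightarrow> real) \<Rightarrow> 'a \<Rightarrow> real" where
  "top_eigenvalue n G W \<omega> \<equiv> largest_eigenvalue (weighted_adjacency_mat n (G \<omega>) (\<lambda>i j. W i j \<omega>))"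

section \<open>First moment bound for heavy subgraphs\<close>

text \<open>There are at most n^k sets of size k, so each size from 0 to K contributes at most
  1.\<close>

lemma sum_subsets_card_le:
  assumes "n > 0"
  shows "(\<Sum>V\<in>{V. V \<subseteq> {..<n} \<and> card V \<le> K}. (1 / real n) ^ card V) \<le> real K + 1"
proof -
  define S where "S = {V. V \<subseteq> {..<n} \<and> card V \<le> K}"
  have fin: "finite S" by (rule finite_subset[of _ "Pow {..<n}"]) (auto simp: S_def)
  have "(\<Sum>V\<in>S. (1 / real n) ^ card V) = (\<Sum>k\<le>K. \<Sum>V\<in>{V \<in> S. card V = k}. (1 / real n) ^ card V)"
    by (rule sum.group[symmetric, OF fin]) (auto simp: S_def)
  also have "\<dots> \<le> (\<Sum>k\<le>K. 1)"
  proof (rule sum_mono)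
    fix k assume k: "k \<in> {..K}"
    have "{V \<in> S. card V = k} = {V. V \<subseteq> {..<n} \<and> card V = k}" using k by (auto simp: S_def)
    then have "(\<Sum>V\<in>{V \<in> S. card V = k}. (1 / real n) ^ card V) = real (n choose k) * (1 / real n) ^ k"
      by (simp add: n_subsets)
    also have "n choose k \<le> n ^ k"
      by (cases "k \<le> n") (auto intro: binomial_le_pow simp: binomial_eq_0)
    then have "real (n choose k) * (1 / real n) ^ k \<le> real n ^ k * (1 / real n) ^ k"
      by (intro mult_right_mono) (auto simp flip: of_nat_power)
    also have "\<dots> = 1" using assms by (simp add: power_divide)
    finally show "(\<Sum>V\<in>{V \<in> S. card V = k}. (1 / real n) ^ card V) \<le> 1" by simp
  qed
  finally show ?thesis by (simp add: S_def)
qed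

context weighted_random_regular_graph
begin

lemma quadratic_form_edges:
  assumes \<omega>: "\<omega> \<in> space M"
  shows "(\<Sum>i<n. \<Sum>j<n. adjacency (G \<omega>) i j * W i j \<omega> * v i * v j) = 2 * (\<Sum>e\<in>G \<omega>. wt e \<omega> * prod v e)"
proof -
  define E where "E = G \<omega>"
  have E: "E \<in> regular_graphs d n" unfolding E_def by (rule G_regular[OF \<omega>])
  define f where "f i j = W i j \<omega> * v i * v j" for i j
  have f: "f i j = f j i" if "i < n" "j < n" for i j
    using W_symmetric[OF that \<omega>] by (simp add: f_def)
  define A where "A = {(i, j). {i, j} \<in> E \<and> i < j}"
  define B where "B = {(i, j). {i, j} \<in> E \<and> j < i}"
  have AB: "A \<subseteq> {..<n} \<times> {..<n}" "B \<subseteq> {..<n} \<times> {..<n}"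
    using regular_graph_edge[OF E] by (auto simp: A_def B_def)
  have fin: "finite A" "finite B" using AB by (auto intro: finite_subset)
  have "(\<Sum>i<n. \<Sum>j<n. adjacency E i j * W i j \<omega> * v i * v j) =
      (\<Sum>(i, j)\<in>{..<n} \<times> {..<n}. adjacency E i j * f i j)"
    by (simp add: sum.cartesian_product f_def mult.assoc)
  also have "\<dots> = (\<Sum>(i, j)\<in>A \<union> B. f i j)"
  proof (rule sum.mono_neutral_cong_right)
    show "A \<union> B \<subseteq> {..<n} \<times> {..<n}" using AB by blast
    show "\<forall>z\<in>{..<n} \<times> {..<n} - (A \<union> B). (case z of (i, j) \<Rightarrow> adjacency E i j * f i j) = 0"
      using regular_graph_edge(3)[OF E] by (force simp: A_def B_def adjacency_def)
  qed (auto simp: A_def B_def adjacency_def)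
  also have "\<dots> = (\<Sum>(i, j)\<in>A. f i j) + (\<Sum>(i, j)\<in>B. f i j)"
    using fin by (intro sum.union_disjoint) (auto simp: A_def B_def)
  also have "(\<Sum>(i, j)\<in>B. f i j) = (\<Sum>(i, j)\<in>A. f i j)"
  proof (rule sum.reindex_bij_witness[of _ prod.swap prod.swap])
    fix z assume "z \<in> B"
    then show "(case prod.swap z of (i, j) \<Rightarrow> f i j) = (case z of (i, j) \<Rightarrow> f i j)"
      using AB f by (cases z) auto
  qed (auto simp: A_def B_def insert_commute)
  also have "(\<Sum>(i, j)\<in>A. f i j) = (\<Sum>e\<in>E. wt e \<omega> * prod v e)"
  proof (rule sum.reindex_bij_witness[of _ "\<lambda>e. (Min e, Max e)" "\<lambda>(i, j). {i, j}"])
    fix e assume "e \<in> E"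
    then have e: "e \<in> vertex_pairs n" using regular_graphsD(1)[OF E] by blast
    note ends = vertex_pair_ends[OF e]
    show "(case (Min e, Max e) of (i, j) \<Rightarrow> {i, j}) = e" using ends by simp
    show "(Min e, Max e) \<in> A" using ends \<open>e \<in> E\<close> by (simp add: A_def)
  next
    fix z assume "z \<in> A"
    then obtain i j where z: "z = (i, j)" "i < j" "{i, j} \<in> E" by (auto simp: A_def)
    then have mm: "Min {i, j} = i" "Max {i, j} = j" by auto
    then show "(Min (case z of (i, j) \<Rightarrow> {i, j}), Max (case z of (i, j) \<Rightarrow> {i, j})) = z"
      "(case z of (i, j) \<Rightarrow> {i, j}) \<in> E"
      "wt (case z of (i, j) \<Rightarrow> {i, j}) \<omega> * prod v (case z of (i, j) \<Rightarrow> {i, j}) = (case z of (i, j) \<Rightarrow> f i j)"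
      using z by (simp_all add: wt_def f_def)
  qed
  finally show ?thesis by (simp add: E_def)
qed

lemma largest_eigenvalue_weighted:
  assumes \<omega>: "\<omega> \<in> space M" and n: "n > 0"
  defines "lam \<equiv> top_eigenvalue n G W \<omega>"
  shows "2 * (\<Sum>e\<in>G \<omega>. wt e \<omega> * prod v e) \<le> lam * (\<Sum>i<n. (v i)\<^sup>2)"
    and "\<exists>u. (\<Sum>i<n. (u i)\<^sup>2) = 1 \<and> 2 * (\<Sum>e\<in>G \<omega>. wt e \<omega> * prod u e) = lam"
proof -
  have sym: "adjacency (G \<omega>) i j * W i j \<omega> = adjacency (G \<omega>) j i * W j i \<omega>" if "i < n" "j < n" for i j
    using W_symmetric[OF that \<omega>] by (simp add: adjacency_def insert_commute)
  note ray = largest_eigenvalue_rayleigh[where a = "\<lambda>i j. adjacency (G \<omega>) i j * W i j \<omega>", OF n]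
  show "2 * (\<Sum>e\<in>G \<omega>. wt e \<omega> * prod v e) \<le> lam * (\<Sum>i<n. (v i)\<^sup>2)"
    using ray(1)[of v] sym quadratic_form_edges[OF \<omega>, of v]
    by (simp add: lam_def weighted_adjacency_mat_def)
  show "\<exists>u. (\<Sum>i<n. (u i)\<^sup>2) = 1 \<and> 2 * (\<Sum>e\<in>G \<omega>. wt e \<omega> * prod u e) = lam"
    using ray(2) sym quadratic_form_edges[OF \<omega>]
    by (simp add: lam_def weighted_adjacency_mat_def)
qed

definition heavy :: "real \<Rightarrow> real \<Rightarrow> nat set set \<Rightarrow> 'a set" where
  "heavy \<alpha> T F = {\<omega> \<in> space M. F \<subseteq> G \<omega> \<and> T \<le> (\<Sum>e\<in>F. \<bar>wt e \<omega>\<bar> powr \<alpha>)}"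

text \<open>Independence of graph and weights makes the probability a product: the switching
  estimate for containing F times Chernoff's bound for its weights.\<close>

lemma heavy:
  assumes F: "F \<subseteq> vertex_pairs n" "card F \<le> k" and n: "n \<ge> 8 + 4 * d + 4 * k" and d: "d > 0"
    and \<alpha>: "\<alpha> > 0" and s: "s > 0"
    and m: "(\<integral>\<^sup>+x. ennreal (exp (s * \<bar>x\<bar> powr \<alpha>)) \<partial>\<mu>) \<le> ennreal m" "m \<ge> 0"
  shows "heavy \<alpha> T F \<in> events"
    and "prob (heavy \<alpha> T F) \<le> (2 * real d / real n) ^ card F * (m ^ card F * exp (- s * T))"
proof -
  have wtF[measurable]: "wt e \<in> borel_measurable M" if "e \<in> F" for e using F that by auto
  define R where "R = regular_graphs d n"
  define \<G> where "\<G> = {E \<in> R. F \<subseteq> E}"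
  define Q where "Q y \<longleftrightarrow> T \<le> (\<Sum>e\<in>F. \<bar>y e\<bar> powr \<alpha>)" for y
  have eq: "heavy \<alpha> T F = {\<omega> \<in> space M. G \<omega> \<in> \<G> \<and> Q (\<lambda>e\<in>vertex_pairs n. wt e \<omega>)}"
  proof -
    have "(\<Sum>e\<in>F. \<bar>(\<lambda>e\<in>vertex_pairs n. wt e \<omega>) e\<bar> powr \<alpha>) = (\<Sum>e\<in>F. \<bar>wt e \<omega>\<bar> powr \<alpha>)" for \<omega>
      using F(1) by (intro sum.cong) auto
    then show ?thesis unfolding heavy_def \<G>_def Q_def R_def using G_regular by auto
  qed
  have Q: "{y \<in> space (PiM (vertex_pairs n) (\<lambda>_. borel)). Q y} \<in> sets (PiM (vertex_pairs n) (\<lambda>_. borel))"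
  proof -
    have [measurable]: "(\<lambda>y. y e) \<in> borel_measurable (PiM (vertex_pairs n) (\<lambda>_. borel))" if "e \<in> F" for e
      using F that by (intro measurable_component_singleton) auto
    show ?thesis unfolding Q_def by measurable
  qed
  have "{\<omega> \<in> space M. G \<omega> \<in> \<G>} = G -` \<G> \<inter> space M" by auto
  also have "\<dots> \<in> events" using G_measurable by (rule measurable_sets) (auto simp: \<G>_def R_def)
  finally have "{\<omega> \<in> space M. G \<omega> \<in> \<G>} \<inter> {\<omega> \<in> space M. T \<le> (\<Sum>e\<in>F. \<bar>wt e \<omega>\<bar> powr \<alpha>)} \<in> events"
    by (rule sets.Int) measurable
  moreover have "heavy \<alpha> T F = {\<omega> \<in> space M. G \<omega> \<in> \<G>} \<inter> {\<omega> \<in> space M. T \<le> (\<Sum>e\<in>F. \<bar>wt e \<omega>\<bar> powr \<alpha>)}"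
    unfolding heavy_def \<G>_def R_def using G_regular by auto
  ultimately show "heavy \<alpha> T F \<in> events" by simp
  have "prob (heavy \<alpha> T F) = prob {\<omega> \<in> space M. G \<omega> \<in> \<G>} * prob {\<omega> \<in> space M. Q (\<lambda>e\<in>vertex_pairs n. wt e \<omega>)}"
    unfolding eq by (rule prob_graph_and_weights[OF _ Q]) (auto simp: \<G>_def R_def)
  also have "{\<omega> \<in> space M. Q (\<lambda>e\<in>vertex_pairs n. wt e \<omega>)} =
      {\<omega> \<in> space M. T \<le> (\<Sum>e\<in>F. \<bar>wt e \<omega>\<bar> powr \<alpha>)}"
  proof -
    have "(\<Sum>e\<in>F. \<bar>(\<lambda>e\<in>vertex_pairs n. wt e \<omega>) e\<bar> powr \<alpha>) = (\<Sum>e\<in>F. \<bar>wt e \<omega>\<bar> powr \<alpha>)" for \<omega>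
      using F(1) by (intro sum.cong) auto
    then show ?thesis unfolding Q_def by simp
  qed
  also have "prob {\<omega> \<in> space M. G \<omega> \<in> \<G>} * prob {\<omega> \<in> space M. T \<le> (\<Sum>e\<in>F. \<bar>wt e \<omega>\<bar> powr \<alpha>)}
      \<le> (2 * real d / real n) ^ card F * (m ^ card F * exp (- s * T))"
  proof (intro mult_mono)
    have R: "card R > 0" using finite_regular_graphs regular_graphs_nonempty by (auto simp: R_def card_gt_0_iff)
    have "prob {\<omega> \<in> space M. G \<omega> \<in> \<G>} = card \<G> / card R"
      unfolding R_def by (rule prob_G_in) (auto simp: \<G>_def R_def)
    also have "\<dots> \<le> (2 * real d / real n) ^ card F"
      using card_regular_graphs_containing[OF d n F] R unfolding \<G>_def R_def
      by (simp only: pos_divide_le_eq of_nat_0_less_iff)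
    finally show "prob {\<omega> \<in> space M. G \<omega> \<in> \<G>} \<le> (2 * real d / real n) ^ card F" .
    show "prob {\<omega> \<in> space M. T \<le> (\<Sum>e\<in>F. \<bar>wt e \<omega>\<bar> powr \<alpha>)} \<le> m ^ card F * exp (- s * T)"
      by (rule prob_sum_wt_ge[OF F(1) s \<alpha> m])
  qed auto
  finally show "prob (heavy \<alpha> T F) \<le> (2 * real d / real n) ^ card F * (m ^ card F * exp (- s * T))" .
qed

text \<open>
  First moment bound over all labelled subgraphs with at most \<open>K\<close> vertices: \<open>n ^ card V\<close> choices
  of the vertices against the probability \<open>n ^ (- card F)\<close> of the edges.
\<close>

lemma dense_heavy_subgraphs:
  fixes m s :: real
  assumes n: "n \<ge> 8 + 4 * d + 4 * 2 ^ K" and d: "d > 0" and \<alpha>: "\<alpha> > 0" and s: "s > 0"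
    and m: "(\<integral>\<^sup>+x. ennreal (exp (s * \<bar>x\<bar> powr \<alpha>)) \<partial>\<mu>) \<le> ennreal m" "m \<ge> 0" and q: "q \<le> 1"
  shows "\<exists>B\<in>events. prob B \<le>
      2 ^ 2 ^ K * max 1 (2 * real d * m) ^ 2 ^ K * (real K + 1) * real n ^ (1 - q) * exp (- s * T) \<and>
    (\<forall>\<omega>\<in>space M - B. \<forall>V F. F \<subseteq> G \<omega> \<longrightarrow> V \<subseteq> {..<n} \<longrightarrow> \<Union>F \<subseteq> V \<longrightarrow> card V \<le> K \<longrightarrow>
      card V + q \<le> card F + 1 \<longrightarrow> (\<Sum>e\<in>F. \<bar>wt e \<omega>\<bar> powr \<alpha>) \<le> T)"
proof -
  define D where "D = max 1 (2 * real d * m)"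
  \<comment> \<open>All subsets of V are counted instead of its pairs: at most k edges fit on K
    vertices, and there are at most 2^k edge sets. Only boundedness in n matters.\<close>
  define k :: nat where "k = 2 ^ K"
  define Vs where "Vs = {V. V \<subseteq> {..<n} \<and> card V \<le> K}"
  \<comment> \<open>The case q = 0 admits trees, for which n^(card V - card F) can be as large as n.
    The case q = 1 requires at least as many edges as vertices, and the factor n disappears.\<close>
  define Fs where "Fs V = {F. F \<subseteq> vertex_pairs n \<and> F \<subseteq> Pow V \<and> card V + q \<le> card F + 1}" for V
  have n0: "n > 0" using n by simp
  have finVs: "finite Vs" by (rule finite_subset[of _ "Pow {..<n}"]) (auto simp: Vs_def)
  have finV: "finite V" if "V \<in> Vs" for V using that finite_subset by (auto simp: Vs_def)
  have cardPow: "card (Pow V) \<le> k" if "V \<in> Vs" for V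
    using that finV[OF that] by (simp add: card_Pow k_def Vs_def)
  have finFs: "finite (Fs V)" and cardFs: "card (Fs V) \<le> 2 ^ k" if V: "V \<in> Vs" for V
  proof -
    have sub: "Fs V \<subseteq> Pow (Pow V)" by (auto simp: Fs_def)
    have fin: "finite (Pow (Pow V))" using finV[OF V] by simp
    show "finite (Fs V)" using sub fin by (rule finite_subset)
    have "card (Fs V) \<le> card (Pow (Pow V))" using fin sub by (rule card_mono)
    also have "\<dots> = 2 ^ card (Pow V)" using finV[OF V] by (subst card_Pow) auto
    also have "\<dots> \<le> 2 ^ k" using cardPow[OF V] by simp
    finally show "card (Fs V) \<le> 2 ^ k" .
  qed
  have cardF: "card F \<le> k" if "V \<in> Vs" "F \<in> Fs V" for V F
    using card_mono[of "Pow V" F] finV[OF that(1)] cardPow[OF that(1)] that(2) by (auto simp: Fs_def)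
  have n': "n \<ge> 8 + 4 * d + 4 * k" using n by (simp add: k_def)
  define c where "c = D ^ k * real n ^ (1 - q) * exp (- s * T)"
  define B where "B = (\<Union>V\<in>Vs. \<Union>F\<in>Fs V. heavy \<alpha> T F)"
  have ev: "heavy \<alpha> T F \<in> events" if "V \<in> Vs" "F \<in> Fs V" for V F
    by (rule heavy(1)[OF _ cardF[OF that] n' d \<alpha> s m]) (use that in \<open>auto simp: Fs_def\<close>)
  have B: "B \<in> events" unfolding B_def using finVs finFs ev by (intro sets.finite_UN) auto
  have pr: "prob (heavy \<alpha> T F) \<le> (1 / real n) ^ card V * c" if V: "V \<in> Vs" and F: "F \<in> Fs V" for V F
  proof -
    have "prob (heavy \<alpha> T F) \<le> (2 * real d / real n) ^ card F * (m ^ card F * exp (- s * T))"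
      by (rule heavy(2)[OF _ cardF[OF V F] n' d \<alpha> s m]) (use F in \<open>auto simp: Fs_def\<close>)
    also have "\<dots> = (2 * real d * m) ^ card F * (1 / real n) ^ card F * exp (- s * T)"
      by (simp add: power_mult_distrib power_divide)
    also have "\<dots> \<le> D ^ k * ((1 / real n) ^ card V * real n ^ (1 - q)) * exp (- s * T)"
    proof (intro mult_right_mono mult_mono)
      have "(2 * real d * m) ^ card F \<le> D ^ card F" using m by (intro power_mono) (auto simp: D_def)
      also have "\<dots> \<le> D ^ k" using cardF[OF V F] by (intro power_increasing) (auto simp: D_def)
      finally show "(2 * real d * m) ^ card F \<le> D ^ k" .
      have "real n ^ card V * 1 \<le> real n ^ (card F + (1 - q))"
        using F q n0 by (auto simp: Fs_def intro!: power_increasing)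
      then show "(1 / real n) ^ card F \<le> (1 / real n) ^ card V * real n ^ (1 - q)"
        using n0 by (simp add: power_divide power_add field_simps)
    qed (auto simp: D_def)
    finally show ?thesis by (simp add: c_def mult_ac)
  qed
  have c0: "c \<ge> 0" by (auto simp: c_def D_def)
  have "prob B \<le> (\<Sum>V\<in>Vs. prob (\<Union>F\<in>Fs V. heavy \<alpha> T F))"
    unfolding B_def using finVs finFs ev
    by (intro finite_measure_subadditive_finite) (auto intro!: sets.finite_UN)
  also have "\<dots> \<le> (\<Sum>V\<in>Vs. \<Sum>F\<in>Fs V. prob (heavy \<alpha> T F))"
    using finFs ev by (intro sum_mono finite_measure_subadditive_finite) auto
  also have "\<dots> \<le> (\<Sum>V\<in>Vs. \<Sum>F\<in>Fs V. (1 / real n) ^ card V * c)"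
    using pr by (intro sum_mono)
  also have "\<dots> \<le> (\<Sum>V\<in>Vs. 2 ^ k * ((1 / real n) ^ card V * c))"
  proof (rule sum_mono)
    fix V assume "V \<in> Vs"
    then have "real (card (Fs V)) \<le> real (2 ^ k)" using cardFs by (simp only: of_nat_le_iff)
    then have "real (card (Fs V)) \<le> 2 ^ k" by simp
    then show "(\<Sum>F\<in>Fs V. (1 / real n) ^ card V * c) \<le> 2 ^ k * ((1 / real n) ^ card V * c)"
      using c0 by (simp add: mult_right_mono)
  qed
  also have "\<dots> = 2 ^ k * c * (\<Sum>V\<in>Vs. (1 / real n) ^ card V)"
    by (simp add: sum_distrib_left mult_ac)
  also have "\<dots> \<le> 2 ^ k * c * (real K + 1)"
    unfolding Vs_def using c0 by (intro mult_left_mono sum_subsets_card_le n0) auto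
  finally have prB: "prob B \<le> 2 ^ 2 ^ K * max 1 (2 * real d * m) ^ 2 ^ K * (real K + 1) * real n ^ (1 - q) * exp (- s * T)"
    by (simp add: c_def k_def D_def mult_ac)
  have good: "(\<Sum>e\<in>F. \<bar>wt e \<omega>\<bar> powr \<alpha>) \<le> T"
    if \<omega>: "\<omega> \<in> space M - B" and F: "F \<subseteq> G \<omega>" "V \<subseteq> {..<n}" "\<Union>F \<subseteq> V" "card V \<le> K" "card V + q \<le> card F + 1" for \<omega> V F
  proof (rule ccontr)
    assume "\<not> ?thesis"
    then have "\<omega> \<in> heavy \<alpha> T F" using \<omega> F by (auto simp: heavy_def)
    moreover have "V \<in> Vs" using F by (auto simp: Vs_def)
    moreover have "F \<in> Fs V"
      using F regular_graphsD(1)[OF G_regular[of \<omega>]] \<omega> by (auto simp: Fs_def)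
    ultimately show False using \<omega> by (auto simp: B_def)
  qed
  show ?thesis
    by (intro bexI[OF _ B] conjI ballI allI impI prB) (rule good)
qed

section \<open>Bounds for the largest eigenvalue\<close>

text \<open>The hypotheses on T1 and T2 have the shape of the conclusion of
  \<open>dense_heavy_subgraphs\<close> for q = 0 and q = 1.\<close>

lemma largest_eigenvalue_upper:
  fixes \<tau> T1 T2 :: real
  assumes n: "n > 0" and d: "d \<ge> 2" and \<alpha>: "\<alpha> > 0" and \<omega>: "\<omega> \<in> space M" and \<tau>: "\<tau> \<ge> 0" and K: "K \<ge> 1"
    and T1: "\<And>V F. F \<subseteq> G \<omega> \<Longrightarrow> V \<subseteq> {..<n} \<Longrightarrow> \<Union>F \<subseteq> V \<Longrightarrow> card V \<le> K \<Longrightarrow>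
      card V + 0 \<le> card F + 1 \<Longrightarrow> (\<Sum>e\<in>F. \<bar>wt e \<omega>\<bar> powr \<alpha>) \<le> T1"
    and T2: "\<And>V F. F \<subseteq> G \<omega> \<Longrightarrow> V \<subseteq> {..<n} \<Longrightarrow> \<Union>F \<subseteq> V \<Longrightarrow> card V \<le> K \<Longrightarrow>
      card V + 1 \<le> card F + 1 \<Longrightarrow> (\<Sum>e\<in>F. \<bar>wt e \<omega>\<bar> powr \<alpha>) \<le> T2"
    and KT: "T1 < real (K - 1) * \<tau> powr \<alpha>"
  shows "top_eigenvalue n G W \<omega>
    \<le> d * \<tau> + limit_const d \<alpha> * T1 powr (1 / \<alpha>) + d * T2 powr (1 / \<alpha>)"
proof -
  note E = G_regular[OF \<omega>]
  obtain u where u: "(\<Sum>i<n. (u i)\<^sup>2) = 1"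
    "2 * (\<Sum>e\<in>G \<omega>. wt e \<omega> * prod u e) = top_eigenvalue n G W \<omega>"
    using largest_eigenvalue_weighted(2)[OF \<omega> n] by blast
  have "2 * (\<Sum>e\<in>G \<omega>. wt e \<omega> * prod u e) \<le> 2 * (\<Sum>e\<in>G \<omega>. \<bar>wt e \<omega>\<bar> * \<bar>prod u e\<bar>)"
    by (intro mult_left_mono sum_mono) (auto simp flip: abs_mult)
  also have "\<dots> \<le> (d * \<tau> + limit_const d \<alpha> * T1 powr (1 / \<alpha>) + d * T2 powr (1 / \<alpha>)) * (\<Sum>i<n. (u i)\<^sup>2)"
  proof (rule quadratic_form_upper[OF d \<alpha> \<tau> K])
    show "finite (G \<omega>)" by (rule regular_graphsD(2)[OF E])
    show "card e = 2" if "e \<in> G \<omega>" for e using regular_graphsD(1)[OF E] that by blast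
    show "\<Union>(G \<omega>) \<subseteq> {..<n}" using regular_graphsD(1)[OF E] by blast
    show "card {e \<in> G \<omega>. x \<in> e} \<le> d" for x
    proof (cases "x < n")
      case False
      then have "{e \<in> G \<omega>. x \<in> e} = {}" using regular_graphsD(1)[OF E] by blast
      then show ?thesis by (simp only: card.empty)
    qed (use regular_graphsD(3)[OF E] in simp)
  qed (use T1 T2 KT in auto)
  finally show ?thesis using u by simp
qed


text \<open>The test vector vanishes off N, so edges leaving N contribute nothing, whatever the sign
  of their weights. Its norm may be below 1, which does no harm once the eigenvalue is known to be
  positive.\<close>

lemma largest_eigenvalue_gt_witness:
  assumes \<omega>: "\<omega> \<in> space M" and n: "n > 0" and c: "0 \<le> c" and l: "0 < l"
    and wit: "local_witness n \<alpha> c (G \<omega>) N t v"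
    and ge: "\<And>e. e \<in> G \<omega> \<Longrightarrow> e \<subseteq> N \<Longrightarrow> l * t e \<le> wt e \<omega>"
  shows "l * c < top_eigenvalue n G W \<omega>"
proof -
  define E where "E = G \<omega>"
  define S where "S = {e \<in> E. e \<subseteq> N}"
  define lam where "lam = top_eigenvalue n G W \<omega>"
  define V where "V = (\<Sum>i<n. (v i)\<^sup>2)"
  note reg = regular_graphsD[OF G_regular[OF \<omega>], folded E_def]
  have v: "0 \<le> v i" "i \<notin> N \<Longrightarrow> v i = 0" for i using wit by (auto simp: local_witness_def)
  have V: "0 \<le> V" "V \<le> 1" and cw: "c < 2 * (\<Sum>e\<in>S. t e * prod v e)"
    using wit by (auto simp: local_witness_def V_def S_def E_def sum_nonneg)
  have "l * c < l * (2 * (\<Sum>e\<in>S. t e * prod v e))" using cw l by simp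
  also have "\<dots> = 2 * (\<Sum>e\<in>S. (l * t e) * prod v e)" by (simp add: sum_distrib_left mult_ac)
  also have "\<dots> \<le> 2 * (\<Sum>e\<in>S. wt e \<omega> * prod v e)"
    using ge v by (intro mult_left_mono sum_mono mult_right_mono prod_nonneg) (auto simp: S_def E_def)
  also have "(\<Sum>e\<in>S. wt e \<omega> * prod v e) = (\<Sum>e\<in>E. wt e \<omega> * prod v e)"
  proof (rule sum.mono_neutral_left)
    show "\<forall>e\<in>E - S. wt e \<omega> * prod v e = 0"
    proof
      fix e assume e: "e \<in> E - S"
      then obtain i where i: "i \<in> e" "v i = 0" using v(2) by (auto simp: S_def)
      have "card e = 2" using e reg(1) by auto
      then have "finite e" by (intro card_ge_0_finite) simp
      then have "prod v e = 0" using i by (intro prod_zero) auto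
      then show "wt e \<omega> * prod v e = 0" by simp
    qed
  qed (use reg in \<open>auto simp: S_def\<close>)
  also have "2 * (\<Sum>e\<in>E. wt e \<omega> * prod v e) \<le> lam * V"
    unfolding E_def lam_def V_def by (rule largest_eigenvalue_weighted(1)[OF \<omega> n])
  finally have lt: "l * c < lam * V" .
  have "0 \<le> l * c" using l c by simp
  with lt have "lam > 0" using V(1) by (smt (verit) mult_nonneg_nonneg mult_minus_left)
  then have "lam * V \<le> lam" using V by (simp add: mult_left_le)
  then show ?thesis using lt unfolding lam_def by linarith
qed

text \<open>The maximum with 1 makes the tail bound applicable even where t e is 0. Since (max 1
  y)^\<alpha> \<le> 1 + y^\<alpha>, it costs only a constant factor per edge, and the remaining
  exponents add up to at most l^\<alpha>.\<close>

lemma prob_wt_ge_all: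
  assumes S: "S \<subseteq> vertex_pairs n" and \<alpha>: "\<alpha> > 0" and l: "l \<ge> 0"
    and C1: "C1 > 0" "\<And>t. t \<ge> 1 \<Longrightarrow> C1 / 2 * exp (- (t powr \<alpha>)) \<le> measure \<mu> {t..}"
    and t: "\<And>e. 0 \<le> t e" "(\<Sum>e\<in>S. t e powr \<alpha>) \<le> 1"
  shows "min 1 (C1 / 2 * exp (- 1)) ^ card S * exp (- (l powr \<alpha>))
    \<le> prob {\<omega> \<in> space M. \<forall>e\<in>S. max 1 (l * t e) \<le> wt e \<omega>}"
proof -
  define c0 where "c0 = min 1 (C1 / 2 * exp (- 1))"
  have c0: "c0 \<ge> 0" using C1(1) by (simp add: c0_def)
  have finS: "finite S" using S finite_vertex_pairs finite_subset by blast
  have one: "c0 * exp (- (l powr \<alpha> * t e powr \<alpha>)) \<le> prob {\<omega> \<in> space M. max 1 (l * t e) \<le> wt e \<omega>}"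
    if e: "e \<in> S" for e
  proof -
    define y where "y = l * t e"
    have y: "y \<ge> 0" using l t by (simp add: y_def)
    have "(max 1 y) powr \<alpha> \<le> 1 + y powr \<alpha>"
      using \<alpha> by (auto simp: max_def)
    then have "C1 / 2 * (exp (- 1) * exp (- (y powr \<alpha>))) \<le> C1 / 2 * exp (- ((max 1 y) powr \<alpha>))"
      using C1(1) by (intro mult_left_mono) (auto simp: mult_exp_exp)
    also have "\<dots> \<le> measure \<mu> {max 1 y..}" by (rule C1(2)) simp
    also have "\<dots> = measure (distr M borel (wt e)) {max 1 y..}" using distr_wt S e by auto
    also have "\<dots> = prob (wt e -` {max 1 y..} \<inter> space M)"
      using S e by (intro measure_distr wt_measurable) auto
    also have "wt e -` {max 1 y..} \<inter> space M = {\<omega> \<in> space M. max 1 y \<le> wt e \<omega>}" by auto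
    finally have "(C1 / 2 * exp (- 1)) * exp (- (y powr \<alpha>)) \<le> prob {\<omega> \<in> space M. max 1 y \<le> wt e \<omega>}"
      by (simp only: mult.assoc)
    from order_trans[OF _ this, of "c0 * exp (- (y powr \<alpha>))"]
    have "c0 * exp (- (y powr \<alpha>)) \<le> prob {\<omega> \<in> space M. max 1 y \<le> wt e \<omega>}"
      by (simp add: c0_def mult_right_mono)
    moreover have "y powr \<alpha> = l powr \<alpha> * t e powr \<alpha>" using l t(1) by (simp add: y_def powr_mult)
    ultimately show ?thesis by (simp only: y_def)
  qed
  have "c0 ^ card S * exp (- (l powr \<alpha>)) \<le> c0 ^ card S * exp (- (l powr \<alpha> * (\<Sum>e\<in>S. t e powr \<alpha>)))"
    using t c0 by (intro mult_left_mono) (auto simp: mult_left_le)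
  also have "\<dots> = (\<Prod>e\<in>S. c0 * exp (- (l powr \<alpha> * t e powr \<alpha>)))"
    using finS by (simp add: prod.distrib exp_sum[symmetric] sum_distrib_left sum_negf)
  also have "\<dots> \<le> (\<Prod>e\<in>S. prob {\<omega> \<in> space M. max 1 (l * t e) \<le> wt e \<omega>})"
    using one c0 by (intro prod_mono) auto
  also have "\<dots> = prob {\<omega> \<in> space M. \<forall>e\<in>S. max 1 (l * t e) \<le> wt e \<omega>}"
  proof (cases "S = {}")
    case False
    have "prob (\<Inter>e\<in>S. wt e -` {max 1 (l * t e)..} \<inter> space M) = (\<Prod>e\<in>S. prob (wt e -` {max 1 (l * t e)..} \<inter> space M))"
      by (rule indep_varsD[OF indep_wt False finS S]) simp
    moreover have "(\<Inter>e\<in>S. wt e -` {max 1 (l * t e)..} \<inter> space M) = {\<omega> \<in> space M. \<forall>e\<in>S. max 1 (l * t e) \<le> wt e \<omega>}"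
      using False by auto
    moreover have "wt e -` {max 1 (l * t e)..} \<inter> space M = {\<omega> \<in> space M. max 1 (l * t e) \<le> wt e \<omega>}" for e
      by auto
    ultimately show ?thesis by simp
  qed (simp add: prob_space)
  finally show ?thesis by (simp add: c0_def)
qed

text \<open>Each block succeeds independently with probability at least q, and (1 - q)^N \<le> exp
  (- q N). The base is capped at 1, so replacing the number of edges by the bound k only lowers the
  success probability.\<close>

lemma prob_no_disjoint_block:
  assumes \<alpha>: "\<alpha> > 0" and l: "l \<ge> 0"
    and C1: "C1 > 0" "\<And>t. t \<ge> 1 \<Longrightarrow> C1 / 2 * exp (- (t powr \<alpha>)) \<le> measure \<mu> {t..}"
    and C: "finite C" and S: "\<And>x. x \<in> C \<Longrightarrow> S x \<subseteq> vertex_pairs n" "disjoint_family_on S C"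
    and k: "\<And>x. x \<in> C \<Longrightarrow> card (S x) \<le> k"
    and t: "\<And>x e. x \<in> C \<Longrightarrow> 0 \<le> t x e" "\<And>x. x \<in> C \<Longrightarrow> (\<Sum>e\<in>S x. t x e powr \<alpha>) \<le> 1"
  shows "prob {\<omega> \<in> space M. \<forall>x\<in>C. \<not> (\<forall>e\<in>S x. max 1 (l * t x e) \<le> wt e \<omega>)}
    \<le> exp (- (min 1 (C1 / 2 * exp (- 1)) ^ k * exp (- (l powr \<alpha>)) * card C))"
proof -
  define q where "q = min 1 (C1 / 2 * exp (- 1)) ^ k * exp (- (l powr \<alpha>))"
  define A where "A x = {y \<in> space (PiM (S x) (\<lambda>_. borel)). \<not> (\<forall>e\<in>S x. max 1 (l * t x e) \<le> y e)}" for x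
  have A: "A x \<in> sets (PiM (S x) (\<lambda>_. borel))" if x: "x \<in> C" for x
  proof -
    have "finite (S x)" using S(1)[OF x] finite_vertex_pairs finite_subset by blast
    moreover have [measurable]: "(\<lambda>y. y e) \<in> borel_measurable (PiM (S x) (\<lambda>_. borel))" if "e \<in> S x" for e
      using that by (rule measurable_component_singleton)
    ultimately show ?thesis unfolding A_def by measurable
  qed
  have inA: "(\<lambda>e\<in>S x. wt e \<omega>) \<in> A x \<longleftrightarrow> \<not> (\<forall>e\<in>S x. max 1 (l * t x e) \<le> wt e \<omega>)" for x \<omega>
    by (auto simp: A_def space_PiM)
  have c0: "0 \<le> min 1 (C1 / 2 * exp (- 1))" "min 1 (C1 / 2 * exp (- 1)) \<le> 1" using C1(1) by auto
  have q1: "q \<le> 1" unfolding q_def using c0 by (intro mult_le_one power_le_one) auto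
  have one: "prob {\<omega> \<in> space M. (\<lambda>e\<in>S x. wt e \<omega>) \<in> A x} \<le> 1 - q" if x: "x \<in> C" for x
  proof -
    define Z where "Z = {\<omega> \<in> space M. \<forall>e\<in>S x. max 1 (l * t x e) \<le> wt e \<omega>}"
    have "q \<le> min 1 (C1 / 2 * exp (- 1)) ^ card (S x) * exp (- (l powr \<alpha>))"
      unfolding q_def using c0 k[OF x] by (intro mult_right_mono power_decreasing) auto
    also have "\<dots> \<le> prob Z"
      unfolding Z_def by (rule prob_wt_ge_all[OF S(1)[OF x] \<alpha> l C1 t(1)[OF x] t(2)[OF x]])
    finally have qZ: "q \<le> prob Z" .
    have Z: "Z \<in> events"
    proof -
      have fin: "finite (S x)" using S(1)[OF x] finite_vertex_pairs finite_subset by blast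
      have [measurable]: "wt e \<in> borel_measurable M" if "e \<in> S x" for e using S(1)[OF x] that by auto
      show ?thesis unfolding Z_def using fin by measurable
    qed
    have "{\<omega> \<in> space M. (\<lambda>e\<in>S x. wt e \<omega>) \<in> A x} = space M - Z"
      unfolding inA Z_def by auto
    then show ?thesis using prob_compl[OF Z] qZ by simp
  qed
  have "prob {\<omega> \<in> space M. \<forall>x\<in>C. \<not> (\<forall>e\<in>S x. max 1 (l * t x e) \<le> wt e \<omega>)} =
      (\<Prod>x\<in>C. prob {\<omega> \<in> space M. (\<lambda>e\<in>S x. wt e \<omega>) \<in> A x})"
    using indep_blocks[OF S A C] unfolding inA by simp
  also have "\<dots> \<le> (\<Prod>x\<in>C. 1 - q)" using one by (intro prod_mono) auto
  also have "\<dots> = (1 - q) ^ card C" by simp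
  also have "\<dots> \<le> exp (- q) ^ card C"
    using q1 exp_ge_add_one_self[of "- q"] by (intro power_mono) auto
  also have "\<dots> = exp (- (q * card C))" by (simp add: exp_of_nat_mult[symmetric] mult.commute)
  finally show ?thesis by (simp add: q_def)
qed

text \<open>Witnesses and centres are chosen for every regular graph beforehand. The exceptional
  event is split according to the value of G, and on each piece independence leaves a statement
  about weights alone. In the rate, 2^((d + 1)^r) bounds the number of edges in a ball and (d +
  1)^(2 r) comes from \<open>disjoint_gballs\<close>.\<close>

lemma largest_eigenvalue_lower:
  assumes n: "n > 0" and \<alpha>: "\<alpha> > 0" and c: "0 \<le> c" and l: "0 < l"
    and C1: "C1 > 0" "\<And>t. t \<ge> 1 \<Longrightarrow> C1 / 2 * exp (- (t powr \<alpha>)) \<le> measure \<mu> {t..}"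
    and wit: "\<forall>E\<in>regular_graphs d n. \<forall>x<n. \<exists>t v. local_witness n \<alpha> c E (gball E r x) t v"
  shows "\<exists>B\<in>events. prob B \<le>
      exp (- (min 1 (C1 / 2 * exp (- 1)) ^ 2 ^ (d + 1) ^ r / real ((d + 1) ^ (2 * r)) * (real n * exp (- (l powr \<alpha>))))) \<and>
    (\<forall>\<omega>\<in>space M - B. l * c < top_eigenvalue n G W \<omega>)"
proof -
  define R where "R = regular_graphs d n"
  define k :: nat where "k = 2 ^ (d + 1) ^ r"
  define D where "D = real ((d + 1) ^ (2 * r))"
  define c0 where "c0 = min 1 (C1 / 2 * exp (- 1))"
  define \<delta> where "\<delta> = exp (- (c0 ^ k / D * (real n * exp (- (l powr \<alpha>)))))"
  have "\<forall>E. \<forall>x. \<exists>p. E \<in> R \<longrightarrow> x < n \<longrightarrow> local_witness n \<alpha> c E (gball E r x) (fst p) (snd p)"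
    using wit unfolding R_def by auto
  then obtain p where p: "\<And>E x. E \<in> R \<Longrightarrow> x < n \<Longrightarrow> local_witness n \<alpha> c E (gball E r x) (fst (p E x)) (snd (p E x))"
    by metis
  define t where "t E x = fst (p E x)" for E x
  have "\<forall>E. \<exists>C. E \<in> R \<longrightarrow> C \<subseteq> {..<n} \<and> disjoint_family_on (gball E r) C \<and> n \<le> (d + 1) ^ (2 * r) * card C"
    using disjoint_gballs unfolding R_def by blast
  then obtain C where C: "\<And>E. E \<in> R \<Longrightarrow> C E \<subseteq> {..<n}" "\<And>E. E \<in> R \<Longrightarrow> disjoint_family_on (gball E r) (C E)"
    "\<And>E. E \<in> R \<Longrightarrow> n \<le> (d + 1) ^ (2 * r) * card (C E)"
    by metis
  define S where "S E x = {e \<in> E. e \<subseteq> gball E r x}" for E :: "nat set set" and x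
  define Q where "Q E y \<longleftrightarrow> (\<forall>x\<in>C E. \<not> (\<forall>e\<in>S E x. max 1 (l * t E x e) \<le> y e))" for E y
  define Bad where "Bad E = {\<omega> \<in> space M. G \<omega> \<in> {E} \<and> Q E (\<lambda>e\<in>vertex_pairs n. wt e \<omega>)}" for E
  have finR: "finite R" unfolding R_def by (rule finite_regular_graphs)
  have SV: "S E x \<subseteq> vertex_pairs n" if "E \<in> R" for E x
    using regular_graphsD(1) that unfolding S_def R_def by blast
  have Qeq: "Q E (\<lambda>e\<in>vertex_pairs n. wt e \<omega>) \<longleftrightarrow> (\<forall>x\<in>C E. \<not> (\<forall>e\<in>S E x. max 1 (l * t E x e) \<le> wt e \<omega>))"
    if "E \<in> R" for E \<omega>
  proof -
    have "(\<forall>e\<in>S E x. max 1 (l * t E x e) \<le> (\<lambda>e\<in>vertex_pairs n. wt e \<omega>) e) \<longleftrightarrow>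
        (\<forall>e\<in>S E x. max 1 (l * t E x e) \<le> wt e \<omega>)" for x
      using SV[OF that, of x] by (intro ball_cong refl) auto
    then show ?thesis unfolding Q_def by simp
  qed
  have Qm: "{y \<in> space (PiM (vertex_pairs n) (\<lambda>_. borel)). Q E y} \<in> sets (PiM (vertex_pairs n) (\<lambda>_. borel))"
    if E: "E \<in> R" for E
  proof -
    have fin: "finite (C E)" "finite (S E x)" for x
      by (rule finite_subset[OF C(1)[OF E] finite_lessThan],
        rule finite_subset[OF SV[OF E] finite_vertex_pairs])
    have [measurable]: "(\<lambda>y. y e) \<in> borel_measurable (PiM (vertex_pairs n) (\<lambda>_. borel))" if "e \<in> S E x" for e x
      using SV[OF E] that by (intro measurable_component_singleton) auto
    show ?thesis unfolding Q_def using fin by measurable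
  qed
  have BadE: "Bad E \<in> events" if E: "E \<in> R" for E
  proof -
    have 1: "G -` {E} \<inter> space M \<in> events"
      using G_measurable by (rule measurable_sets) (use E in \<open>auto simp: R_def\<close>)
    have "(\<lambda>\<omega>. \<lambda>e\<in>vertex_pairs n. wt e \<omega>) \<in> M \<rightarrow>\<^sub>M PiM (vertex_pairs n) (\<lambda>_. borel)"
      by (intro measurable_restrict wt_measurable)
    from measurable_sets[OF this Qm[OF E]]
    have 2: "(\<lambda>\<omega>. \<lambda>e\<in>vertex_pairs n. wt e \<omega>) -` {y \<in> space (PiM (vertex_pairs n) (\<lambda>_. borel)). Q E y} \<inter> space M \<in> events" .
    have "Bad E = (G -` {E} \<inter> space M) \<inter>
        ((\<lambda>\<omega>. \<lambda>e\<in>vertex_pairs n. wt e \<omega>) -` {y \<in> space (PiM (vertex_pairs n) (\<lambda>_. borel)). Q E y} \<inter> space M)"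
      by (auto simp: Bad_def space_PiM)
    then show ?thesis using sets.Int[OF 1 2] by simp
  qed
  have prBad: "prob (Bad E) \<le> prob {\<omega> \<in> space M. G \<omega> \<in> {E}} * \<delta>" if E: "E \<in> R" for E
  proof -
    have "prob (Bad E) = prob {\<omega> \<in> space M. G \<omega> \<in> {E}} * prob {\<omega> \<in> space M. Q E (\<lambda>e\<in>vertex_pairs n. wt e \<omega>)}"
      unfolding Bad_def using E Qm[OF E] by (intro prob_graph_and_weights) (auto simp: R_def)
    moreover have "prob {\<omega> \<in> space M. Q E (\<lambda>e\<in>vertex_pairs n. wt e \<omega>)} \<le> exp (- (c0 ^ k * exp (- (l powr \<alpha>)) * card (C E)))"
      unfolding Qeq[OF E] c0_def
    proof (rule prob_no_disjoint_block[OF \<alpha> less_imp_le[OF l] C1])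
      show "finite (C E)" by (rule finite_subset[OF C(1)[OF E] finite_lessThan])
      show "S E x \<subseteq> vertex_pairs n" for x by (rule SV[OF E])
      show "disjoint_family_on (S E) (C E)"
        unfolding disjoint_family_on_def
      proof (intro ballI impI)
        fix x y assume xy: "x \<in> C E" "y \<in> C E" "x \<noteq> y"
        then have "gball E r x \<inter> gball E r y = {}" using C(2)[OF E] by (simp add: disjoint_family_on_def)
        moreover have "e \<noteq> {}" if "e \<in> S E x" for e using SV[OF E] that by force
        ultimately show "S E x \<inter> S E y = {}" unfolding S_def by blast
      qed
      fix x assume x: "x \<in> C E"
      then have xn: "x < n" using C(1)[OF E] by auto
      have E': "E \<in> regular_graphs d n" using E by (simp add: R_def)
      have fin: "finite (gball E r x)" using gball_regular(1)[OF E' xn] finite_subset by blast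
      have "card (S E x) \<le> card (Pow (gball E r x))" using fin by (intro card_mono) (auto simp: S_def)
      also have "\<dots> \<le> k" unfolding k_def card_Pow[OF fin]
        by (intro power_increasing gball_regular(2)[OF E' xn]) auto
      finally show "card (S E x) \<le> k" .
      show "0 \<le> t E x e" for e using p[OF E xn] by (simp add: local_witness_def t_def)
      show "(\<Sum>e\<in>S E x. t E x e powr \<alpha>) \<le> 1" using p[OF E xn] by (simp add: local_witness_def t_def S_def)
    qed
    moreover have "exp (- (c0 ^ k * exp (- (l powr \<alpha>)) * card (C E))) \<le> \<delta>"
    proof -
      have D: "D > 0" by (simp add: D_def)
      have "real n \<le> D * real (card (C E))"
        using C(3)[OF E] unfolding D_def of_nat_mult[symmetric] of_nat_le_iff .
      then have "real n / D \<le> real (card (C E))" using D by (simp add: divide_le_eq mult.commute)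
      then have "c0 ^ k * exp (- (l powr \<alpha>)) * (real n / D) \<le> c0 ^ k * exp (- (l powr \<alpha>)) * real (card (C E))"
        using C1(1) by (intro mult_left_mono) (auto simp: c0_def)
      then show ?thesis by (simp add: \<delta>_def mult_ac)
    qed
    ultimately show ?thesis
      using mult_left_mono[OF order_trans measure_nonneg] by simp
  qed
  define B where "B = (\<Union>E\<in>R. Bad E)"
  have B: "B \<in> events" unfolding B_def using finR BadE by (rule sets.finite_UN)
  have "prob B \<le> (\<Sum>E\<in>R. prob (Bad E))"
    unfolding B_def using finR BadE by (intro finite_measure_subadditive_finite) auto
  also have "\<dots> \<le> (\<Sum>E\<in>R. prob {\<omega> \<in> space M. G \<omega> \<in> {E}} * \<delta>)" by (intro sum_mono prBad)
  also have "\<dots> = (\<Sum>E\<in>R. 1 / real (card R) * \<delta>)"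
    unfolding R_def by (intro sum.cong refl arg_cong2[of _ _ _ _ "(*)"]) (subst prob_G_in; auto)
  also have "\<dots> = \<delta>"
    using regular_graphs_nonempty finR by (simp add: R_def)
  finally have prB: "prob B \<le> \<delta>" .
  have good: "l * c < top_eigenvalue n G W \<omega>"
    if \<omega>: "\<omega> \<in> space M - B" for \<omega>
  proof -
    define E where "E = G \<omega>"
    have E: "E \<in> R" using G_regular \<omega> by (auto simp: R_def E_def)
    have "\<omega> \<notin> Bad E" using \<omega> E by (auto simp: B_def)
    then have "\<not> Q E (\<lambda>e\<in>vertex_pairs n. wt e \<omega>)" using \<omega> by (auto simp: Bad_def E_def)
    then obtain x where x: "x \<in> C E" "\<forall>e\<in>S E x. max 1 (l * t E x e) \<le> wt e \<omega>"
      unfolding Qeq[OF E] by blast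
    then have xn: "x < n" using C(1)[OF E] by auto
    show ?thesis
    proof (rule largest_eigenvalue_gt_witness[OF _ n c l])
      show "\<omega> \<in> space M" using \<omega> by simp
      show "local_witness n \<alpha> c (G \<omega>) (gball E r x) (t E x) (snd (p E x))"
        using p[OF E xn] by (simp add: t_def E_def)
      show "l * t E x e \<le> wt e \<omega>" if "e \<in> G \<omega>" "e \<subseteq> gball E r x" for e
        using x(2) that by (auto simp: S_def E_def)
    qed
  qed
  show ?thesis
    using prB unfolding \<delta>_def c0_def k_def D_def by (intro bexI[OF _ B] conjI ballI good)
qed

end

section \<open>Convergence in probability\<close>

text \<open>A single \<eta> sets the cutoff for light edges, the excess allowed to trees and the
  budget of components with a cycle; these are the three summands, with D the degree.\<close>

lemma upper_parameters:
  fixes H \<epsilon> \<alpha> D :: real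
  assumes "\<alpha> > 0" "\<epsilon> > 0"
  shows "\<exists>\<eta>>0. \<eta> < 1 \<and> D * \<eta> + H * (1 + \<eta>) powr (1 / \<alpha>) + D * \<eta> powr (1 / \<alpha>) \<le> H + \<epsilon>"
proof -
  have a: "1 / \<alpha> > 0" using assms by simp
  have "((\<lambda>\<eta>. D * \<eta> + H * (1 + \<eta>) powr (1 / \<alpha>) + D * \<eta> powr (1 / \<alpha>)) \<longlongrightarrow> D * 0 + H * (1 + 0) powr (1 / \<alpha>) + D * 0) (at_right 0)"
  proof (intro tendsto_intros)
    show "((\<lambda>\<eta>. \<eta> powr (1 / \<alpha>)) \<longlongrightarrow> 0) (at_right 0)"
      using a by real_asymp
  qed auto
  then have "\<forall>\<^sub>F \<eta> in at_right 0. D * \<eta> + H * (1 + \<eta>) powr (1 / \<alpha>) + D * \<eta> powr (1 / \<alpha>) < H + \<epsilon>"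
    using assms(2) by (intro order_tendstoD(2)) auto
  moreover have "\<forall>\<^sub>F \<eta> in at_right (0::real). \<eta> < 1 \<and> 0 < \<eta>"
    using eventually_at_right_less[of "0::real"] by (auto simp: eventually_conj_iff eventually_at_right_field intro: exI[of _ 1])
  ultimately have "\<forall>\<^sub>F \<eta> in at_right 0. \<eta> < 1 \<and> 0 < \<eta> \<and>
      D * \<eta> + H * (1 + \<eta>) powr (1 / \<alpha>) + D * \<eta> powr (1 / \<alpha>) < H + \<epsilon>"
    by eventually_elim auto
  then obtain \<eta> where "\<eta> < 1 \<and> 0 < \<eta> \<and> D * \<eta> + H * (1 + \<eta>) powr (1 / \<alpha>) + D * \<eta> powr (1 / \<alpha>) < H + \<epsilon>"
    using eventually_happens[of _ "at_right (0::real)"] by auto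
  then show ?thesis by (intro exI[of _ \<eta>]) auto
qed

text \<open>The value c lies below the optimal constant so that local witnesses exist, and 1 -
  \<eta> is the fraction of log n spent on the weights of one ball. The maximum with 0 handles large
  \<epsilon>.\<close>

lemma lower_parameters:
  fixes H \<epsilon> \<alpha> :: real
  assumes "\<alpha> > 0" "\<epsilon> > 0" "H > 0"
  shows "\<exists>c \<eta>. 0 \<le> c \<and> c < H \<and> 0 < \<eta> \<and> \<eta> < 1 \<and> H - \<epsilon> \<le> (1 - \<eta>) powr (1 / \<alpha>) * c"
proof -
  define c where "c = max 0 (H - \<epsilon> / 2)"
  have "((\<lambda>\<eta>. (1 - \<eta>) powr (1 / \<alpha>) * c) \<longlongrightarrow> (1 - 0) powr (1 / \<alpha>) * c) (at_right 0)"
    by (intro tendsto_intros) auto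
  then have "\<forall>\<^sub>F \<eta> in at_right 0. H - \<epsilon> < (1 - \<eta>) powr (1 / \<alpha>) * c"
    using assms by (intro order_tendstoD(1)) (auto simp: c_def max_def)
  moreover have "\<forall>\<^sub>F \<eta> in at_right (0::real). \<eta> < 1 \<and> 0 < \<eta>"
    using eventually_at_right_less[of "0::real"] by (auto simp: eventually_conj_iff eventually_at_right_field intro: exI[of _ 1])
  ultimately have "\<forall>\<^sub>F \<eta> in at_right 0. \<eta> < 1 \<and> 0 < \<eta> \<and> H - \<epsilon> < (1 - \<eta>) powr (1 / \<alpha>) * c"
    by eventually_elim auto
  then obtain \<eta> where "\<eta> < 1 \<and> 0 < \<eta> \<and> H - \<epsilon> < (1 - \<eta>) powr (1 / \<alpha>) * c"
    using eventually_happens[of _ "at_right (0::real)"] by auto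
  then show ?thesis using assms by (intro exI[of _ c] exI[of _ \<eta>]) (auto simp: c_def)
qed

text \<open>The rate \<open>f\<close> and the threshold \<open>N\<close> are chosen before the
  probability space, as the spaces in the final statement vary with n.\<close>

lemma upper_tail:
  assumes d: "d \<ge> 2" and \<alpha>: "\<alpha> > 0" and law: "weibull_law \<alpha> \<mu>" and \<epsilon>: "\<epsilon> > 0"
  shows "\<exists>f N. f \<longlonglongrightarrow> 0 \<and> (\<forall>n\<ge>N. \<forall>(M :: 'a measure) G W. weighted_random_regular_graph M d n G W \<mu> \<longrightarrow>
    (\<exists>B\<in>sets M. measure M B \<le> f n \<and> (\<forall>\<omega>\<in>space M - B.
      top_eigenvalue n G W \<omega>
        \<le> (limit_const d \<alpha> + \<epsilon>) * ln (real n) powr (1 / \<alpha>))))"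
proof -
  define H where "H = limit_const d \<alpha>"
  obtain \<eta> :: real where \<eta>: "\<eta> > 0" "\<eta> < 1" and \<eta>H: "d * \<eta> + H * (1 + \<eta>) powr (1 / \<alpha>) + d * \<eta> powr (1 / \<alpha>) \<le> H + \<epsilon>"
    using upper_parameters[OF \<alpha> \<epsilon>, of "real d" H] by (elim exE conjE)
  \<comment> \<open>K - 1 edges of weight above \<eta> (log n)^(1/\<alpha>) together exceed the
    budget (1 + \<eta>) log n.\<close>
  define K where "K = nat \<lceil>(1 + \<eta>) / \<eta> powr \<alpha>\<rceil> + 2"
  have K: "K \<ge> 1" "1 + \<eta> < real (K - 1) * \<eta> powr \<alpha>"
  proof -
    have "0 < \<eta> powr \<alpha>" using \<eta> by simp
    moreover have "(1 + \<eta>) / \<eta> powr \<alpha> < real (K - 1)" unfolding K_def by linarith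
    ultimately show "1 + \<eta> < real (K - 1) * \<eta> powr \<alpha>" by (simp only: pos_divide_less_eq)
  qed (simp add: K_def)
  \<comment> \<open>Strictly between 1 / (1 + \<eta>) and 1: below 1 for a finite exponential
    moment, and large enough that n times n^(- s (1 + \<eta>)) tends to 0.\<close>
  define s where "s = 1 / (1 + \<eta> / 2)"
  have s: "0 < s" "s < 1" "s * (1 + \<eta>) > 1" using \<eta> by (auto simp: s_def field_simps)
  define m where "m = enn2real (\<integral>\<^sup>+x. ennreal (exp (s * \<bar>x\<bar> powr \<alpha>)) \<partial>\<mu>)"
  have m: "(\<integral>\<^sup>+x. ennreal (exp (s * \<bar>x\<bar> powr \<alpha>)) \<partial>\<mu>) \<le> ennreal m" "m \<ge> 0"
    using weibull_exp_moment[OF law \<alpha> s(1,2)] by (simp_all add: m_def ennreal_enn2real)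
  define A where "A = 2 ^ 2 ^ K * max 1 (2 * real d * m) ^ 2 ^ K * (real K + 1)"
  \<comment> \<open>The two terms are the first moment bounds for q = 0 and q = 1.\<close>
  define f where "f n = A * (real n * exp (- s * ((1 + \<eta>) * ln (real n)))) + A * exp (- s * (\<eta> * ln (real n)))" for n :: nat
  have f: "f \<longlonglongrightarrow> 0"
  proof -
    define a where "a = s * (1 + \<eta>) - 1"
    define b where "b = s * \<eta>"
    have ab: "a > 0" "b > 0" using s \<eta> by (auto simp: a_def b_def)
    have "(\<lambda>n. A * real n powr (- a) + A * real n powr (- b)) \<longlonglongrightarrow> A * 0 + A * 0"
      using ab by (intro tendsto_intros tendsto_neg_powr filterlim_real_sequentially) simp_all
    moreover have "\<forall>\<^sub>F n in sequentially. A * real n powr (- a) + A * real n powr (- b) = f n"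
      using eventually_gt_at_top[of 0]
    proof eventually_elim
      case (elim n)
      have "real n powr (- a) = real n powr 1 * real n powr (- (s * (1 + \<eta>)))"
        unfolding powr_add[symmetric] by (simp add: a_def)
      then show ?case using elim by (simp add: f_def powr_def b_def mult_ac)
    qed
    ultimately show ?thesis by (simp add: tendsto_cong)
  qed
  have main: "\<exists>B\<in>sets M. measure M B \<le> f n \<and> (\<forall>\<omega>\<in>space M - B.
      top_eigenvalue n G W \<omega> \<le> (H + \<epsilon>) * ln (real n) powr (1 / \<alpha>))"
    if n: "n \<ge> 8 + 4 * d + 4 * 2 ^ K" and loc: "weighted_random_regular_graph M d n G W \<mu>"
    for n and M :: "'a measure" and G W
  proof -
    interpret weighted_random_regular_graph M d n G W \<mu> by (rule loc)
    define L where "L = ln (real n)"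
    have L: "L > 0" using n by (simp add: L_def)
    have d0: "d > 0" using d by simp
    obtain B1 where B1: "B1 \<in> events" "prob B1 \<le> A * real n ^ (1 - 0) * exp (- s * ((1 + \<eta>) * L))"
      and g1: "\<forall>\<omega>\<in>space M - B1. \<forall>V F. F \<subseteq> G \<omega> \<longrightarrow> V \<subseteq> {..<n} \<longrightarrow> \<Union>F \<subseteq> V \<longrightarrow> card V \<le> K \<longrightarrow>
        card V + 0 \<le> card F + 1 \<longrightarrow> (\<Sum>e\<in>F. \<bar>wt e \<omega>\<bar> powr \<alpha>) \<le> (1 + \<eta>) * L"
      using dense_heavy_subgraphs[OF n d0 \<alpha> s(1) m, of 0 "(1 + \<eta>) * L"] unfolding A_def by auto
    obtain B2 where B2: "B2 \<in> events" "prob B2 \<le> A * real n ^ (1 - 1) * exp (- s * (\<eta> * L))"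
      and g2: "\<forall>\<omega>\<in>space M - B2. \<forall>V F. F \<subseteq> G \<omega> \<longrightarrow> V \<subseteq> {..<n} \<longrightarrow> \<Union>F \<subseteq> V \<longrightarrow> card V \<le> K \<longrightarrow>
        card V + 1 \<le> card F + 1 \<longrightarrow> (\<Sum>e\<in>F. \<bar>wt e \<omega>\<bar> powr \<alpha>) \<le> \<eta> * L"
      using dense_heavy_subgraphs[OF n d0 \<alpha> s(1) m, of 1 "\<eta> * L"] unfolding A_def by auto
    show ?thesis
    proof (intro bexI conjI ballI)
      show "B1 \<union> B2 \<in> events" using B1 B2 by auto
      show "prob (B1 \<union> B2) \<le> f n"
        using measure_Un_le[OF B1(1) B2(1)] B1(2) B2(2) by (simp add: f_def L_def mult.assoc)
      fix \<omega> assume \<omega>: "\<omega> \<in> space M - (B1 \<union> B2)"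
      define R where "R = L powr (1 / \<alpha>)"
      have R: "R > 0" "R powr \<alpha> = L" using L \<alpha> by (auto simp: R_def powr_powr)
      have "top_eigenvalue n G W \<omega>
        \<le> d * (\<eta> * R) + limit_const d \<alpha> * ((1 + \<eta>) * L) powr (1 / \<alpha>) + d * (\<eta> * L) powr (1 / \<alpha>)"
      proof (rule largest_eigenvalue_upper[where K = K])
        show "(1 + \<eta>) * L < real (K - 1) * (\<eta> * R) powr \<alpha>"
        proof -
          have "(\<eta> * R) powr \<alpha> = \<eta> powr \<alpha> * L" using \<eta> R by (simp add: powr_mult)
          then show ?thesis
            using mult_strict_right_mono[OF K(2) L] by (simp only: mult.assoc)
        qed
      qed (use n d \<alpha> \<omega> \<eta> R K g1 g2 in auto)
      also have "\<dots> = (d * \<eta> + H * (1 + \<eta>) powr (1 / \<alpha>) + d * \<eta> powr (1 / \<alpha>)) * R"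
      proof -
        have "((1 + \<eta>) * L) powr (1 / \<alpha>) = (1 + \<eta>) powr (1 / \<alpha>) * R"
          "(\<eta> * L) powr (1 / \<alpha>) = \<eta> powr (1 / \<alpha>) * R"
          unfolding R_def using \<eta> L by (simp_all only: powr_mult)
        then show ?thesis unfolding H_def by (simp only: distrib_right mult.assoc)
      qed
      also have "\<dots> \<le> (H + \<epsilon>) * R" using \<eta>H R by (intro mult_right_mono) auto
      finally show "top_eigenvalue n G W \<omega> \<le> (H + \<epsilon>) * ln (real n) powr (1 / \<alpha>)"
        by (simp add: R_def L_def)
    qed
  qed
  show ?thesis unfolding H_def[symmetric] using f main by blast
qed

lemma lower_tail:
  assumes d: "d \<ge> 2" and \<alpha>: "\<alpha> > 0" and law: "weibull_law \<alpha> \<mu>" and \<epsilon>: "\<epsilon> > 0"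
  shows "\<exists>f N. f \<longlonglongrightarrow> 0 \<and> (\<forall>n\<ge>N. \<forall>(M :: 'a measure) G W. weighted_random_regular_graph M d n G W \<mu> \<longrightarrow>
    (\<exists>B\<in>sets M. measure M B \<le> f n \<and> (\<forall>\<omega>\<in>space M - B.
      (limit_const d \<alpha> - \<epsilon>) * ln (real n) powr (1 / \<alpha>)
        \<le> top_eigenvalue n G W \<omega>)))"
proof -
  define H where "H = limit_const d \<alpha>"
  have H: "H > 0" using limit_const_ge_1[OF d, of \<alpha>] by (simp add: H_def)
  obtain c \<eta> :: real where c: "0 \<le> c" "c < H" and \<eta>: "0 < \<eta>" "\<eta> < 1" and cH: "H - \<epsilon> \<le> (1 - \<eta>) powr (1 / \<alpha>) * c"
    using lower_parameters[OF \<alpha> \<epsilon> H] by (elim exE conjE)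
  obtain C1 C2 where C1: "C1 > 0" "\<And>t. t \<ge> 1 \<Longrightarrow> C1 / 2 * exp (- (t powr \<alpha>)) \<le> measure \<mu> {t..}"
    using weibull_lawE[OF law] by metis
  obtain r where r: "\<forall>n. \<forall>E\<in>regular_graphs d n. \<forall>x<n. \<exists>t v. local_witness n \<alpha> c E (gball E r x) t v"
    using local_witness_exists[OF d \<alpha> c(1)] c(2) unfolding H_def by blast
  define \<kappa> where "\<kappa> = min 1 (C1 / 2 * exp (- 1)) ^ 2 ^ (d + 1) ^ r / real ((d + 1) ^ (2 * r))"
  have \<kappa>: "\<kappa> > 0" using C1(1) by (simp add: \<kappa>_def)
  \<comment> \<open>The exponent is of order n^\<eta>: about n disjoint balls, each succeeding with
    probability of order n^(- (1 - \<eta>)).\<close>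
  define f where "f n = exp (- (\<kappa> * (real n * exp (- ((1 - \<eta>) * ln (real n))))))" for n :: nat
  have f: "f \<longlonglongrightarrow> 0"
  proof -
    have "filterlim (\<lambda>n. \<kappa> * real n powr \<eta>) at_top sequentially"
      using \<kappa> \<eta> by real_asymp
    then have "(\<lambda>n. exp (- (\<kappa> * real n powr \<eta>))) \<longlonglongrightarrow> 0"
      by (intro filterlim_compose[OF exp_at_bot] filterlim_compose[OF filterlim_uminus_at_bot_at_top])
    moreover have "\<forall>\<^sub>F n in sequentially. exp (- (\<kappa> * real n powr \<eta>)) = f n"
      using eventually_gt_at_top[of 0]
    proof eventually_elim
      case (elim n)
      have "real n powr \<eta> = real n powr 1 * real n powr (- (1 - \<eta>))"
        unfolding powr_add[symmetric] by simp
      also have "\<dots> = real n * exp (- ((1 - \<eta>) * ln (real n)))"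
        using elim by (simp add: powr_def left_diff_distrib)
      finally show ?case by (simp only: f_def)
    qed
    ultimately show ?thesis by (simp add: tendsto_cong)
  qed
  have main: "\<exists>B\<in>sets M. measure M B \<le> f n \<and> (\<forall>\<omega>\<in>space M - B.
      (H - \<epsilon>) * ln (real n) powr (1 / \<alpha>) \<le> top_eigenvalue n G W \<omega>)"
    if n: "n \<ge> 3" and loc: "weighted_random_regular_graph M d n G W \<mu>"
    for n and M :: "'a measure" and G W
  proof -
    interpret weighted_random_regular_graph M d n G W \<mu> by (rule loc)
    define L where "L = ln (real n)"
    have L: "L > 0" using n by (simp add: L_def)
    define l where "l = ((1 - \<eta>) * L) powr (1 / \<alpha>)"
    have l: "l > 0" "l powr \<alpha> = (1 - \<eta>) * L" using L \<eta> \<alpha> by (auto simp: l_def powr_powr)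
    have n0: "n > 0" using n by simp
    obtain B where B: "B \<in> events" "prob B \<le> exp (- (\<kappa> * (real n * exp (- (l powr \<alpha>)))))"
      and g: "\<forall>\<omega>\<in>space M - B. l * c < top_eigenvalue n G W \<omega>"
      using largest_eigenvalue_lower[OF n0 \<alpha> c(1) l(1) C1 r[THEN spec, of n]] unfolding \<kappa>_def by blast
    have "(H - \<epsilon>) * L powr (1 / \<alpha>) \<le> l * c"
    proof -
      have "(H - \<epsilon>) * L powr (1 / \<alpha>) \<le> ((1 - \<eta>) powr (1 / \<alpha>) * c) * L powr (1 / \<alpha>)"
        using cH by (intro mult_right_mono) auto
      also have "\<dots> = l * c" using L \<eta> by (simp add: l_def powr_mult)
      finally show ?thesis .
    qed
    then show ?thesis using B g unfolding f_def l(2) L_def by (intro bexI[of _ B]) force+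
  qed
  show ?thesis unfolding H_def[symmetric] using f main by blast
qed

text \<open>The value of \<open>measure\<close> outside the \<sigma>-algebra is 0. Covering the
  deviation event by measurable sets thus bounds it without first establishing measurability of the
  eigenvalue.\<close>

lemma measure_le_if_subset_Un:
  assumes "prob_space M" "B1 \<in> sets M" "B2 \<in> sets M" "A \<subseteq> B1 \<union> B2"
  shows "measure M A \<le> measure M B1 + measure M B2"
proof (cases "A \<in> sets M")
  case True
  interpret prob_space M by fact
  have "measure M A \<le> measure M (B1 \<union> B2)" using assms by (intro finite_measure_mono) auto
  then show ?thesis using measure_Un_le[OF assms(2,3)] by linarith
qed (simp add: measure_notin_sets)

lemma largest_eigenvalue_converges:
  fixes M :: "nat \<Rightarrow> 'a measure"
  assumes d: "d \<ge> 2" and \<alpha>: "\<alpha> > 0" and law: "weibull_law \<alpha> \<mu>"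
    and loc: "\<forall>n. n > d \<longrightarrow> even (n * d) \<longrightarrow> weighted_random_regular_graph (M n) d n (G n) (W n) \<mu>"
  shows "converges_in_prob M
    (\<lambda>n \<omega>. largest_eigenvalue (weighted_adjacency_mat n (G n \<omega>) (\<lambda>i j. W n i j \<omega>)) / ln (real n) powr (1 / \<alpha>))
    (limit_const d \<alpha>) (inf sequentially (principal {n. n > d \<and> even (n * d)}))"
  unfolding converges_in_prob_def
proof (intro allI impI)
  fix \<epsilon> :: real assume \<epsilon>: "\<epsilon> > 0"
  define H where "H = limit_const d \<alpha>"
  define lam where "lam n \<omega> = largest_eigenvalue (weighted_adjacency_mat n (G n \<omega>) (\<lambda>i j. W n i j \<omega>))" for n \<omega>
  define L where "L n = ln (real n) powr (1 / \<alpha>)" for n :: nat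
  define S where "S = {n. n > d \<and> even (n * d)}"
  obtain f N where f: "f \<longlonglongrightarrow> 0" and up: "\<forall>n\<ge>N. \<forall>(M :: 'a measure) G W. weighted_random_regular_graph M d n G W \<mu> \<longrightarrow>
    (\<exists>B\<in>sets M. measure M B \<le> f n \<and> (\<forall>\<omega>\<in>space M - B.
      top_eigenvalue n G W \<omega> \<le> (H + \<epsilon>) * ln (real n) powr (1 / \<alpha>)))"
    using upper_tail[OF d \<alpha> law \<epsilon>] unfolding H_def by blast
  obtain g N' where g: "g \<longlonglongrightarrow> 0" and lo: "\<forall>n\<ge>N'. \<forall>(M :: 'a measure) G W. weighted_random_regular_graph M d n G W \<mu> \<longrightarrow>
    (\<exists>B\<in>sets M. measure M B \<le> g n \<and> (\<forall>\<omega>\<in>space M - B.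
      (H - \<epsilon>) * ln (real n) powr (1 / \<alpha>) \<le> top_eigenvalue n G W \<omega>))"
    using lower_tail[OF d \<alpha> law \<epsilon>] unfolding H_def by blast
  define A where "A n = {\<omega> \<in> space (M n). \<bar>lam n \<omega> / L n - H\<bar> > \<epsilon>}" for n
  have le: "measure (M n) (A n) \<le> f n + g n" if n: "n \<ge> N + N'" "n \<in> S" for n
  proof -
    have wr: "weighted_random_regular_graph (M n) d n (G n) (W n) \<mu>" using loc n by (auto simp: S_def)
    then have ps: "prob_space (M n)" by (rule weighted_random_regular_graph.axioms)
    obtain B1 where B1: "B1 \<in> sets (M n)" "measure (M n) B1 \<le> f n"
      "\<forall>\<omega>\<in>space (M n) - B1. lam n \<omega> \<le> (H + \<epsilon>) * L n"
      using up[rule_format, OF _ wr] n unfolding lam_def L_def by auto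
    obtain B2 where B2: "B2 \<in> sets (M n)" "measure (M n) B2 \<le> g n"
      "\<forall>\<omega>\<in>space (M n) - B2. (H - \<epsilon>) * L n \<le> lam n \<omega>"
      using lo[rule_format, OF _ wr] n unfolding lam_def L_def by auto
    have Ln: "L n > 0" using n d by (simp add: L_def S_def)
    have "A n \<subseteq> B1 \<union> B2"
    proof
      fix \<omega> assume \<omega>: "\<omega> \<in> A n"
      show "\<omega> \<in> B1 \<union> B2"
      proof (rule ccontr)
        assume "\<omega> \<notin> B1 \<union> B2"
        then have "lam n \<omega> \<le> (H + \<epsilon>) * L n" "(H - \<epsilon>) * L n \<le> lam n \<omega>"
          using B1(3) B2(3) \<omega> by (auto simp: A_def)
        then have "lam n \<omega> / L n \<le> H + \<epsilon>" "H - \<epsilon> \<le> lam n \<omega> / L n"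
          using Ln by (auto simp: divide_le_eq le_divide_eq)
        then show False using \<omega> by (auto simp: A_def abs_if split: if_splits)
      qed
    qed
    from measure_le_if_subset_Un[OF ps B1(1) B2(1) this] show ?thesis using B1(2) B2(2) by linarith
  qed
  have ev: "\<forall>\<^sub>F n in inf sequentially (principal S). measure (M n) (A n) \<le> f n + g n"
    unfolding eventually_inf_principal using eventually_ge_at_top[of "N + N'"]
    by eventually_elim (use le in auto)
  have lim: "((\<lambda>n. f n + g n) \<longlongrightarrow> 0) (inf sequentially (principal S))"
    using tendsto_add[OF f g] by (intro tendsto_mono[OF inf_le1]) simp
  have "((\<lambda>n. measure (M n) (A n)) \<longlongrightarrow> 0) (inf sequentially (principal S))"
    by (rule tendsto_sandwich[OF _ ev tendsto_const lim]) simp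
  then show "((\<lambda>n. measure (M n) {\<omega> \<in> space (M n).
      \<bar>largest_eigenvalue (weighted_adjacency_mat n (G n \<omega>) (\<lambda>i j. W n i j \<omega>)) / ln (real n) powr (1 / \<alpha>) - limit_const d \<alpha>\<bar> > \<epsilon>})
      \<longlongrightarrow> 0) (inf sequentially (principal {n. n > d \<and> even (n * d)}))"
    unfolding A_def lam_def L_def H_def S_def .
qed

theorem theorem1:
  fixes d :: nat
  assumes "d \<ge> 3"
  shows "\<exists>h :: real \<Rightarrow> real.
    continuous_on {2<..} h \<and>
    h \<in> {2<..} \<rightarrow> {1<..} \<and>
    (\<forall>(\<alpha>::real) (\<mu>::real measure) (M :: nat \<Rightarrow> 'a measure) G W.
       \<alpha> > 0 \<longrightarrow> weibull_law \<alpha> \<mu> \<longrightarrow>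
       (\<forall>n. n > d \<longrightarrow> even (n * d) \<longrightarrow>
          weighted_random_regular_graph (M n) d n (G n) (W n) \<mu>) \<longrightarrow>
       converges_in_prob M
         (\<lambda>n \<omega>. largest_eigenvalue (weighted_adjacency_mat n (G n \<omega>) (\<lambda>i j. W n i j \<omega>))
                / ln (real n) powr (1 / \<alpha>))
         (if \<alpha> \<le> 2 then 1 else h \<alpha>)
         (inf sequentially (principal {n. n > d \<and> even (n * d)}))) \<and>
    (\<forall>\<alpha>>2. h \<alpha> = 2 * (SUP u\<in>l1_unit_sphere (tree_verts d). tree_functional d \<alpha> u)) \<and>
    (h \<longlongrightarrow> 1) (at_right 2) \<and>
    (h \<longlongrightarrow> 2 * sqrt (real d - 1)) at_top"
proof (intro exI[of _ "growth_const d"] conjI allI impI)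
  have d: "d \<ge> 2" using assms by simp
  show "continuous_on {2<..} (growth_const d)" by (rule continuous_on_growth_const[OF d])
  show "growth_const d \<in> {2<..} \<rightarrow> {1<..}" using growth_const_gt_1[OF d] by auto
  show "growth_const d \<alpha> = 2 * (SUP u\<in>l1_unit_sphere (tree_verts d). tree_functional d \<alpha> u)" if "\<alpha> > 2" for \<alpha>
    by (rule growth_const_eq_SUP[OF d that])
  show "(growth_const d \<longlongrightarrow> 1) (at_right 2)" by (rule growth_const_tendsto_at_2[OF d])
  show "(growth_const d \<longlongrightarrow> 2 * sqrt (real d - 1)) at_top" by (rule growth_const_tendsto_at_top[OF d])
next
  fix \<alpha> :: real and \<mu> :: "real measure" and M :: "nat \<Rightarrow> 'a measure" and G W
  assume "\<alpha> > 0" "weibull_law \<alpha> \<mu>"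
    "\<forall>n. n > d \<longrightarrow> even (n * d) \<longrightarrow> weighted_random_regular_graph (M n) d n (G n) (W n) \<mu>"
  then show "converges_in_prob M
         (\<lambda>n \<omega>. largest_eigenvalue (weighted_adjacency_mat n (G n \<omega>) (\<lambda>i j. W n i j \<omega>))
                / ln (real n) powr (1 / \<alpha>))
         (if \<alpha> \<le> 2 then 1 else growth_const d \<alpha>)
         (inf sequentially (principal {n. n > d \<and> even (n * d)}))"
    using largest_eigenvalue_converges[of d \<alpha> \<mu> M G W] assms unfolding limit_const_def by simp
qed

end
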